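(* Let $\mathfrak{A},\mathfrak{B},\mathfrak{C}$ be 2-categories and let $\mathcal{L}:\mathfrak{C}\to\mathfrak{A}$ and $\widehat{\mathcal{L}}:\mathfrak{C}\to\mathfrak{B}$ be pseudofunctors with right biadjoints $\mathcal{U}:\mathfrak{A}\to\mathfrak{C}$ and $\widehat{\mathcal{U}}:\mathfrak{B}\to\mathfrak{C}$ respectively, and assume that $\mathcal{U}$ and $\widehat{\mathcal{U}}$ are local equivalences. If $\mathtt{E}:\mathfrak{B}\to\mathfrak{A}$ is a pseudofunctor such that there is a pseudonatural equivalence $\mathtt{E}\circ\widehat{\mathcal{L}}\simeq\mathcal{L}$, then $\mathtt{E}$ is left biadjoint to a pseudofunctor $\mathtt{R}:\mathfrak{A}\to\mathfrak{B}$ which is a local equivalence.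
   Context: We work with 2-categories, pseudofunctors, pseudonatural transformations and modifications. A pseudofunctor $\mathcal{L}:\mathfrak{C}\to\mathfrak{A}$ is left biadjoint to $\mathcal{U}:\mathfrak{A}\to\mathfrak{C}$ if there are pseudonatural transformations $\eta:\mathrm{Id}\to\mathcal{U}\mathcal{L}$ and $\varepsilon:\mathcal{L}\mathcal{U}\to\mathrm{Id}$ satisfying the triangle identities up to coherent invertible modifications; equivalently, there are equivalences of categories $\mathfrak{A}(\mathcal{L}X,Y)\simeq\mathfrak{C}(X,\mathcal{U}Y)$ pseudonatural in $X$ and $Y$. A pseudofunctor is a local equivalence if it induces equivalences between the hom-categories. *)

theory Defs
  imports Main
begin

section \<open>Categories, functors and equivalences of categories\<close>

record ('o, 'a) cat =
  Ob :: "'o set"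
  Ar :: "'a set"
  Dom :: "'a \<Rightarrow> 'o"
  Cod :: "'a \<Rightarrow> 'o"
  Idn :: "'o \<Rightarrow> 'a"
  Cmp :: "'a \<Rightarrow> 'a \<Rightarrow> 'a"

definition Hom :: "('o, 'a, 'z) cat_scheme \<Rightarrow> 'o \<Rightarrow> 'o \<Rightarrow> 'a set" where
  "Hom K x y = {a \<in> Ar K. Dom K a = x \<and> Cod K a = y}"

locale category =
  fixes K :: "('o, 'a, 'z) cat_scheme" (structure)
  assumes Dom_Ob: "a \<in> Ar K \<Longrightarrow> Dom K a \<in> Ob K"
    and Cod_Ob: "a \<in> Ar K \<Longrightarrow> Cod K a \<in> Ob K"
    and Idn_Hom: "x \<in> Ob K \<Longrightarrow> Idn K x \<in> Hom K x x"
    and Cmp_Hom: "\<lbrakk>a \<in> Hom K x y; b \<in> Hom K y z\<rbrakk> \<Longrightarrow> Cmp K b a \<in> Hom K x z"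
    and Cmp_assoc: "\<lbrakk>a \<in> Hom K w x; b \<in> Hom K x y; c \<in> Hom K y z\<rbrakk>
                      \<Longrightarrow> Cmp K (Cmp K c b) a = Cmp K c (Cmp K b a)"
    and Cmp_Idn_left: "a \<in> Hom K x y \<Longrightarrow> Cmp K (Idn K y) a = a"
    and Cmp_Idn_right: "a \<in> Hom K x y \<Longrightarrow> Cmp K a (Idn K x) = a"

definition inverse_in :: "('o, 'a, 'z) cat_scheme \<Rightarrow> 'a \<Rightarrow> 'a \<Rightarrow> bool" where
  "inverse_in K a b \<longleftrightarrow>
     a \<in> Ar K \<and> b \<in> Hom K (Cod K a) (Dom K a) \<and>
     Cmp K b a = Idn K (Dom K a) \<and> Cmp K a b = Idn K (Cod K a)"

definition Iso :: "('o, 'a, 'z) cat_scheme \<Rightarrow> 'o \<Rightarrow> 'o \<Rightarrow> 'a set" where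
  "Iso K x y = {a \<in> Hom K x y. \<exists>b. inverse_in K a b}"

record ('o, 'a, 'p, 'b) fnc =
  FOb :: "'o \<Rightarrow> 'p"
  FAr :: "'a \<Rightarrow> 'b"

locale functor_between =
  J: category J + K: category K
  for J :: "('o, 'a, 'y) cat_scheme" and K :: "('p, 'b, 'z) cat_scheme" +
  fixes F :: "('o, 'a, 'p, 'b, 'w) fnc_scheme"
  assumes FOb_Ob: "x \<in> Ob J \<Longrightarrow> FOb F x \<in> Ob K"
    and FAr_Hom: "a \<in> Hom J x y \<Longrightarrow> FAr F a \<in> Hom K (FOb F x) (FOb F y)"
    and FAr_Idn: "x \<in> Ob J \<Longrightarrow> FAr F (Idn J x) = Idn K (FOb F x)"
    and FAr_Cmp: "\<lbrakk>a \<in> Hom J x y; b \<in> Hom J y z\<rbrakk>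
                    \<Longrightarrow> FAr F (Cmp J b a) = Cmp K (FAr F b) (FAr F a)"

definition fnc_id :: "('o, 'a, 'o, 'a) fnc" where
  "fnc_id = \<lparr>FOb = (\<lambda>x. x), FAr = (\<lambda>a. a)\<rparr>"

definition fnc_comp ::
  "('p, 'b, 'q, 'c) fnc \<Rightarrow> ('o, 'a, 'p, 'b) fnc \<Rightarrow> ('o, 'a, 'q, 'c) fnc" where
  "fnc_comp G F = \<lparr>FOb = (\<lambda>x. FOb G (FOb F x)), FAr = (\<lambda>a. FAr G (FAr F a))\<rparr>"

locale natural_isomorphism =
  F: functor_between J K F + G: functor_between J K G
  for J :: "('o, 'a, 'y) cat_scheme" and K :: "('p, 'b, 'z) cat_scheme"
    and F :: "('o, 'a, 'p, 'b) fnc" and G :: "('o, 'a, 'p, 'b) fnc" +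
  fixes \<theta> :: "'o \<Rightarrow> 'b"
  assumes component_Iso: "x \<in> Ob J \<Longrightarrow> \<theta> x \<in> Iso K (FOb F x) (FOb G x)"
    and naturality: "a \<in> Hom J x y \<Longrightarrow> Cmp K (FAr G a) (\<theta> x) = Cmp K (\<theta> y) (FAr F a)"

definition equivalence_of_categories ::
  "('o, 'a) cat \<Rightarrow> ('p, 'b) cat \<Rightarrow> ('o, 'a, 'p, 'b) fnc \<Rightarrow> bool" where
  "equivalence_of_categories J K F \<longleftrightarrow>
     functor_between J K F \<and>
     (\<exists>G \<theta> \<kappa>. functor_between K J G \<and>
        natural_isomorphism J J fnc_id (fnc_comp G F) \<theta> \<and>
        natural_isomorphism K K (fnc_comp F G) fnc_id \<kappa>)"


section \<open>2-categories\<close>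

text \<open>
  2-categories are strict. A 1-cell \<open>f\<close> knows its source and target objects, a 2-cell
  \<open>a\<close> its domain and codomain 1-cells. All three compositions are written in the order of
  functional composition: \<open>\<odot>\<close> is composition of 1-cells, \<open>\<cdot>\<close> vertical and \<open>\<star>\<close> horizontal
  composition of 2-cells. Operations are unconstrained outside the carriers.
\<close>

record ('o, 'm, 'c) two_cat =
  Obj :: "'o set"
  Arr :: "'m set"
  Cell :: "'c set"
  src :: "'m \<Rightarrow> 'o"
  tgt :: "'m \<Rightarrow> 'o"
  dom2 :: "'c \<Rightarrow> 'm"
  cod2 :: "'c \<Rightarrow> 'm"
  id1 :: "'o \<Rightarrow> 'm"
  cmp1 :: "'m \<Rightarrow> 'm \<Rightarrow> 'm"  (infixr "\<odot>\<index>" 75)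
  id2 :: "'m \<Rightarrow> 'c"
  vcmp :: "'c \<Rightarrow> 'c \<Rightarrow> 'c"  (infixr "\<cdot>\<index>" 65)
  hcmp :: "'c \<Rightarrow> 'c \<Rightarrow> 'c"  (infixr "\<star>\<index>" 70)

definition hom1 :: "('o, 'm, 'c, 'z) two_cat_scheme \<Rightarrow> 'o \<Rightarrow> 'o \<Rightarrow> 'm set" where
  "hom1 C X Y = {f \<in> Arr C. src C f = X \<and> tgt C f = Y}"

definition hom2 :: "('o, 'm, 'c, 'z) two_cat_scheme \<Rightarrow> 'm \<Rightarrow> 'm \<Rightarrow> 'c set" where
  "hom2 C f g = {a \<in> Cell C. dom2 C a = f \<and> cod2 C a = g}"

definition hom_cat :: "('o, 'm, 'c, 'z) two_cat_scheme \<Rightarrow> 'o \<Rightarrow> 'o \<Rightarrow> ('m, 'c) cat" where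
  "hom_cat C X Y =
     \<lparr>Ob = hom1 C X Y, Ar = {a \<in> Cell C. dom2 C a \<in> hom1 C X Y},
      Dom = dom2 C, Cod = cod2 C, Idn = id2 C, Cmp = vcmp C\<rparr>"

abbreviation lwhisk :: "('o, 'm, 'c, 'z) two_cat_scheme \<Rightarrow> 'm \<Rightarrow> 'c \<Rightarrow> 'c"  (infixr "\<rhd>\<index>" 70) where
  "g \<rhd>\<^bsub>C\<^esub> a \<equiv> id2 C g \<star>\<^bsub>C\<^esub> a"

abbreviation rwhisk :: "('o, 'm, 'c, 'z) two_cat_scheme \<Rightarrow> 'c \<Rightarrow> 'm \<Rightarrow> 'c"  (infixr "\<lhd>\<index>" 70) where
  "a \<lhd>\<^bsub>C\<^esub> f \<equiv> a \<star>\<^bsub>C\<^esub> id2 C f"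

locale two_category =
  fixes C :: "('o, 'm, 'c, 'z) two_cat_scheme" (structure)
  assumes src_Obj: "f \<in> Arr C \<Longrightarrow> src C f \<in> Obj C"
    and tgt_Obj: "f \<in> Arr C \<Longrightarrow> tgt C f \<in> Obj C"
    and id1_hom: "X \<in> Obj C \<Longrightarrow> id1 C X \<in> hom1 C X X"
    and cmp1_hom: "\<lbrakk>f \<in> hom1 C X Y; g \<in> hom1 C Y Z\<rbrakk> \<Longrightarrow> g \<odot> f \<in> hom1 C X Z"
    and cmp1_assoc: "\<lbrakk>f \<in> hom1 C W X; g \<in> hom1 C X Y; h \<in> hom1 C Y Z\<rbrakk>
                       \<Longrightarrow> (h \<odot> g) \<odot> f = h \<odot> (g \<odot> f)"
    and cmp1_id_left: "f \<in> hom1 C X Y \<Longrightarrow> id1 C Y \<odot> f = f"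
    and cmp1_id_right: "f \<in> hom1 C X Y \<Longrightarrow> f \<odot> id1 C X = f"
    and dom2_Arr: "a \<in> Cell C \<Longrightarrow> dom2 C a \<in> Arr C"
    and cod2_parallel: "a \<in> Cell C \<Longrightarrow> cod2 C a \<in> hom1 C (src C (dom2 C a)) (tgt C (dom2 C a))"
    and hom_category: "\<lbrakk>X \<in> Obj C; Y \<in> Obj C\<rbrakk> \<Longrightarrow> category (hom_cat C X Y)"
    and hcmp_hom: "\<lbrakk>f \<in> hom1 C X Y; g \<in> hom1 C Y Z; a \<in> hom2 C f f'; b \<in> hom2 C g g'\<rbrakk>
                     \<Longrightarrow> b \<star> a \<in> hom2 C (g \<odot> f) (g' \<odot> f')"
    and hcmp_id2: "\<lbrakk>f \<in> hom1 C X Y; g \<in> hom1 C Y Z\<rbrakk> \<Longrightarrow> id2 C g \<star> id2 C f = id2 C (g \<odot> f)"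
    and interchange: "\<lbrakk>f \<in> hom1 C X Y; g \<in> hom1 C Y Z;
                       a \<in> hom2 C f f'; a' \<in> hom2 C f' f''; b \<in> hom2 C g g'; b' \<in> hom2 C g' g''\<rbrakk>
                       \<Longrightarrow> (b' \<cdot> b) \<star> (a' \<cdot> a) = (b' \<star> a') \<cdot> (b \<star> a)"
    and hcmp_assoc: "\<lbrakk>f \<in> hom1 C W X; g \<in> hom1 C X Y; h \<in> hom1 C Y Z;
                      a \<in> hom2 C f f'; b \<in> hom2 C g g'; c \<in> hom2 C h h'\<rbrakk>
                      \<Longrightarrow> (c \<star> b) \<star> a = c \<star> (b \<star> a)"
    and hcmp_id_left: "\<lbrakk>f \<in> hom1 C X Y; a \<in> hom2 C f f'\<rbrakk> \<Longrightarrow> id2 C (id1 C Y) \<star> a = a"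
    and hcmp_id_right: "\<lbrakk>f \<in> hom1 C X Y; a \<in> hom2 C f f'\<rbrakk> \<Longrightarrow> a \<star> id2 C (id1 C X) = a"

definition iso2 :: "('o, 'm, 'c, 'z) two_cat_scheme \<Rightarrow> 'm \<Rightarrow> 'm \<Rightarrow> 'c set" where
  "iso2 C f g = Iso (hom_cat C (src C f) (tgt C f)) f g"

definition inv2 :: "('o, 'm, 'c, 'z) two_cat_scheme \<Rightarrow> 'c \<Rightarrow> 'c" where
  "inv2 C a = (THE b. inverse_in (hom_cat C (src C (dom2 C a)) (tgt C (dom2 C a))) a b)"


section \<open>Pseudofunctors\<close>

text \<open>
  The comparison 2-cells of a pseudofunctor \<open>F\<close> are
  \<open>PCmp F g f : F g \<odot> F f \<Rightarrow> F (g \<odot> f)\<close> and \<open>PUnit F X : 1 \<Rightarrow> F 1\<close>.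
\<close>

record ('o, 'm, 'c, 'p, 'n, 'd) psfun =
  PObj :: "'o \<Rightarrow> 'p"
  PArr :: "'m \<Rightarrow> 'n"
  PCell :: "'c \<Rightarrow> 'd"
  PCmp :: "'m \<Rightarrow> 'm \<Rightarrow> 'd"
  PUnit :: "'o \<Rightarrow> 'd"

definition hom_functor :: "('o, 'm, 'c, 'p, 'n, 'd) psfun \<Rightarrow> ('m, 'c, 'n, 'd) fnc" where
  "hom_functor F = \<lparr>FOb = PArr F, FAr = PCell F\<rparr>"

locale pseudofunctor =
  C: two_category C + D: two_category D
  for C :: "('o, 'm, 'c) two_cat" and D :: "('p, 'n, 'd) two_cat" +
  fixes F :: "('o, 'm, 'c, 'p, 'n, 'd) psfun"
  assumes PObj_Obj: "X \<in> Obj C \<Longrightarrow> PObj F X \<in> Obj D"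
    and hom_functor: "\<lbrakk>X \<in> Obj C; Y \<in> Obj C\<rbrakk>
          \<Longrightarrow> functor_between (hom_cat C X Y) (hom_cat D (PObj F X) (PObj F Y)) (hom_functor F)"
    and PCmp_iso2: "\<lbrakk>f \<in> hom1 C X Y; g \<in> hom1 C Y Z\<rbrakk>
          \<Longrightarrow> PCmp F g f \<in> iso2 D (PArr F g \<odot>\<^bsub>D\<^esub> PArr F f) (PArr F (g \<odot>\<^bsub>C\<^esub> f))"
    and PUnit_iso2: "X \<in> Obj C \<Longrightarrow> PUnit F X \<in> iso2 D (id1 D (PObj F X)) (PArr F (id1 C X))"
    and PCmp_natural: "\<lbrakk>f \<in> hom1 C X Y; g \<in> hom1 C Y Z; a \<in> hom2 C f f'; b \<in> hom2 C g g'\<rbrakk>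
          \<Longrightarrow> PCmp F g' f' \<cdot>\<^bsub>D\<^esub> (PCell F b \<star>\<^bsub>D\<^esub> PCell F a) = PCell F (b \<star>\<^bsub>C\<^esub> a) \<cdot>\<^bsub>D\<^esub> PCmp F g f"
    and PCmp_assoc: "\<lbrakk>f \<in> hom1 C W X; g \<in> hom1 C X Y; h \<in> hom1 C Y Z\<rbrakk>
          \<Longrightarrow> PCmp F (h \<odot>\<^bsub>C\<^esub> g) f \<cdot>\<^bsub>D\<^esub> (PCmp F h g \<lhd>\<^bsub>D\<^esub> PArr F f)
              = PCmp F h (g \<odot>\<^bsub>C\<^esub> f) \<cdot>\<^bsub>D\<^esub> (PArr F h \<rhd>\<^bsub>D\<^esub> PCmp F g f)"
    and PUnit_left: "f \<in> hom1 C X Y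
          \<Longrightarrow> PCmp F (id1 C Y) f \<cdot>\<^bsub>D\<^esub> (PUnit F Y \<lhd>\<^bsub>D\<^esub> PArr F f) = id2 D (PArr F f)"
    and PUnit_right: "f \<in> hom1 C X Y
          \<Longrightarrow> PCmp F f (id1 C X) \<cdot>\<^bsub>D\<^esub> (PArr F f \<rhd>\<^bsub>D\<^esub> PUnit F X) = id2 D (PArr F f)"

definition ps_id :: "('o, 'm, 'c) two_cat \<Rightarrow> ('o, 'm, 'c, 'o, 'm, 'c) psfun" where
  "ps_id C =
     \<lparr>PObj = (\<lambda>X. X), PArr = (\<lambda>f. f), PCell = (\<lambda>a. a),
      PCmp = (\<lambda>g f. id2 C (g \<odot>\<^bsub>C\<^esub> f)), PUnit = (\<lambda>X. id2 C (id1 C X))\<rparr>"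

text \<open>The composite \<open>G F\<close>; the first argument is the codomain of \<open>G\<close>.\<close>

definition ps_comp ::
  "('q, 'r, 'e) two_cat \<Rightarrow> ('p, 'n, 'd, 'q, 'r, 'e) psfun \<Rightarrow> ('o, 'm, 'c, 'p, 'n, 'd) psfun
     \<Rightarrow> ('o, 'm, 'c, 'q, 'r, 'e) psfun" where
  "ps_comp E G F =
     \<lparr>PObj = (\<lambda>X. PObj G (PObj F X)),
      PArr = (\<lambda>f. PArr G (PArr F f)),
      PCell = (\<lambda>a. PCell G (PCell F a)),
      PCmp = (\<lambda>g f. PCell G (PCmp F g f) \<cdot>\<^bsub>E\<^esub> PCmp G (PArr F g) (PArr F f)),
      PUnit = (\<lambda>X. PCell G (PUnit F X) \<cdot>\<^bsub>E\<^esub> PUnit G (PObj F X))\<rparr>"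

definition local_equivalence ::
  "('o, 'm, 'c) two_cat \<Rightarrow> ('p, 'n, 'd) two_cat \<Rightarrow> ('o, 'm, 'c, 'p, 'n, 'd) psfun \<Rightarrow> bool" where
  "local_equivalence C D F \<longleftrightarrow>
     (\<forall>X\<in>Obj C. \<forall>Y\<in>Obj C.
        equivalence_of_categories (hom_cat C X Y) (hom_cat D (PObj F X) (PObj F Y)) (hom_functor F))"


section \<open>Pseudonatural transformations and modifications\<close>

text \<open>
  A pseudonatural transformation \<open>\<tau> : F \<rightarrow> G\<close> has 1-cells \<open>TArr \<tau> X : F X \<rightarrow> G X\<close> and,
  for \<open>f : X \<rightarrow> Y\<close>, invertible 2-cells \<open>TCell \<tau> f : G f \<odot> \<tau> X \<Rightarrow> \<tau> Y \<odot> F f\<close>.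
\<close>

record ('o, 'm, 'n, 'd) pstrans =
  TArr :: "'o \<Rightarrow> 'n"
  TCell :: "'m \<Rightarrow> 'd"

locale pseudonatural =
  F: pseudofunctor C D F + G: pseudofunctor C D G
  for C :: "('o, 'm, 'c) two_cat" and D :: "('p, 'n, 'd) two_cat"
    and F :: "('o, 'm, 'c, 'p, 'n, 'd) psfun" and G :: "('o, 'm, 'c, 'p, 'n, 'd) psfun" +
  fixes \<tau> :: "('o, 'm, 'n, 'd) pstrans"
  assumes TArr_hom: "X \<in> Obj C \<Longrightarrow> TArr \<tau> X \<in> hom1 D (PObj F X) (PObj G X)"
    and TCell_iso2: "f \<in> hom1 C X Y
          \<Longrightarrow> TCell \<tau> f \<in> iso2 D (PArr G f \<odot>\<^bsub>D\<^esub> TArr \<tau> X) (TArr \<tau> Y \<odot>\<^bsub>D\<^esub> PArr F f)"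
    and TCell_natural: "\<lbrakk>f \<in> hom1 C X Y; a \<in> hom2 C f f'\<rbrakk>
          \<Longrightarrow> (TArr \<tau> Y \<rhd>\<^bsub>D\<^esub> PCell F a) \<cdot>\<^bsub>D\<^esub> TCell \<tau> f = TCell \<tau> f' \<cdot>\<^bsub>D\<^esub> (PCell G a \<lhd>\<^bsub>D\<^esub> TArr \<tau> X)"
    and TCell_unit: "X \<in> Obj C
          \<Longrightarrow> TCell \<tau> (id1 C X) \<cdot>\<^bsub>D\<^esub> (PUnit G X \<lhd>\<^bsub>D\<^esub> TArr \<tau> X) = TArr \<tau> X \<rhd>\<^bsub>D\<^esub> PUnit F X"
    and TCell_cmp: "\<lbrakk>f \<in> hom1 C X Y; g \<in> hom1 C Y Z\<rbrakk>
          \<Longrightarrow> TCell \<tau> (g \<odot>\<^bsub>C\<^esub> f) \<cdot>\<^bsub>D\<^esub> (PCmp G g f \<lhd>\<^bsub>D\<^esub> TArr \<tau> X)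
              = (TArr \<tau> Z \<rhd>\<^bsub>D\<^esub> PCmp F g f) \<cdot>\<^bsub>D\<^esub> (TCell \<tau> g \<lhd>\<^bsub>D\<^esub> PArr F f) \<cdot>\<^bsub>D\<^esub> (PArr G g \<rhd>\<^bsub>D\<^esub> TCell \<tau> f)"

definition tr_id ::
  "('p, 'n, 'd) two_cat \<Rightarrow> ('o, 'm, 'c, 'p, 'n, 'd) psfun \<Rightarrow> ('o, 'm, 'n, 'd) pstrans" where
  "tr_id D F = \<lparr>TArr = (\<lambda>X. id1 D (PObj F X)), TCell = (\<lambda>f. id2 D (PArr F f))\<rparr>"

text \<open>The composite of \<open>\<tau> : F \<rightarrow> G\<close> followed by \<open>\<sigma> : G \<rightarrow> H\<close>, for \<open>F, G, H : C \<rightarrow> D\<close>.\<close>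

definition tr_comp ::
  "('o, 'm, 'c) two_cat \<Rightarrow> ('p, 'n, 'd) two_cat
     \<Rightarrow> ('o, 'm, 'n, 'd) pstrans \<Rightarrow> ('o, 'm, 'n, 'd) pstrans \<Rightarrow> ('o, 'm, 'n, 'd) pstrans" where
  "tr_comp C D \<sigma> \<tau> =
     \<lparr>TArr = (\<lambda>X. TArr \<sigma> X \<odot>\<^bsub>D\<^esub> TArr \<tau> X),
      TCell = (\<lambda>f. (TArr \<sigma> (tgt C f) \<rhd>\<^bsub>D\<^esub> TCell \<tau> f) \<cdot>\<^bsub>D\<^esub> (TCell \<sigma> f \<lhd>\<^bsub>D\<^esub> TArr \<tau> (src C f)))\<rparr>"

text \<open>\<open>\<tau> K : F K \<rightarrow> G K\<close> for \<open>\<tau> : F \<rightarrow> G\<close>.\<close>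

definition tr_pre ::
  "('o, 'm, 'n, 'd) pstrans \<Rightarrow> ('q, 'r, 'e, 'o, 'm, 'c) psfun \<Rightarrow> ('q, 'r, 'n, 'd) pstrans" where
  "tr_pre \<tau> K = \<lparr>TArr = (\<lambda>X. TArr \<tau> (PObj K X)), TCell = (\<lambda>f. TCell \<tau> (PArr K f))\<rparr>"

text \<open>
  \<open>K \<tau> : K F \<rightarrow> K G\<close> for \<open>\<tau> : F \<rightarrow> G\<close> with \<open>F, G : C \<rightarrow> D\<close> and \<open>K : D \<rightarrow> E\<close>. Its 2-cell at
  \<open>f : X \<rightarrow> Y\<close> is \<open>K G f \<odot> K \<tau> X \<Rightarrow> K (G f \<odot> \<tau> X) \<Rightarrow> K (\<tau> Y \<odot> F f) \<Rightarrow> K \<tau> Y \<odot> K F f\<close>.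
\<close>

definition tr_post ::
  "('o, 'm, 'c) two_cat \<Rightarrow> ('q, 'r, 'e) two_cat \<Rightarrow> ('p, 'n, 'd, 'q, 'r, 'e) psfun
     \<Rightarrow> ('o, 'm, 'c, 'p, 'n, 'd) psfun \<Rightarrow> ('o, 'm, 'c, 'p, 'n, 'd) psfun
     \<Rightarrow> ('o, 'm, 'n, 'd) pstrans \<Rightarrow> ('o, 'm, 'r, 'e) pstrans" where
  "tr_post C E K F G \<tau> =
     \<lparr>TArr = (\<lambda>X. PArr K (TArr \<tau> X)),
      TCell = (\<lambda>f. inv2 E (PCmp K (TArr \<tau> (tgt C f)) (PArr F f)) \<cdot>\<^bsub>E\<^esub>
                   PCell K (TCell \<tau> f) \<cdot>\<^bsub>E\<^esub>
                   PCmp K (PArr G f) (TArr \<tau> (src C f)))\<rparr>"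

locale invertible_modification =
  \<sigma>: pseudonatural C D F G \<sigma> + \<tau>: pseudonatural C D F G \<tau>
  for C :: "('o, 'm, 'c) two_cat" and D :: "('p, 'n, 'd) two_cat"
    and F :: "('o, 'm, 'c, 'p, 'n, 'd) psfun" and G :: "('o, 'm, 'c, 'p, 'n, 'd) psfun"
    and \<sigma> :: "('o, 'm, 'n, 'd) pstrans" and \<tau> :: "('o, 'm, 'n, 'd) pstrans" +
  fixes \<Gamma> :: "'o \<Rightarrow> 'd"
  assumes component_iso2: "X \<in> Obj C \<Longrightarrow> \<Gamma> X \<in> iso2 D (TArr \<sigma> X) (TArr \<tau> X)"
    and naturality: "f \<in> hom1 C X Y
          \<Longrightarrow> TCell \<tau> f \<cdot>\<^bsub>D\<^esub> (PArr G f \<rhd>\<^bsub>D\<^esub> \<Gamma> X) = (\<Gamma> Y \<lhd>\<^bsub>D\<^esub> PArr F f) \<cdot>\<^bsub>D\<^esub> TCell \<sigma> f"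

text \<open>Equivalence in the 2-category of pseudofunctors \<open>C \<rightarrow> D\<close>.\<close>

definition pseudonatural_equivalence ::
  "('o, 'm, 'c) two_cat \<Rightarrow> ('p, 'n, 'd) two_cat
     \<Rightarrow> ('o, 'm, 'c, 'p, 'n, 'd) psfun \<Rightarrow> ('o, 'm, 'c, 'p, 'n, 'd) psfun
     \<Rightarrow> ('o, 'm, 'n, 'd) pstrans \<Rightarrow> bool" where
  "pseudonatural_equivalence C D F G \<tau> \<longleftrightarrow>
     pseudonatural C D F G \<tau> \<and>
     (\<exists>\<sigma> \<Gamma> \<Delta>. pseudonatural C D G F \<sigma> \<and>
        invertible_modification C D F F (tr_id D F) (tr_comp C D \<sigma> \<tau>) \<Gamma> \<and>
        invertible_modification C D G G (tr_comp C D \<tau> \<sigma>) (tr_id D G) \<Delta>)"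


section \<open>Biadjunctions\<close>

text \<open>
  \<open>L : C \<rightarrow> A\<close> is left biadjoint to \<open>U : A \<rightarrow> C\<close>, with unit \<open>\<eta>\<close>, counit \<open>\<epsilon>\<close> and invertible
  modifications \<open>s : id L \<Rightarrow> \<epsilon> L \<cdot> L \<eta>\<close> and \<open>t : U \<epsilon> \<cdot> \<eta> U \<Rightarrow> id U\<close> filling the triangles.
  Coherence of \<open>s\<close> and \<open>t\<close> means that the two composites below are identities:

  \<open>\<eta> X \<Rightarrow> U 1 \<odot> \<eta> X \<Rightarrow> U (\<epsilon> L X \<odot> L \<eta> X) \<odot> \<eta> X \<Rightarrow> U \<epsilon> L X \<odot> U L \<eta> X \<odot> \<eta> X
       \<Rightarrow> U \<epsilon> L X \<odot> \<eta> U L X \<odot> \<eta> X \<Rightarrow> \<eta> X\<close>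

  \<open>\<epsilon> Y \<Rightarrow> \<epsilon> Y \<odot> \<epsilon> L U Y \<odot> L \<eta> U Y \<Rightarrow> \<epsilon> Y \<odot> L U \<epsilon> Y \<odot> L \<eta> U Y
       \<Rightarrow> \<epsilon> Y \<odot> L (U \<epsilon> Y \<odot> \<eta> U Y) \<Rightarrow> \<epsilon> Y \<odot> L 1 \<Rightarrow> \<epsilon> Y\<close>

  (the ``swallowtail'' equations). Since composition of pseudofunctors is strictly unital and
  associative on carriers, \<open>L \<eta>\<close>, \<open>\<epsilon> L\<close> etc. are composed without associativity constraints.
\<close>

locale biadjunction =
  L: pseudofunctor C A L + U: pseudofunctor A C U
  + \<eta>: pseudonatural C C "ps_id C" "ps_comp C U L" \<eta>
  + \<epsilon>: pseudonatural A A "ps_comp A L U" "ps_id A" \<epsilon>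
  + s: invertible_modification C A L L
         "tr_id A L" "tr_comp C A (tr_pre \<epsilon> L) (tr_post C A L (ps_id C) (ps_comp C U L) \<eta>)" s
  + t: invertible_modification A C U U
         "tr_comp A C (tr_post A C U (ps_comp A L U) (ps_id A) \<epsilon>) (tr_pre \<eta> U)" "tr_id C U" t
  for C :: "('o, 'm, 'c) two_cat" and A :: "('p, 'n, 'd) two_cat"
    and L :: "('o, 'm, 'c, 'p, 'n, 'd) psfun" and U :: "('p, 'n, 'd, 'o, 'm, 'c) psfun"
    and \<eta> :: "('o, 'm, 'm, 'c) pstrans" and \<epsilon> :: "('p, 'n, 'n, 'd) pstrans"
    and s :: "'o \<Rightarrow> 'd" and t :: "'p \<Rightarrow> 'c" +
  assumes swallowtail_unit: "X \<in> Obj C \<Longrightarrow>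
      (t (PObj L X) \<lhd>\<^bsub>C\<^esub> TArr \<eta> X)
      \<cdot>\<^bsub>C\<^esub> (PArr U (TArr \<epsilon> (PObj L X)) \<rhd>\<^bsub>C\<^esub> TCell \<eta> (TArr \<eta> X))
      \<cdot>\<^bsub>C\<^esub> (inv2 C (PCmp U (TArr \<epsilon> (PObj L X)) (PArr L (TArr \<eta> X))) \<lhd>\<^bsub>C\<^esub> TArr \<eta> X)
      \<cdot>\<^bsub>C\<^esub> (PCell U (s X) \<lhd>\<^bsub>C\<^esub> TArr \<eta> X)
      \<cdot>\<^bsub>C\<^esub> (PUnit U (PObj L X) \<lhd>\<^bsub>C\<^esub> TArr \<eta> X)
      = id2 C (TArr \<eta> X)"
    and swallowtail_counit: "Y \<in> Obj A \<Longrightarrow>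
      (TArr \<epsilon> Y \<rhd>\<^bsub>A\<^esub> inv2 A (PUnit L (PObj U Y)))
      \<cdot>\<^bsub>A\<^esub> (TArr \<epsilon> Y \<rhd>\<^bsub>A\<^esub> PCell L (t Y))
      \<cdot>\<^bsub>A\<^esub> (TArr \<epsilon> Y \<rhd>\<^bsub>A\<^esub> PCmp L (PArr U (TArr \<epsilon> Y)) (TArr \<eta> (PObj U Y)))
      \<cdot>\<^bsub>A\<^esub> (TCell \<epsilon> (TArr \<epsilon> Y) \<lhd>\<^bsub>A\<^esub> PArr L (TArr \<eta> (PObj U Y)))
      \<cdot>\<^bsub>A\<^esub> (TArr \<epsilon> Y \<rhd>\<^bsub>A\<^esub> s (PObj U Y))
      = id2 A (TArr \<epsilon> Y)"

definition left_biadjoint ::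
  "('o, 'm, 'c) two_cat \<Rightarrow> ('p, 'n, 'd) two_cat
     \<Rightarrow> ('o, 'm, 'c, 'p, 'n, 'd) psfun \<Rightarrow> ('p, 'n, 'd, 'o, 'm, 'c) psfun \<Rightarrow> bool" where
  "left_biadjoint C A L U \<longleftrightarrow> (\<exists>\<eta> \<epsilon> s t. biadjunction C A L U \<eta> \<epsilon> s t)"

end

theory Submission
  imports Defs
begin

text \<open>
  The right biadjoint is \<open>R = L' U\<close>, with counit \<open>E L' U \<simeq> L U \<rightarrow> 1\<close>. Because \<open>U\<close> and \<open>U'\<close> are local
  equivalences, the counits \<open>\<epsilon>\<close> and \<open>\<epsilon>'\<close> are equivalences, so \<open>L' \<eta>'\<close> is an equivalence, hence so is
  \<open>L \<eta>' \<simeq> E L' \<eta>'\<close>, and therefore \<open>\<eta>'\<close> is an equivalence at the objects \<open>U Y\<close>. It follows that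
  \<open>L' : C(X, U Y) \<rightarrow> B(L' X, L' U Y)\<close> is an equivalence; comparing it with the transposition
  \<open>C(X, U Y) \<simeq> A(L X, Y)\<close> shows that \<open>g \<mapsto> counit Y \<odot> E g\<close> is an equivalence \<open>B(X, R Y) \<simeq> A(E X, Y)\<close> for \<open>X\<close>
  in the image of \<open>L'\<close>, and every \<open>X\<close> is equivalent to \<open>L' U' X\<close>. The unit, the second triangle
  modification and all coherence equations are then obtained from the universality of the counit.
\<close>

section \<open>Calculus in a 2-category\<close>

text \<open>The formula for \<open>R\<close> is forced. If \<open>E\<close> has a right biadjoint
  \<open>R\<close>, then \<open>U' R\<close> is right biadjoint to \<open>E L' \<simeq> L\<close>,
  so \<open>U' R \<simeq> U\<close>; since \<epsilon>' is an equivalence,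
  \<open>R \<simeq> L' U' R \<simeq> L' U\<close>. The obstacle is coherence: pasting the given
  units and triangle cells together would leave two large swallowtail equations to verify. Hence
  only the counit is assembled from given data. The arguments about equivalences work with 1-cells
  up to isomorphism and with functors that are fully faithful and essentially surjective, and their
  outcome is that transposition along the counit is such a functor. Coherence is confined to a
  general construction: a 2-cell of \<open>B\<close> between 1-cells into \<open>R Y\<close> is
  determined by its transpose in \<open>A\<close>, so each missing cell can be defined by an
  equation that it has to satisfy, and each axiom can be checked after transposing. Local
  equivalence of \<open>R\<close> has the same source: \<open>R\<close> followed by transposition is
  isomorphic to precomposition with the counit, which is an equivalence.\<close>

lemma hom1_iff [simp]: "f \<in> hom1 C X Y \<longleftrightarrow> f \<in> Arr C \<and> src C f = X \<and> tgt C f = Y"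
  by (simp add: hom1_def)

lemma hom2_iff [simp]: "a \<in> hom2 C f g \<longleftrightarrow> a \<in> Cell C \<and> dom2 C a = f \<and> cod2 C a = g"
  by (simp add: hom2_def)

lemma hom_cat_simps [simp]:
  "Ob (hom_cat C X Y) = hom1 C X Y"
  "Ar (hom_cat C X Y) = {a \<in> Cell C. dom2 C a \<in> hom1 C X Y}"
  "Dom (hom_cat C X Y) = dom2 C" "Cod (hom_cat C X Y) = cod2 C"
  "Idn (hom_cat C X Y) = id2 C" "Cmp (hom_cat C X Y) = vcmp C"
  by (simp_all add: hom_cat_def)

lemma Hom_hom_cat [simp]:
  "a \<in> Hom (hom_cat C X Y) f g \<longleftrightarrow>
     a \<in> Cell C \<and> dom2 C a = f \<and> cod2 C a = g \<and> f \<in> Arr C \<and> src C f = X \<and> tgt C f = Y"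
  by (auto simp: Hom_def)

text \<open>Invertibility with no hom-category as a parameter, so that simp can propagate it through
  pastings; \<open>Iso_hom_cat\<close> and \<open>iso2_iff\<close> translate to and from the
  official notions.\<close>

definition isocell :: "('o, 'm, 'c, 'z) two_cat_scheme \<Rightarrow> 'c \<Rightarrow> bool" where
  "isocell C a \<longleftrightarrow> a \<in> Cell C \<and>
     (\<exists>b. b \<in> Cell C \<and> dom2 C b = cod2 C a \<and> cod2 C b = dom2 C a \<and>
        vcmp C b a = id2 C (dom2 C a) \<and> vcmp C a b = id2 C (cod2 C a))"

context two_category
begin

declare src_Obj [simp] tgt_Obj [simp] dom2_Arr [simp]

lemma id1_simps [simp]:
  assumes "X \<in> Obj C"
  shows "id1 C X \<in> Arr C" "src C (id1 C X) = X" "tgt C (id1 C X) = X"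
  using id1_hom[OF assms] by simp_all

lemma cmp1_simps [simp]:
  assumes "f \<in> Arr C" "g \<in> Arr C" "src C g = tgt C f"
  shows "g \<odot> f \<in> Arr C" "src C (g \<odot> f) = src C f" "tgt C (g \<odot> f) = tgt C g"
  using cmp1_hom[of f "src C f" "tgt C f" g "tgt C g"] assms by simp_all

lemma cmp1_assoc_simp [simp]:
  "\<lbrakk>f \<in> Arr C; g \<in> Arr C; h \<in> Arr C; src C g = tgt C f; src C h = tgt C g\<rbrakk>
     \<Longrightarrow> (h \<odot> g) \<odot> f = h \<odot> (g \<odot> f)"
  using cmp1_assoc[of f _ _ g _ h] by simp

lemma cmp1_id_simps [simp]:
  "\<lbrakk>f \<in> Arr C; tgt C f = Y\<rbrakk> \<Longrightarrow> id1 C Y \<odot> f = f"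
  "\<lbrakk>f \<in> Arr C; src C f = X\<rbrakk> \<Longrightarrow> f \<odot> id1 C X = f"
  using cmp1_id_left[of f _ Y] cmp1_id_right[of f X] by simp_all

lemma cod2_simps [simp]:
  assumes "a \<in> Cell C"
  shows "cod2 C a \<in> Arr C" "src C (cod2 C a) = src C (dom2 C a)" "tgt C (cod2 C a) = tgt C (dom2 C a)"
  using cod2_parallel[OF assms] by simp_all

lemma id2_simps [simp]:
  assumes "f \<in> Arr C"
  shows "id2 C f \<in> Cell C" "dom2 C (id2 C f) = f" "cod2 C (id2 C f) = f"
  using category.Idn_Hom[OF hom_category[of "src C f" "tgt C f"], of f] assms by simp_all

lemma vcmp_simps [simp]:
  assumes "a \<in> Cell C" "b \<in> Cell C" "dom2 C b = cod2 C a"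
  shows "b \<cdot> a \<in> Cell C" "dom2 C (b \<cdot> a) = dom2 C a" "cod2 C (b \<cdot> a) = cod2 C b"
  using category.Cmp_Hom[OF hom_category[of "src C (dom2 C a)" "tgt C (dom2 C a)"],
      of a "dom2 C a" "cod2 C a" b "cod2 C b"] assms by simp_all

lemma vcmp_assoc [simp]:
  "\<lbrakk>a \<in> Cell C; b \<in> Cell C; c \<in> Cell C; dom2 C b = cod2 C a; dom2 C c = cod2 C b\<rbrakk>
     \<Longrightarrow> (c \<cdot> b) \<cdot> a = c \<cdot> (b \<cdot> a)"
  using category.Cmp_assoc[OF hom_category[of "src C (dom2 C a)" "tgt C (dom2 C a)"],
      of a "dom2 C a" "cod2 C a" b "cod2 C b" c "cod2 C c"] by simp

lemma vcmp_id_simps [simp]: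
  "\<lbrakk>a \<in> Cell C; cod2 C a = g\<rbrakk> \<Longrightarrow> id2 C g \<cdot> a = a"
  "\<lbrakk>a \<in> Cell C; dom2 C a = f\<rbrakk> \<Longrightarrow> a \<cdot> id2 C f = a"
  using category.Cmp_Idn_left[OF hom_category[of "src C (dom2 C a)" "tgt C (dom2 C a)"],
      of a "dom2 C a" "cod2 C a"]
    category.Cmp_Idn_right[OF hom_category[of "src C (dom2 C a)" "tgt C (dom2 C a)"],
      of a "dom2 C a" "cod2 C a"] by auto

lemma hcmp_simps [simp]:
  assumes "a \<in> Cell C" "b \<in> Cell C" "src C (dom2 C b) = tgt C (dom2 C a)"
  shows "b \<star> a \<in> Cell C" "dom2 C (b \<star> a) = dom2 C b \<odot> dom2 C a"
    "cod2 C (b \<star> a) = cod2 C b \<odot> cod2 C a"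
  using hcmp_hom[of "dom2 C a" "src C (dom2 C a)" "tgt C (dom2 C a)" "dom2 C b" "tgt C (dom2 C b)"
      a "cod2 C a" b "cod2 C b"] assms by simp_all

lemma hcmp_id2_simp [simp]:
  "\<lbrakk>f \<in> Arr C; g \<in> Arr C; src C g = tgt C f\<rbrakk> \<Longrightarrow> id2 C g \<star> id2 C f = id2 C (g \<odot> f)"
  using hcmp_id2[of f _ _ g] by simp

lemma hcmp_assoc_simp [simp]:
  "\<lbrakk>a \<in> Cell C; b \<in> Cell C; c \<in> Cell C; src C (dom2 C b) = tgt C (dom2 C a);
    src C (dom2 C c) = tgt C (dom2 C b)\<rbrakk> \<Longrightarrow> (c \<star> b) \<star> a = c \<star> (b \<star> a)"
  using hcmp_assoc[of "dom2 C a" "src C (dom2 C a)" "tgt C (dom2 C a)" "dom2 C b" "tgt C (dom2 C b)"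
      "dom2 C c" "tgt C (dom2 C c)" a "cod2 C a" b "cod2 C b" c "cod2 C c"] by simp

lemma hcmp_id_simps [simp]:
  "\<lbrakk>a \<in> Cell C; tgt C (dom2 C a) = Y\<rbrakk> \<Longrightarrow> id2 C (id1 C Y) \<star> a = a"
  "\<lbrakk>a \<in> Cell C; src C (dom2 C a) = X\<rbrakk> \<Longrightarrow> a \<star> id2 C (id1 C X) = a"
  using hcmp_id_left[of "dom2 C a" _ Y a] hcmp_id_right[of "dom2 C a" X _ a] by simp_all

text \<open>Associating to the right merges successive right whiskerings by itself but keeps left
  ones apart; this rule joins the latter. Every whiskered cell then has the normal form
  \<open>g \<rhd> a \<lhd> f\<close>.\<close>

lemma lwhisk_lwhisk [simp]:
  assumes "a \<in> Cell C" "g \<in> Arr C" "h \<in> Arr C" "src C g = tgt C (dom2 C a)" "src C h = tgt C g"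
  shows "h \<rhd> g \<rhd> a = (h \<odot> g) \<rhd> a"
  using hcmp_assoc_simp[of a "id2 C g" "id2 C h"] assms by simp

text \<open>Interchange against an identity cell. As a simp rule it spreads a pasting into a
  vertical chain of whiskered cells.\<close>

lemma whisk_vcmp [simp]:
  "\<lbrakk>a \<in> Cell C; b \<in> Cell C; dom2 C b = cod2 C a; g \<in> Arr C; src C g = tgt C (dom2 C a)\<rbrakk>
     \<Longrightarrow> g \<rhd> (b \<cdot> a) = (g \<rhd> b) \<cdot> (g \<rhd> a)"
  "\<lbrakk>a \<in> Cell C; b \<in> Cell C; dom2 C b = cod2 C a; f \<in> Arr C; src C (dom2 C a) = tgt C f\<rbrakk>
     \<Longrightarrow> (b \<cdot> a) \<lhd> f = (b \<lhd> f) \<cdot> (a \<lhd> f)"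
  using interchange[of "dom2 C a" "src C (dom2 C a)" "tgt C (dom2 C a)" g "tgt C g" a "cod2 C a" b "cod2 C b"
      "id2 C g" g "id2 C g" g]
    interchange[of f "src C f" "tgt C f" "dom2 C a" "tgt C (dom2 C a)" "id2 C f" f "id2 C f" f
      a "cod2 C a" b "cod2 C b"]
  by simp_all

lemma hcmp_whisk:
  assumes "a \<in> Cell C" "b \<in> Cell C" "src C (dom2 C b) = tgt C (dom2 C a)"
  shows "b \<star> a = (b \<lhd> cod2 C a) \<cdot> (dom2 C b \<rhd> a)" "b \<star> a = (cod2 C b \<rhd> a) \<cdot> (b \<lhd> dom2 C a)"
  using interchange[of "dom2 C a" "src C (dom2 C a)" "tgt C (dom2 C a)" "dom2 C b" "tgt C (dom2 C b)"
      a "cod2 C a" "id2 C (cod2 C a)" "cod2 C a" "id2 C (dom2 C b)" "dom2 C b" b "cod2 C b"]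
    interchange[of "dom2 C a" "src C (dom2 C a)" "tgt C (dom2 C a)" "dom2 C b" "tgt C (dom2 C b)"
      "id2 C (dom2 C a)" "dom2 C a" a "cod2 C a" b "cod2 C b" "id2 C (cod2 C b)" "cod2 C b"]
    assms by simp_all

text \<open>Two cells acting on disjoint stretches of a composite may be performed in either order.
  The normal form does not prefer one of the orders, so this law is invoked through explicit
  instances.\<close>

lemma exchange:
  assumes "a \<in> Cell C" "b \<in> Cell C" "src C (dom2 C b) = tgt C (dom2 C a)"
  shows "(b \<lhd> cod2 C a) \<cdot> (dom2 C b \<rhd> a) = (cod2 C b \<rhd> a) \<cdot> (b \<lhd> dom2 C a)"
  using hcmp_whisk[of a b] assms by metis

text \<open>In a right-nested chain the pair \<open>x \<cdot> y\<close> is not a subterm of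
  \<open>x \<cdot> y \<cdot> r\<close>. This turns an equation for the pair into a rewrite rule that
  fires in front of a tail.\<close>

lemma reassoc:
  assumes "x \<cdot> y = z" "x \<in> Cell C" "y \<in> Cell C" "r \<in> Cell C" "dom2 C x = cod2 C y" "dom2 C y = cod2 C r"
  shows "x \<cdot> y \<cdot> r = z \<cdot> r"
  using assms vcmp_assoc[of r y x] by simp

lemma reassoc3:
  assumes "x \<cdot> y \<cdot> w = z" "x \<in> Cell C" "y \<in> Cell C" "w \<in> Cell C" "r \<in> Cell C"
    "dom2 C x = cod2 C y" "dom2 C y = cod2 C w" "dom2 C w = cod2 C r"
  shows "x \<cdot> y \<cdot> w \<cdot> r = z \<cdot> r"
proof -
  have "(x \<cdot> y \<cdot> w) \<cdot> r = z \<cdot> r"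
    by (simp only: assms(1))
  then show ?thesis
    using assms(2-) by simp
qed

section \<open>Invertible 2-cells and their inverses\<close>

lemma isocell_Cell [simp]: "isocell C a \<Longrightarrow> a \<in> Cell C"
  by (simp add: isocell_def)

lemma inverse_in_hom_cat:
  assumes "a \<in> Cell C" "X = src C (dom2 C a)" "Y = tgt C (dom2 C a)"
  shows "inverse_in (hom_cat C X Y) a b \<longleftrightarrow>
     b \<in> Cell C \<and> dom2 C b = cod2 C a \<and> cod2 C b = dom2 C a \<and>
        b \<cdot> a = id2 C (dom2 C a) \<and> a \<cdot> b = id2 C (cod2 C a)"
  using assms by (auto simp: inverse_in_def)

lemma Iso_hom_cat [simp]:
  "a \<in> Iso (hom_cat C X Y) f g \<longleftrightarrow>
     isocell C a \<and> dom2 C a = f \<and> cod2 C a = g \<and> src C f = X \<and> tgt C f = Y"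
proof (cases "a \<in> Cell C \<and> dom2 C a = f \<and> src C f = X \<and> tgt C f = Y")
  case True
  then have "inverse_in (hom_cat C X Y) a b \<longleftrightarrow>
     b \<in> Cell C \<and> dom2 C b = cod2 C a \<and> cod2 C b = dom2 C a \<and>
        b \<cdot> a = id2 C (dom2 C a) \<and> a \<cdot> b = id2 C (cod2 C a)" for b
    by (intro inverse_in_hom_cat) auto
  with True show ?thesis
    by (auto simp: Iso_def isocell_def simp del: isocell_Cell)
next
  case False
  then show ?thesis
    by (auto simp: Iso_def isocell_def simp del: isocell_Cell)
qed

lemma iso2_iff [simp]: "a \<in> iso2 C f g \<longleftrightarrow> isocell C a \<and> dom2 C a = f \<and> cod2 C a = g"
  by (auto simp: iso2_def)

lemma inverse_unique:
  assumes "a \<in> Cell C" "b \<in> Cell C" "b' \<in> Cell C" "dom2 C b = cod2 C a" "cod2 C b = dom2 C a"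
    "dom2 C b' = cod2 C a" "cod2 C b' = dom2 C a" "b \<cdot> a = id2 C (dom2 C a)" "a \<cdot> b' = id2 C (cod2 C a)"
  shows "b = b'"
  using vcmp_assoc[of b' a b] assms by simp

lemma inv2_simps [simp]:
  assumes "isocell C a"
  shows "inv2 C a \<in> Cell C" "dom2 C (inv2 C a) = cod2 C a" "cod2 C (inv2 C a) = dom2 C a"
    "inv2 C a \<cdot> a = id2 C (dom2 C a)" "a \<cdot> inv2 C a = id2 C (cod2 C a)"
proof -
  obtain b where b: "b \<in> Cell C" "dom2 C b = cod2 C a" "cod2 C b = dom2 C a"
    "b \<cdot> a = id2 C (dom2 C a)" "a \<cdot> b = id2 C (cod2 C a)"
    using assms by (auto simp: isocell_def simp del: isocell_Cell)
  have a: "a \<in> Cell C"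
    using assms by simp
  have "inv2 C a = b"
    unfolding inv2_def inverse_in_hom_cat[OF a refl refl]
    using b inverse_unique[OF a] by (intro the_equality) auto
  with b show "inv2 C a \<in> Cell C" "dom2 C (inv2 C a) = cod2 C a" "cod2 C (inv2 C a) = dom2 C a"
    "inv2 C a \<cdot> a = id2 C (dom2 C a)" "a \<cdot> inv2 C a = id2 C (cod2 C a)"
    by simp_all
qed

lemma inv2_cancel [simp]:
  "\<lbrakk>isocell C a; r \<in> Cell C; dom2 C a = cod2 C r\<rbrakk> \<Longrightarrow> inv2 C a \<cdot> a \<cdot> r = r"
  "\<lbrakk>isocell C a; r \<in> Cell C; cod2 C a = cod2 C r\<rbrakk> \<Longrightarrow> a \<cdot> inv2 C a \<cdot> r = r"
  using vcmp_assoc[of r a "inv2 C a"] vcmp_assoc[of r "inv2 C a" a] by simp_all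

lemma isocellI:
  assumes "a \<in> Cell C" "b \<in> Cell C" "dom2 C b = cod2 C a" "cod2 C b = dom2 C a"
    "b \<cdot> a = id2 C (dom2 C a)" "a \<cdot> b = id2 C (cod2 C a)"
  shows "isocell C a"
  using assms by (auto simp: isocell_def simp del: isocell_Cell)

lemma isocell_inv2 [simp]: "isocell C a \<Longrightarrow> isocell C (inv2 C a)"
  by (rule isocellI[of _ a]) simp_all

lemma isocell_id2 [simp]: "f \<in> Arr C \<Longrightarrow> isocell C (id2 C f)"
  by (rule isocellI[of _ "id2 C f"]) simp_all

lemma isocell_vcmp [simp]:
  "\<lbrakk>isocell C a; isocell C b; dom2 C b = cod2 C a\<rbrakk> \<Longrightarrow> isocell C (b \<cdot> a)"
  by (rule isocellI[of _ "inv2 C a \<cdot> inv2 C b"]) simp_all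

lemma isocell_lwhisk [simp]:
  assumes "isocell C a" "g \<in> Arr C" "src C g = tgt C (dom2 C a)"
  shows "isocell C (g \<rhd> a)"
proof (rule isocellI[of _ "g \<rhd> inv2 C a"])
  show "(g \<rhd> inv2 C a) \<cdot> (g \<rhd> a) = id2 C (dom2 C (g \<rhd> a))"
    using assms whisk_vcmp(1)[of a "inv2 C a" g] by simp
  show "(g \<rhd> a) \<cdot> (g \<rhd> inv2 C a) = id2 C (cod2 C (g \<rhd> a))"
    using assms whisk_vcmp(1)[of "inv2 C a" a g] by simp
qed (use assms in simp_all)

lemma isocell_rwhisk [simp]:
  assumes "isocell C a" "f \<in> Arr C" "src C (dom2 C a) = tgt C f"
  shows "isocell C (a \<lhd> f)"
proof (rule isocellI[of _ "inv2 C a \<lhd> f"])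
  show "(inv2 C a \<lhd> f) \<cdot> (a \<lhd> f) = id2 C (dom2 C (a \<lhd> f))"
    using assms whisk_vcmp(2)[of a "inv2 C a" f] by simp
  show "(a \<lhd> f) \<cdot> (inv2 C a \<lhd> f) = id2 C (cod2 C (a \<lhd> f))"
    using assms whisk_vcmp(2)[of "inv2 C a" a f] by simp
qed (use assms in simp_all)

lemma iso_right_cancel:
  assumes "isocell C a" "x \<in> Cell C" "y \<in> Cell C" "dom2 C x = cod2 C a" "dom2 C y = cod2 C a"
    "x \<cdot> a = y \<cdot> a"
  shows "x = y"
proof -
  have "(x \<cdot> a) \<cdot> inv2 C a = (y \<cdot> a) \<cdot> inv2 C a"
    by (simp only: assms)
  then show ?thesis
    using assms(1-5) by simp
qed

lemma iso_left_cancel: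
  assumes "isocell C a" "x \<in> Cell C" "y \<in> Cell C" "cod2 C x = dom2 C a" "cod2 C y = dom2 C a"
    "a \<cdot> x = a \<cdot> y"
  shows "x = y"
proof -
  have "inv2 C a \<cdot> (a \<cdot> x) = inv2 C a \<cdot> (a \<cdot> y)"
    by (simp only: assms)
  then show ?thesis
    using assms(1-5) by simp
qed

end

section \<open>Calculus of pseudofunctors and pseudonatural transformations\<close>

context pseudofunctor
begin

declare PObj_Obj [simp]

lemma PArr_simps [simp]:
  assumes "f \<in> Arr C"
  shows "PArr F f \<in> Arr D" "src D (PArr F f) = PObj F (src C f)" "tgt D (PArr F f) = PObj F (tgt C f)"
  using functor_between.FOb_Ob[OF hom_functor[of "src C f" "tgt C f"], of f] assms
  by (simp_all add: hom_functor_def)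

lemma PCell_simps [simp]:
  assumes "a \<in> Cell C"
  shows "PCell F a \<in> Cell D" "dom2 D (PCell F a) = PArr F (dom2 C a)"
    "cod2 D (PCell F a) = PArr F (cod2 C a)"
  using functor_between.FAr_Hom[OF hom_functor[of "src C (dom2 C a)" "tgt C (dom2 C a)"],
      of a "dom2 C a" "cod2 C a"] assms
  by (simp_all add: hom_functor_def)

lemma PCell_id2 [simp]: "f \<in> Arr C \<Longrightarrow> PCell F (id2 C f) = id2 D (PArr F f)"
  using functor_between.FAr_Idn[OF hom_functor[of "src C f" "tgt C f"], of f]
  by (simp add: hom_functor_def)

lemma PCell_vcmp [simp]:
  "\<lbrakk>a \<in> Cell C; b \<in> Cell C; dom2 C b = cod2 C a\<rbrakk>
     \<Longrightarrow> PCell F (b \<cdot>\<^bsub>C\<^esub> a) = PCell F b \<cdot>\<^bsub>D\<^esub> PCell F a"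
  using functor_between.FAr_Cmp[OF hom_functor[of "src C (dom2 C a)" "tgt C (dom2 C a)"],
      of a "dom2 C a" "cod2 C a" b "cod2 C b"]
  by (simp add: hom_functor_def)

lemma PCell_isocell [simp]:
  assumes "isocell C a"
  shows "isocell D (PCell F a)"
  using assms C.inv2_simps[OF assms] PCell_vcmp[of a "inv2 C a"] PCell_vcmp[of "inv2 C a" a]
  by (intro D.isocellI[of _ "PCell F (inv2 C a)"]) (simp_all del: PCell_vcmp)

lemma PCmp_simps [simp]:
  assumes "f \<in> Arr C" "g \<in> Arr C" "src C g = tgt C f"
  shows "isocell D (PCmp F g f)" "PCmp F g f \<in> Cell D" "dom2 D (PCmp F g f) = PArr F g \<odot>\<^bsub>D\<^esub> PArr F f"
    "cod2 D (PCmp F g f) = PArr F (g \<odot>\<^bsub>C\<^esub> f)"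
  using PCmp_iso2[of f _ _ g] assms by simp_all

lemma PUnit_simps [simp]:
  assumes "X \<in> Obj C"
  shows "isocell D (PUnit F X)" "PUnit F X \<in> Cell D" "dom2 D (PUnit F X) = id1 D (PObj F X)"
    "cod2 D (PUnit F X) = PArr F (id1 C X)"
  using PUnit_iso2[of X] assms by simp_all

lemma PCmp_rwhisk:
  assumes "a \<in> Cell C" "dom2 C a = g" "cod2 C a = g'" "f \<in> Arr C" "src C g = tgt C f"
  shows "PCmp F g' f \<cdot>\<^bsub>D\<^esub> (PCell F a \<lhd>\<^bsub>D\<^esub> PArr F f) = PCell F (a \<lhd>\<^bsub>C\<^esub> f) \<cdot>\<^bsub>D\<^esub> PCmp F g f"
  using PCmp_natural[of f _ _ g _ "id2 C f" f a g'] assms by auto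

lemma PCmp_lwhisk:
  assumes "a \<in> Cell C" "dom2 C a = f" "cod2 C a = f'" "g \<in> Arr C" "src C g = tgt C f"
  shows "PCmp F g f' \<cdot>\<^bsub>D\<^esub> (PArr F g \<rhd>\<^bsub>D\<^esub> PCell F a) = PCell F (g \<rhd>\<^bsub>C\<^esub> a) \<cdot>\<^bsub>D\<^esub> PCmp F g f"
  using PCmp_natural[of f _ _ g _ a f' "id2 C g" g] assms by auto

lemma PCmp_assoc_simp:
  "\<lbrakk>f \<in> Arr C; g \<in> Arr C; h \<in> Arr C; src C g = tgt C f; src C h = tgt C g\<rbrakk>
     \<Longrightarrow> PCmp F (h \<odot>\<^bsub>C\<^esub> g) f \<cdot>\<^bsub>D\<^esub> (PCmp F h g \<lhd>\<^bsub>D\<^esub> PArr F f)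
         = PCmp F h (g \<odot>\<^bsub>C\<^esub> f) \<cdot>\<^bsub>D\<^esub> (PArr F h \<rhd>\<^bsub>D\<^esub> PCmp F g f)"
  using PCmp_assoc[of f _ _ g _ h] by simp

lemma PUnit_unit_simps:
  "\<lbrakk>f \<in> Arr C; tgt C f = Y\<rbrakk> \<Longrightarrow> PCmp F (id1 C Y) f \<cdot>\<^bsub>D\<^esub> (PUnit F Y \<lhd>\<^bsub>D\<^esub> PArr F f) = id2 D (PArr F f)"
  "\<lbrakk>f \<in> Arr C; src C f = X\<rbrakk> \<Longrightarrow> PCmp F f (id1 C X) \<cdot>\<^bsub>D\<^esub> (PArr F f \<rhd>\<^bsub>D\<^esub> PUnit F X) = id2 D (PArr F f)"
  using PUnit_left[of f _ Y] PUnit_right[of f X] by simp_all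

end

text \<open>The axioms are phrased with equations for \<open>src\<close>, \<open>tgt\<close>,
  \<open>dom2\<close> and \<open>cod2\<close> instead of membership in hom-sets, and functoriality
  on hom-categories is split up, so that simp can discharge the premises.\<close>

lemma pseudofunctorI:
  assumes "two_category C" "two_category D"
    and PObj: "\<And>X. X \<in> Obj C \<Longrightarrow> PObj F X \<in> Obj D"
    and PArr: "\<And>f. f \<in> Arr C \<Longrightarrow> PArr F f \<in> Arr D \<and> src D (PArr F f) = PObj F (src C f) \<and>
           tgt D (PArr F f) = PObj F (tgt C f)"
    and PCell: "\<And>a. a \<in> Cell C \<Longrightarrow> PCell F a \<in> Cell D \<and> dom2 D (PCell F a) = PArr F (dom2 C a) \<and>
           cod2 D (PCell F a) = PArr F (cod2 C a)"
    and id2: "\<And>f. f \<in> Arr C \<Longrightarrow> PCell F (id2 C f) = id2 D (PArr F f)"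
    and vcmp: "\<And>a b. \<lbrakk>a \<in> Cell C; b \<in> Cell C; dom2 C b = cod2 C a\<rbrakk>
           \<Longrightarrow> PCell F (b \<cdot>\<^bsub>C\<^esub> a) = PCell F b \<cdot>\<^bsub>D\<^esub> PCell F a"
    and PCmp: "\<And>f g. \<lbrakk>f \<in> Arr C; g \<in> Arr C; src C g = tgt C f\<rbrakk>
           \<Longrightarrow> isocell D (PCmp F g f) \<and> dom2 D (PCmp F g f) = PArr F g \<odot>\<^bsub>D\<^esub> PArr F f \<and>
               cod2 D (PCmp F g f) = PArr F (g \<odot>\<^bsub>C\<^esub> f)"
    and PUnit: "\<And>X. X \<in> Obj C
           \<Longrightarrow> isocell D (PUnit F X) \<and> dom2 D (PUnit F X) = id1 D (PObj F X) \<and>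
               cod2 D (PUnit F X) = PArr F (id1 C X)"
    and natural: "\<And>a b. \<lbrakk>a \<in> Cell C; b \<in> Cell C; src C (dom2 C b) = tgt C (dom2 C a)\<rbrakk>
           \<Longrightarrow> PCmp F (cod2 C b) (cod2 C a) \<cdot>\<^bsub>D\<^esub> (PCell F b \<star>\<^bsub>D\<^esub> PCell F a)
               = PCell F (b \<star>\<^bsub>C\<^esub> a) \<cdot>\<^bsub>D\<^esub> PCmp F (dom2 C b) (dom2 C a)"
    and assoc: "\<And>f g h. \<lbrakk>f \<in> Arr C; g \<in> Arr C; h \<in> Arr C; src C g = tgt C f; src C h = tgt C g\<rbrakk>
           \<Longrightarrow> PCmp F (h \<odot>\<^bsub>C\<^esub> g) f \<cdot>\<^bsub>D\<^esub> (PCmp F h g \<lhd>\<^bsub>D\<^esub> PArr F f)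
              = PCmp F h (g \<odot>\<^bsub>C\<^esub> f) \<cdot>\<^bsub>D\<^esub> (PArr F h \<rhd>\<^bsub>D\<^esub> PCmp F g f)"
    and unit: "\<And>f. f \<in> Arr C
           \<Longrightarrow> PCmp F (id1 C (tgt C f)) f \<cdot>\<^bsub>D\<^esub> (PUnit F (tgt C f) \<lhd>\<^bsub>D\<^esub> PArr F f) = id2 D (PArr F f)"
       "\<And>f. f \<in> Arr C
           \<Longrightarrow> PCmp F f (id1 C (src C f)) \<cdot>\<^bsub>D\<^esub> (PArr F f \<rhd>\<^bsub>D\<^esub> PUnit F (src C f)) = id2 D (PArr F f)"
  shows "pseudofunctor C D F"
proof -
  interpret C: two_category C by fact
  interpret D: two_category D by fact
  show ?thesis
  proof (intro pseudofunctor.intro pseudofunctor_axioms.intro)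
    fix X Y assume XY: "X \<in> Obj C" "Y \<in> Obj C"
    interpret J: category "hom_cat C X Y" using XY by (rule C.hom_category)
    interpret K: category "hom_cat D (PObj F X) (PObj F Y)" using XY PObj by (intro D.hom_category)
    show "functor_between (hom_cat C X Y) (hom_cat D (PObj F X) (PObj F Y)) (hom_functor F)"
      by unfold_locales (auto simp: hom_functor_def PArr PCell id2 vcmp)
  qed (use assms in auto)
qed

context pseudonatural
begin

lemma TArr_simps [simp]:
  assumes "X \<in> Obj C"
  shows "TArr \<tau> X \<in> Arr D" "src D (TArr \<tau> X) = PObj F X" "tgt D (TArr \<tau> X) = PObj G X"
  using TArr_hom[OF assms] by simp_all

lemma TCell_simps [simp]:
  assumes "f \<in> Arr C"
  shows "isocell D (TCell \<tau> f)" "TCell \<tau> f \<in> Cell D"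
    "dom2 D (TCell \<tau> f) = PArr G f \<odot>\<^bsub>D\<^esub> TArr \<tau> (src C f)"
    "cod2 D (TCell \<tau> f) = TArr \<tau> (tgt C f) \<odot>\<^bsub>D\<^esub> PArr F f"
  using TCell_iso2[of f] assms by simp_all

lemma TCell_natural_simp:
  assumes "a \<in> Cell C" "dom2 C a = f" "cod2 C a = f'" "src C f = X" "tgt C f = Y"
  shows "(TArr \<tau> Y \<rhd>\<^bsub>D\<^esub> PCell F a) \<cdot>\<^bsub>D\<^esub> TCell \<tau> f = TCell \<tau> f' \<cdot>\<^bsub>D\<^esub> (PCell G a \<lhd>\<^bsub>D\<^esub> TArr \<tau> X)"
  using TCell_natural[of f X Y a f'] assms by auto

lemma TCell_cmp_simp:
  "\<lbrakk>f \<in> Arr C; g \<in> Arr C; src C g = tgt C f; src C f = X; tgt C g = Z\<rbrakk>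
     \<Longrightarrow> TCell \<tau> (g \<odot>\<^bsub>C\<^esub> f) \<cdot>\<^bsub>D\<^esub> (PCmp G g f \<lhd>\<^bsub>D\<^esub> TArr \<tau> X)
         = (TArr \<tau> Z \<rhd>\<^bsub>D\<^esub> PCmp F g f) \<cdot>\<^bsub>D\<^esub> (TCell \<tau> g \<lhd>\<^bsub>D\<^esub> PArr F f) \<cdot>\<^bsub>D\<^esub> (PArr G g \<rhd>\<^bsub>D\<^esub> TCell \<tau> f)"
  using TCell_cmp[of f X _ g Z] by simp

end

lemma pseudonaturalI:
  assumes "pseudofunctor C D F" "pseudofunctor C D G"
    and TArr: "\<And>X. X \<in> Obj C \<Longrightarrow> TArr \<tau> X \<in> Arr D \<and> src D (TArr \<tau> X) = PObj F X \<and> tgt D (TArr \<tau> X) = PObj G X"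
    and TCell: "\<And>f. f \<in> Arr C \<Longrightarrow> isocell D (TCell \<tau> f) \<and> dom2 D (TCell \<tau> f) = PArr G f \<odot>\<^bsub>D\<^esub> TArr \<tau> (src C f) \<and>
           cod2 D (TCell \<tau> f) = TArr \<tau> (tgt C f) \<odot>\<^bsub>D\<^esub> PArr F f"
    and natural: "\<And>a. a \<in> Cell C
           \<Longrightarrow> (TArr \<tau> (tgt C (dom2 C a)) \<rhd>\<^bsub>D\<^esub> PCell F a) \<cdot>\<^bsub>D\<^esub> TCell \<tau> (dom2 C a)
              = TCell \<tau> (cod2 C a) \<cdot>\<^bsub>D\<^esub> (PCell G a \<lhd>\<^bsub>D\<^esub> TArr \<tau> (src C (dom2 C a)))"
    and unit: "\<And>X. X \<in> Obj C
           \<Longrightarrow> TCell \<tau> (id1 C X) \<cdot>\<^bsub>D\<^esub> (PUnit G X \<lhd>\<^bsub>D\<^esub> TArr \<tau> X) = TArr \<tau> X \<rhd>\<^bsub>D\<^esub> PUnit F X"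
    and cmp: "\<And>f g. \<lbrakk>f \<in> Arr C; g \<in> Arr C; src C g = tgt C f\<rbrakk>
           \<Longrightarrow> TCell \<tau> (g \<odot>\<^bsub>C\<^esub> f) \<cdot>\<^bsub>D\<^esub> (PCmp G g f \<lhd>\<^bsub>D\<^esub> TArr \<tau> (src C f))
              = (TArr \<tau> (tgt C g) \<rhd>\<^bsub>D\<^esub> PCmp F g f) \<cdot>\<^bsub>D\<^esub> (TCell \<tau> g \<lhd>\<^bsub>D\<^esub> PArr F f) \<cdot>\<^bsub>D\<^esub> (PArr G g \<rhd>\<^bsub>D\<^esub> TCell \<tau> f)"
  shows "pseudonatural C D F G \<tau>"
proof -
  interpret F: pseudofunctor C D F by fact
  interpret G: pseudofunctor C D G by fact
  show ?thesis
    by unfold_locales (use assms in auto)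
qed

section \<open>Composition of pseudofunctors and pseudonatural transformations\<close>

lemma pseudofunctor_ps_id:
  assumes "two_category C"
  shows "pseudofunctor C C (ps_id C)"
proof -
  interpret two_category C by fact
  show ?thesis
    by (rule pseudofunctorI) (auto simp: ps_id_def two_category_axioms)
qed

lemma ps_id_simps [simp]:
  "PObj (ps_id C) X = X" "PArr (ps_id C) f = f" "PCell (ps_id C) a = a"
  "PCmp (ps_id C) g f = id2 C (g \<odot>\<^bsub>C\<^esub> f)" "PUnit (ps_id C) X = id2 C (id1 C X)"
  by (simp_all add: ps_id_def)

lemma ps_comp_simps [simp]:
  "PObj (ps_comp E G F) X = PObj G (PObj F X)" "PArr (ps_comp E G F) f = PArr G (PArr F f)"
  "PCell (ps_comp E G F) a = PCell G (PCell F a)"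
  "PCmp (ps_comp E G F) g f = PCell G (PCmp F g f) \<cdot>\<^bsub>E\<^esub> PCmp G (PArr F g) (PArr F f)"
  "PUnit (ps_comp E G F) X = PCell G (PUnit F X) \<cdot>\<^bsub>E\<^esub> PUnit G (PObj F X)"
  by (simp_all add: ps_comp_def)

lemma tr_id_simps [simp]:
  "TArr (tr_id D F) X = id1 D (PObj F X)" "TCell (tr_id D F) f = id2 D (PArr F f)"
  by (simp_all add: tr_id_def)

lemma tr_pre_simps [simp]:
  "TArr (tr_pre \<tau> K) X = TArr \<tau> (PObj K X)" "TCell (tr_pre \<tau> K) f = TCell \<tau> (PArr K f)"
  by (simp_all add: tr_pre_def)

lemma tr_comp_simps [simp]:
  "TArr (tr_comp C D \<sigma> \<tau>) X = TArr \<sigma> X \<odot>\<^bsub>D\<^esub> TArr \<tau> X"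
  "TCell (tr_comp C D \<sigma> \<tau>) f =
     (TArr \<sigma> (tgt C f) \<rhd>\<^bsub>D\<^esub> TCell \<tau> f) \<cdot>\<^bsub>D\<^esub> (TCell \<sigma> f \<lhd>\<^bsub>D\<^esub> TArr \<tau> (src C f))"
  by (simp_all add: tr_comp_def)

text \<open>Each axiom combines the same axiom for \<open>G\<close> at images under \<open>F\<close>
  with the image under \<open>G\<close> of the axiom for \<open>F\<close>; naturality of
  \<open>PCmp G\<close> moves the comparison cells of \<open>G\<close> past the images of those of
  \<open>F\<close>.\<close>

lemma pseudofunctor_ps_comp:
  assumes "pseudofunctor C D F" "pseudofunctor D E G"
  shows "pseudofunctor C E (ps_comp E G F)"
proof -
  interpret F: pseudofunctor C D F by fact
  interpret G: pseudofunctor D E G by fact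
  let ?H = "ps_comp E G F"
  show ?thesis
  proof (rule pseudofunctorI)
    fix a b assume ab: "a \<in> Cell C" "b \<in> Cell C" "src C (dom2 C b) = tgt C (dom2 C a)"
    have 1: "PCmp G (PArr F (cod2 C b)) (PArr F (cod2 C a)) \<cdot>\<^bsub>E\<^esub> (PCell G (PCell F b) \<star>\<^bsub>E\<^esub> PCell G (PCell F a))
      = PCell G (PCell F b \<star>\<^bsub>D\<^esub> PCell F a) \<cdot>\<^bsub>E\<^esub> PCmp G (PArr F (dom2 C b)) (PArr F (dom2 C a))"
      using ab by (intro G.PCmp_natural[of _ _ _ _ "PObj F (tgt C (dom2 C b))"]) auto
    have 2: "PCmp F (cod2 C b) (cod2 C a) \<cdot>\<^bsub>D\<^esub> (PCell F b \<star>\<^bsub>D\<^esub> PCell F a)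
      = PCell F (b \<star>\<^bsub>C\<^esub> a) \<cdot>\<^bsub>D\<^esub> PCmp F (dom2 C b) (dom2 C a)"
      using ab by (intro F.PCmp_natural[of _ _ _ _ "tgt C (dom2 C b)"]) auto
    have 3: "PCell G (PCmp F (cod2 C b) (cod2 C a)) \<cdot>\<^bsub>E\<^esub> PCell G (PCell F b \<star>\<^bsub>D\<^esub> PCell F a)
      = PCell G (PCell F (b \<star>\<^bsub>C\<^esub> a)) \<cdot>\<^bsub>E\<^esub> PCell G (PCmp F (dom2 C b) (dom2 C a))"
      using arg_cong[OF 2, of "PCell G"] ab by simp
    show "PCmp ?H (cod2 C b) (cod2 C a) \<cdot>\<^bsub>E\<^esub> (PCell ?H b \<star>\<^bsub>E\<^esub> PCell ?H a)
      = PCell ?H (b \<star>\<^bsub>C\<^esub> a) \<cdot>\<^bsub>E\<^esub> PCmp ?H (dom2 C b) (dom2 C a)"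
      using ab by (simp add: 1 G.D.reassoc[OF 3])
  next
    fix f g h assume fgh: "f \<in> Arr C" "g \<in> Arr C" "h \<in> Arr C" "src C g = tgt C f" "src C h = tgt C g"
    have 1: "PCmp G (PArr F (h \<odot>\<^bsub>C\<^esub> g)) (PArr F f) \<cdot>\<^bsub>E\<^esub> (PCell G (PCmp F h g) \<lhd>\<^bsub>E\<^esub> PArr G (PArr F f))
      = PCell G (PCmp F h g \<lhd>\<^bsub>D\<^esub> PArr F f) \<cdot>\<^bsub>E\<^esub> PCmp G (PArr F h \<odot>\<^bsub>D\<^esub> PArr F g) (PArr F f)"
      using fgh by (intro G.PCmp_rwhisk) auto
    have 2: "PCmp G (PArr F h) (PArr F (g \<odot>\<^bsub>C\<^esub> f)) \<cdot>\<^bsub>E\<^esub> (PArr G (PArr F h) \<rhd>\<^bsub>E\<^esub> PCell G (PCmp F g f))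
      = PCell G (PArr F h \<rhd>\<^bsub>D\<^esub> PCmp F g f) \<cdot>\<^bsub>E\<^esub> PCmp G (PArr F h) (PArr F g \<odot>\<^bsub>D\<^esub> PArr F f)"
      using fgh by (intro G.PCmp_lwhisk) auto
    have 3: "PCell G (PCmp F (h \<odot>\<^bsub>C\<^esub> g) f) \<cdot>\<^bsub>E\<^esub> PCell G (PCmp F h g \<lhd>\<^bsub>D\<^esub> PArr F f)
       = PCell G (PCmp F h (g \<odot>\<^bsub>C\<^esub> f)) \<cdot>\<^bsub>E\<^esub> PCell G (PArr F h \<rhd>\<^bsub>D\<^esub> PCmp F g f)"
      using arg_cong[OF F.PCmp_assoc_simp[OF fgh], of "PCell G"] fgh by simp
    have 4: "PCmp G (PArr F h \<odot>\<^bsub>D\<^esub> PArr F g) (PArr F f) \<cdot>\<^bsub>E\<^esub> (PCmp G (PArr F h) (PArr F g) \<lhd>\<^bsub>E\<^esub> PArr G (PArr F f))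
         = PCmp G (PArr F h) (PArr F g \<odot>\<^bsub>D\<^esub> PArr F f) \<cdot>\<^bsub>E\<^esub> (PArr G (PArr F h) \<rhd>\<^bsub>E\<^esub> PCmp G (PArr F g) (PArr F f))"
      using fgh by (intro G.PCmp_assoc_simp) auto
    show "PCmp ?H (h \<odot>\<^bsub>C\<^esub> g) f \<cdot>\<^bsub>E\<^esub> (PCmp ?H h g \<lhd>\<^bsub>E\<^esub> PArr ?H f)
      = PCmp ?H h (g \<odot>\<^bsub>C\<^esub> f) \<cdot>\<^bsub>E\<^esub> (PArr ?H h \<rhd>\<^bsub>E\<^esub> PCmp ?H g f)"
      using fgh by (simp add: G.D.reassoc[OF 1] G.D.reassoc[OF 2] G.D.reassoc[OF 3] 4)
  next
    fix f assume f: "f \<in> Arr C"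
    have 1: "PCmp G (PArr F (id1 C (tgt C f))) (PArr F f) \<cdot>\<^bsub>E\<^esub> (PCell G (PUnit F (tgt C f)) \<lhd>\<^bsub>E\<^esub> PArr G (PArr F f))
      = PCell G (PUnit F (tgt C f) \<lhd>\<^bsub>D\<^esub> PArr F f) \<cdot>\<^bsub>E\<^esub> PCmp G (id1 D (PObj F (tgt C f))) (PArr F f)"
      using f by (intro G.PCmp_rwhisk) auto
    have 3: "PCell G (PCmp F (id1 C (tgt C f)) f) \<cdot>\<^bsub>E\<^esub> PCell G (PUnit F (tgt C f) \<lhd>\<^bsub>D\<^esub> PArr F f)
       = id2 E (PArr G (PArr F f))"
      using arg_cong[OF F.PUnit_unit_simps(1)[OF f refl], of "PCell G"] f by simp
    have 4: "PCmp G (id1 D (PObj F (tgt C f))) (PArr F f) \<cdot>\<^bsub>E\<^esub> (PUnit G (PObj F (tgt C f)) \<lhd>\<^bsub>E\<^esub> PArr G (PArr F f))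
        = id2 E (PArr G (PArr F f))"
      using f by (intro G.PUnit_unit_simps) auto
    show "PCmp ?H (id1 C (tgt C f)) f \<cdot>\<^bsub>E\<^esub> (PUnit ?H (tgt C f) \<lhd>\<^bsub>E\<^esub> PArr ?H f)
       = id2 E (PArr ?H f)"
      using f by (simp add: G.D.reassoc[OF 1] 3 4)
  next
    fix f assume f: "f \<in> Arr C"
    have 1: "PCmp G (PArr F f) (PArr F (id1 C (src C f))) \<cdot>\<^bsub>E\<^esub> (PArr G (PArr F f) \<rhd>\<^bsub>E\<^esub> PCell G (PUnit F (src C f)))
      = PCell G (PArr F f \<rhd>\<^bsub>D\<^esub> PUnit F (src C f)) \<cdot>\<^bsub>E\<^esub> PCmp G (PArr F f) (id1 D (PObj F (src C f)))"
      using f by (intro G.PCmp_lwhisk) auto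
    have 3: "PCell G (PCmp F f (id1 C (src C f))) \<cdot>\<^bsub>E\<^esub> PCell G (PArr F f \<rhd>\<^bsub>D\<^esub> PUnit F (src C f))
       = id2 E (PArr G (PArr F f))"
      using arg_cong[OF F.PUnit_unit_simps(2)[OF f refl], of "PCell G"] f by simp
    have 4: "PCmp G (PArr F f) (id1 D (PObj F (src C f))) \<cdot>\<^bsub>E\<^esub> (PArr G (PArr F f) \<rhd>\<^bsub>E\<^esub> PUnit G (PObj F (src C f)))
        = id2 E (PArr G (PArr F f))"
      using f by (intro G.PUnit_unit_simps) auto
    show "PCmp ?H f (id1 C (src C f)) \<cdot>\<^bsub>E\<^esub> (PArr ?H f \<rhd>\<^bsub>E\<^esub> PUnit ?H (src C f))
       = id2 E (PArr ?H f)"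
      using f by (simp add: G.D.reassoc[OF 1] 3 4)
  qed (auto intro: F.C.two_category_axioms G.D.two_category_axioms)
qed

text \<open>The comparison cells of \<open>K\<close> are 2-cells of \<open>D\<close>; naturality of
  \<tau> at them bridges the gap between the unit and composition axioms for \<tau> and those for
  the whiskered transformation.\<close>

lemma pseudonatural_tr_pre:
  assumes "pseudofunctor C D K" "pseudonatural D E F G \<tau>"
  shows "pseudonatural C E (ps_comp E F K) (ps_comp E G K) (tr_pre \<tau> K)"
proof -
  interpret K: pseudofunctor C D K by fact
  interpret T: pseudonatural D E F G \<tau> by fact
  let ?GK = "ps_comp E G K"
  let ?FK = "ps_comp E F K"
  let ?\<theta> = "tr_pre \<tau> K"
  show ?thesis
  proof (rule pseudonaturalI)
    show "pseudofunctor C E ?FK" "pseudofunctor C E ?GK"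
      by (intro pseudofunctor_ps_comp[of C D] K.pseudofunctor_axioms T.F.pseudofunctor_axioms
          T.G.pseudofunctor_axioms)+
  next
    fix a assume "a \<in> Cell C"
    then show "(TArr ?\<theta> (tgt C (dom2 C a)) \<rhd>\<^bsub>E\<^esub> PCell ?FK a) \<cdot>\<^bsub>E\<^esub> TCell ?\<theta> (dom2 C a)
       = TCell ?\<theta> (cod2 C a) \<cdot>\<^bsub>E\<^esub> (PCell ?GK a \<lhd>\<^bsub>E\<^esub> TArr ?\<theta> (src C (dom2 C a)))"
      using T.TCell_natural_simp[of "PCell K a"] by simp
  next
    fix X assume X: "X \<in> Obj C"
    have 1: "(TArr \<tau> (PObj K X) \<rhd>\<^bsub>E\<^esub> PCell F (PUnit K X)) \<cdot>\<^bsub>E\<^esub> TCell \<tau> (id1 D (PObj K X))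
      = TCell \<tau> (PArr K (id1 C X)) \<cdot>\<^bsub>E\<^esub> (PCell G (PUnit K X) \<lhd>\<^bsub>E\<^esub> TArr \<tau> (PObj K X))"
      using X by (intro T.TCell_natural_simp) auto
    show "TCell ?\<theta> (id1 C X) \<cdot>\<^bsub>E\<^esub> (PUnit ?GK X \<lhd>\<^bsub>E\<^esub> TArr ?\<theta> X) =
       TArr ?\<theta> X \<rhd>\<^bsub>E\<^esub> PUnit ?FK X"
      using X by (simp add: T.F.D.reassoc[OF 1[symmetric]] T.TCell_unit)
  next
    fix f g assume fg: "f \<in> Arr C" "g \<in> Arr C" "src C g = tgt C f"
    have 1: "(TArr \<tau> (PObj K (tgt C g)) \<rhd>\<^bsub>E\<^esub> PCell F (PCmp K g f)) \<cdot>\<^bsub>E\<^esub> TCell \<tau> (PArr K g \<odot>\<^bsub>D\<^esub> PArr K f)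
      = TCell \<tau> (PArr K (g \<odot>\<^bsub>C\<^esub> f)) \<cdot>\<^bsub>E\<^esub> (PCell G (PCmp K g f) \<lhd>\<^bsub>E\<^esub> TArr \<tau> (PObj K (src C f)))"
      using fg by (intro T.TCell_natural_simp) auto
    show "TCell ?\<theta> (g \<odot>\<^bsub>C\<^esub> f) \<cdot>\<^bsub>E\<^esub> (PCmp ?GK g f \<lhd>\<^bsub>E\<^esub> TArr ?\<theta> (src C f)) =
       (TArr ?\<theta> (tgt C g) \<rhd>\<^bsub>E\<^esub> PCmp ?FK g f) \<cdot>\<^bsub>E\<^esub>
       (TCell ?\<theta> g \<lhd>\<^bsub>E\<^esub> PArr ?FK f) \<cdot>\<^bsub>E\<^esub> (PArr ?GK g \<rhd>\<^bsub>E\<^esub> TCell ?\<theta> f)"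
      using fg by (simp add: T.F.D.reassoc[OF 1[symmetric]] T.TCell_cmp_simp)
  qed auto
qed

lemma pseudonatural_tr_comp:
  assumes "pseudonatural C D F G \<tau>" "pseudonatural C D G H \<sigma>"
  shows "pseudonatural C D F H (tr_comp C D \<sigma> \<tau>)"
proof -
  interpret T: pseudonatural C D F G \<tau> by fact
  interpret S: pseudonatural C D G H \<sigma> by fact
  note cmpT = pseudonatural.TCell_cmp_simp[OF assms(1)]
  note cmpS = pseudonatural.TCell_cmp_simp[OF assms(2)]
  let ?\<theta> = "tr_comp C D \<sigma> \<tau>"
  show ?thesis
  proof (rule pseudonaturalI)
    fix a assume a: "a \<in> Cell C"
    have 1: "((TArr \<sigma> (tgt C (dom2 C a)) \<odot>\<^bsub>D\<^esub> TArr \<tau> (tgt C (dom2 C a))) \<rhd>\<^bsub>D\<^esub> PCell F a) \<cdot>\<^bsub>D\<^esub>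
         (TArr \<sigma> (tgt C (dom2 C a)) \<rhd>\<^bsub>D\<^esub> TCell \<tau> (dom2 C a))
      = (TArr \<sigma> (tgt C (dom2 C a)) \<rhd>\<^bsub>D\<^esub> TCell \<tau> (cod2 C a)) \<cdot>\<^bsub>D\<^esub>
         (TArr \<sigma> (tgt C (dom2 C a)) \<rhd>\<^bsub>D\<^esub> PCell G a \<lhd>\<^bsub>D\<^esub> TArr \<tau> (src C (dom2 C a)))"
      using arg_cong[OF T.TCell_natural_simp[OF a refl refl refl refl],
          of "\<lambda>x. TArr \<sigma> (tgt C (dom2 C a)) \<rhd>\<^bsub>D\<^esub> x"] a by simp
    have 2: "(TArr \<sigma> (tgt C (dom2 C a)) \<rhd>\<^bsub>D\<^esub> PCell G a \<lhd>\<^bsub>D\<^esub> TArr \<tau> (src C (dom2 C a))) \<cdot>\<^bsub>D\<^esub>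
        (TCell \<sigma> (dom2 C a) \<lhd>\<^bsub>D\<^esub> TArr \<tau> (src C (dom2 C a)))
      = (TCell \<sigma> (cod2 C a) \<lhd>\<^bsub>D\<^esub> TArr \<tau> (src C (dom2 C a))) \<cdot>\<^bsub>D\<^esub>
        (PCell H a \<lhd>\<^bsub>D\<^esub> (TArr \<sigma> (src C (dom2 C a)) \<odot>\<^bsub>D\<^esub> TArr \<tau> (src C (dom2 C a))))"
      using arg_cong[OF S.TCell_natural_simp[OF a refl refl refl refl],
          of "\<lambda>x. x \<lhd>\<^bsub>D\<^esub> TArr \<tau> (src C (dom2 C a))"] a by simp
    show "(TArr ?\<theta> (tgt C (dom2 C a)) \<rhd>\<^bsub>D\<^esub> PCell F a) \<cdot>\<^bsub>D\<^esub> TCell ?\<theta> (dom2 C a)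
      = TCell ?\<theta> (cod2 C a) \<cdot>\<^bsub>D\<^esub> (PCell H a \<lhd>\<^bsub>D\<^esub> TArr ?\<theta> (src C (dom2 C a)))"
      using a by (simp add: T.F.D.reassoc[OF 1] 2)
  next
    fix X assume X: "X \<in> Obj C"
    have 1: "(TCell \<sigma> (id1 C X) \<lhd>\<^bsub>D\<^esub> TArr \<tau> X) \<cdot>\<^bsub>D\<^esub> (PUnit H X \<lhd>\<^bsub>D\<^esub> (TArr \<sigma> X \<odot>\<^bsub>D\<^esub> TArr \<tau> X))
       = TArr \<sigma> X \<rhd>\<^bsub>D\<^esub> PUnit G X \<lhd>\<^bsub>D\<^esub> TArr \<tau> X"
      using arg_cong[OF S.TCell_unit[OF X], of "\<lambda>x. x \<lhd>\<^bsub>D\<^esub> TArr \<tau> X"] X by simp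
    have 2: "(TArr \<sigma> X \<rhd>\<^bsub>D\<^esub> TCell \<tau> (id1 C X)) \<cdot>\<^bsub>D\<^esub> (TArr \<sigma> X \<rhd>\<^bsub>D\<^esub> PUnit G X \<lhd>\<^bsub>D\<^esub> TArr \<tau> X)
       = (TArr \<sigma> X \<odot>\<^bsub>D\<^esub> TArr \<tau> X) \<rhd>\<^bsub>D\<^esub> PUnit F X"
      using arg_cong[OF T.TCell_unit[OF X], of "\<lambda>x. TArr \<sigma> X \<rhd>\<^bsub>D\<^esub> x"] X by simp
    show "TCell ?\<theta> (id1 C X) \<cdot>\<^bsub>D\<^esub> (PUnit H X \<lhd>\<^bsub>D\<^esub> TArr ?\<theta> X)
      = TArr ?\<theta> X \<rhd>\<^bsub>D\<^esub> PUnit F X"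
      using X by (simp add: 1 2)
  next
    fix f g assume fg: "f \<in> Arr C" "g \<in> Arr C" "src C g = tgt C f"
    let ?s = "\<lambda>X. TArr \<sigma> X" and ?t = "\<lambda>X. TArr \<tau> X"
    let ?X = "src C f" and ?Y = "tgt C f" and ?Z = "tgt C g"
    have 1: "(TCell \<sigma> (g \<odot>\<^bsub>C\<^esub> f) \<lhd>\<^bsub>D\<^esub> ?t ?X) \<cdot>\<^bsub>D\<^esub> (PCmp H g f \<lhd>\<^bsub>D\<^esub> (?s ?X \<odot>\<^bsub>D\<^esub> ?t ?X))
      = (?s ?Z \<rhd>\<^bsub>D\<^esub> PCmp G g f \<lhd>\<^bsub>D\<^esub> ?t ?X) \<cdot>\<^bsub>D\<^esub> (TCell \<sigma> g \<lhd>\<^bsub>D\<^esub> (PArr G f \<odot>\<^bsub>D\<^esub> ?t ?X)) \<cdot>\<^bsub>D\<^esub>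
        (PArr H g \<rhd>\<^bsub>D\<^esub> TCell \<sigma> f \<lhd>\<^bsub>D\<^esub> ?t ?X)"
      using arg_cong[OF cmpS[OF fg refl refl], of "\<lambda>x. x \<lhd>\<^bsub>D\<^esub> ?t ?X"] fg by simp
    have 2: "(?s ?Z \<rhd>\<^bsub>D\<^esub> TCell \<tau> (g \<odot>\<^bsub>C\<^esub> f)) \<cdot>\<^bsub>D\<^esub> (?s ?Z \<rhd>\<^bsub>D\<^esub> PCmp G g f \<lhd>\<^bsub>D\<^esub> ?t ?X)
      = ((?s ?Z \<odot>\<^bsub>D\<^esub> ?t ?Z) \<rhd>\<^bsub>D\<^esub> PCmp F g f) \<cdot>\<^bsub>D\<^esub> (?s ?Z \<rhd>\<^bsub>D\<^esub> TCell \<tau> g \<lhd>\<^bsub>D\<^esub> PArr F f) \<cdot>\<^bsub>D\<^esub>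
        ((?s ?Z \<odot>\<^bsub>D\<^esub> PArr G g) \<rhd>\<^bsub>D\<^esub> TCell \<tau> f)"
      using arg_cong[OF cmpT[OF fg refl refl], of "\<lambda>x. ?s ?Z \<rhd>\<^bsub>D\<^esub> x"] fg by simp
    \<comment> \<open>The one ingredient besides the axioms of \<sigma> and \<tau>: the cell of
      \<sigma> at \<open>g\<close> and the cell of \<tau> at \<open>f\<close> act on disjoint
      stretches.\<close>
    have 3: "(TCell \<sigma> g \<lhd>\<^bsub>D\<^esub> (?t ?Y \<odot>\<^bsub>D\<^esub> PArr F f)) \<cdot>\<^bsub>D\<^esub> ((PArr H g \<odot>\<^bsub>D\<^esub> ?s ?Y) \<rhd>\<^bsub>D\<^esub> TCell \<tau> f)
       = ((?s ?Z \<odot>\<^bsub>D\<^esub> PArr G g) \<rhd>\<^bsub>D\<^esub> TCell \<tau> f) \<cdot>\<^bsub>D\<^esub> (TCell \<sigma> g \<lhd>\<^bsub>D\<^esub> (PArr G f \<odot>\<^bsub>D\<^esub> ?t ?X))"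
      using T.F.D.exchange[of "TCell \<tau> f" "TCell \<sigma> g"] fg by simp
    show "TCell ?\<theta> (g \<odot>\<^bsub>C\<^esub> f) \<cdot>\<^bsub>D\<^esub> (PCmp H g f \<lhd>\<^bsub>D\<^esub> TArr ?\<theta> ?X) =
       (TArr ?\<theta> ?Z \<rhd>\<^bsub>D\<^esub> PCmp F g f) \<cdot>\<^bsub>D\<^esub>
       (TCell ?\<theta> g \<lhd>\<^bsub>D\<^esub> PArr F f) \<cdot>\<^bsub>D\<^esub> (PArr H g \<rhd>\<^bsub>D\<^esub> TCell ?\<theta> f)"
      using fg by (simp add: 1 T.F.D.reassoc[OF 2] T.F.D.reassoc[OF 3])
  qed (auto intro: T.F.pseudofunctor_axioms S.G.pseudofunctor_axioms)
qed

text \<open>Needed because reassociating composites of pseudofunctors changes them outside the carriers.\<close>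

lemma pseudonatural_cong_dom:
  assumes "pseudonatural C D F G \<tau>" "pseudofunctor C D F'"
    and "\<And>X. X \<in> Obj C \<Longrightarrow> PObj F' X = PObj F X"
    and "\<And>f. f \<in> Arr C \<Longrightarrow> PArr F' f = PArr F f"
    and "\<And>a. a \<in> Cell C \<Longrightarrow> PCell F' a = PCell F a"
    and "\<And>f g. \<lbrakk>f \<in> Arr C; g \<in> Arr C; src C g = tgt C f\<rbrakk> \<Longrightarrow> PCmp F' g f = PCmp F g f"
    and "\<And>X. X \<in> Obj C \<Longrightarrow> PUnit F' X = PUnit F X"
  shows "pseudonatural C D F' G \<tau>"
proof -
  interpret T: pseudonatural C D F G \<tau> by fact
  show ?thesis
    by (rule pseudonaturalI)
      (auto simp: assms T.G.pseudofunctor_axioms T.TCell_unit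
         T.TCell_natural_simp[OF _ refl refl refl refl] T.TCell_cmp_simp[OF _ _ _ refl refl])
qed

text \<open>The two bracketings differ in \<open>PCmp\<close> and \<open>PUnit\<close>: one applies
  \<open>E\<close> to a vertical composite, the other composes the images. Functoriality of
  \<open>E\<close> equates these only for composable cells of \<open>B\<close>.\<close>

lemma pseudonatural_comp_assoc:
  assumes "pseudonatural C A (ps_comp A (ps_comp A E L) U) G \<tau>"
    and "pseudofunctor C D U" "pseudofunctor D B L" "pseudofunctor B A E"
  shows "pseudonatural C A (ps_comp A E (ps_comp B L U)) G \<tau>"
proof -
  interpret U: pseudofunctor C D U by fact
  interpret L: pseudofunctor D B L by fact
  interpret E: pseudofunctor B A E by fact
  show ?thesis
    by (rule pseudonatural_cong_dom[OF assms(1)])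
      (auto intro!: pseudofunctor_ps_comp[of C B] pseudofunctor_ps_comp[of C D] assms)
qed

lemma pseudonatural_tr_id:
  assumes "pseudofunctor C D F"
  shows "pseudonatural C D F F (tr_id D F)"
proof -
  interpret F: pseudofunctor C D F by fact
  show ?thesis
    by (rule pseudonaturalI) (auto simp: assms)
qed

text \<open>
  Pseudonaturality of \<open>\<tau>\<close> is not assumed but transported along \<open>\<Gamma>\<close>; for the triangle modifications of
  a biadjunction this avoids verifying the axioms for the composites with \<open>tr_post\<close>.
\<close>

lemma invertible_modification_from_tr_id:
  assumes "pseudofunctor C D F"
    and TArr: "\<And>X. X \<in> Obj C \<Longrightarrow> TArr \<tau> X \<in> Arr D \<and> src D (TArr \<tau> X) = PObj F X \<and> tgt D (TArr \<tau> X) = PObj F X"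
    and TCell: "\<And>f. f \<in> Arr C \<Longrightarrow> isocell D (TCell \<tau> f) \<and> dom2 D (TCell \<tau> f) = PArr F f \<odot>\<^bsub>D\<^esub> TArr \<tau> (src C f) \<and>
           cod2 D (TCell \<tau> f) = TArr \<tau> (tgt C f) \<odot>\<^bsub>D\<^esub> PArr F f"
    and mod: "\<And>X. X \<in> Obj C \<Longrightarrow> isocell D (\<Gamma> X) \<and> dom2 D (\<Gamma> X) = id1 D (PObj F X) \<and> cod2 D (\<Gamma> X) = TArr \<tau> X"
    and nat: "\<And>f. f \<in> Arr C \<Longrightarrow> TCell \<tau> f \<cdot>\<^bsub>D\<^esub> (PArr F f \<rhd>\<^bsub>D\<^esub> \<Gamma> (src C f)) = \<Gamma> (tgt C f) \<lhd>\<^bsub>D\<^esub> PArr F f"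
  shows "invertible_modification C D F F (tr_id D F) \<tau> \<Gamma>"
proof -
  interpret F: pseudofunctor C D F by fact
  note [simp] = TArr mod TCell nat
  have [simp]: "\<Gamma> X \<in> Cell D" if "X \<in> Obj C" for X
    using mod that by auto
  have [simp]: "TCell \<tau> f \<in> Cell D" if "f \<in> Arr C" for f
    using TCell that by auto
  interpret I: pseudonatural C D F F "tr_id D F"
    using assms(1) by (rule pseudonatural_tr_id)
  interpret T: pseudonatural C D F F \<tau>
  proof (rule pseudonaturalI)
    fix a assume a: "a \<in> Cell C"
    let ?f = "dom2 C a" and ?g = "cod2 C a" and ?X = "src C (dom2 C a)" and ?Y = "tgt C (dom2 C a)"
    have f: "?f \<in> Arr C" and g: "?g \<in> Arr C" using a by auto
    \<comment> \<open>Here and for the two other axioms, the equation is tested after composing with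
      an invertible whiskering of \<Gamma>: \<open>nat\<close> then replaces each cell of \<tau> by
      a whiskered \<Gamma>, and \<open>exchange\<close> moves that past the remaining cells.\<close>
    have 1: "(PCell F a \<lhd>\<^bsub>D\<^esub> TArr \<tau> ?X) \<cdot>\<^bsub>D\<^esub> (PArr F ?f \<rhd>\<^bsub>D\<^esub> \<Gamma> ?X) = (PArr F ?g \<rhd>\<^bsub>D\<^esub> \<Gamma> ?X) \<cdot>\<^bsub>D\<^esub> PCell F a"
      using F.D.exchange[of "\<Gamma> ?X" "PCell F a"] a by simp
    have 2: "(TArr \<tau> ?Y \<rhd>\<^bsub>D\<^esub> PCell F a) \<cdot>\<^bsub>D\<^esub> (\<Gamma> ?Y \<lhd>\<^bsub>D\<^esub> PArr F ?f) = (\<Gamma> ?Y \<lhd>\<^bsub>D\<^esub> PArr F ?g) \<cdot>\<^bsub>D\<^esub> PCell F a"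
      using F.D.exchange[of "PCell F a" "\<Gamma> ?Y"] a by simp
    have 3: "TCell \<tau> ?g \<cdot>\<^bsub>D\<^esub> (PArr F ?g \<rhd>\<^bsub>D\<^esub> \<Gamma> ?X) = \<Gamma> ?Y \<lhd>\<^bsub>D\<^esub> PArr F ?g"
      using nat[OF g] a by simp
    show "(TArr \<tau> ?Y \<rhd>\<^bsub>D\<^esub> PCell F a) \<cdot>\<^bsub>D\<^esub> TCell \<tau> ?f = TCell \<tau> ?g \<cdot>\<^bsub>D\<^esub> (PCell F a \<lhd>\<^bsub>D\<^esub> TArr \<tau> ?X)"
      by (rule F.D.iso_right_cancel[of "PArr F ?f \<rhd>\<^bsub>D\<^esub> \<Gamma> ?X"])
        (use a in \<open>simp_all add: 1 2 F.D.reassoc[OF 3]\<close>)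
  next
    fix X assume X: "X \<in> Obj C"
    then have i: "id1 C X \<in> Arr C" by simp
    have 1: "(PUnit F X \<lhd>\<^bsub>D\<^esub> TArr \<tau> X) \<cdot>\<^bsub>D\<^esub> \<Gamma> X = (PArr F (id1 C X) \<rhd>\<^bsub>D\<^esub> \<Gamma> X) \<cdot>\<^bsub>D\<^esub> PUnit F X"
      using F.D.exchange[of "\<Gamma> X" "PUnit F X"] X by simp
    have 2: "(TArr \<tau> X \<rhd>\<^bsub>D\<^esub> PUnit F X) \<cdot>\<^bsub>D\<^esub> \<Gamma> X = (\<Gamma> X \<lhd>\<^bsub>D\<^esub> PArr F (id1 C X)) \<cdot>\<^bsub>D\<^esub> PUnit F X"
      using F.D.exchange[of "PUnit F X" "\<Gamma> X"] X by simp
    have 3: "TCell \<tau> (id1 C X) \<cdot>\<^bsub>D\<^esub> (PArr F (id1 C X) \<rhd>\<^bsub>D\<^esub> \<Gamma> X) = \<Gamma> X \<lhd>\<^bsub>D\<^esub> PArr F (id1 C X)"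
      using nat[OF i] X by simp
    show "TCell \<tau> (id1 C X) \<cdot>\<^bsub>D\<^esub> (PUnit F X \<lhd>\<^bsub>D\<^esub> TArr \<tau> X) = TArr \<tau> X \<rhd>\<^bsub>D\<^esub> PUnit F X"
      by (rule F.D.iso_right_cancel[of "\<Gamma> X"]) (use X in \<open>simp_all add: 1 2 F.D.reassoc[OF 3]\<close>)
  next
    fix f g assume fg: "f \<in> Arr C" "g \<in> Arr C" "src C g = tgt C f"
    let ?X = "src C f" and ?Y = "tgt C f" and ?Z = "tgt C g"
    have gf: "g \<odot>\<^bsub>C\<^esub> f \<in> Arr C" using fg by simp
    have 1: "(PCmp F g f \<lhd>\<^bsub>D\<^esub> TArr \<tau> ?X) \<cdot>\<^bsub>D\<^esub> ((PArr F g \<odot>\<^bsub>D\<^esub> PArr F f) \<rhd>\<^bsub>D\<^esub> \<Gamma> ?X)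
      = (PArr F (g \<odot>\<^bsub>C\<^esub> f) \<rhd>\<^bsub>D\<^esub> \<Gamma> ?X) \<cdot>\<^bsub>D\<^esub> PCmp F g f"
      using F.D.exchange[of "\<Gamma> ?X" "PCmp F g f"] fg by simp
    have 2: "(TArr \<tau> ?Z \<rhd>\<^bsub>D\<^esub> PCmp F g f) \<cdot>\<^bsub>D\<^esub> (\<Gamma> ?Z \<lhd>\<^bsub>D\<^esub> (PArr F g \<odot>\<^bsub>D\<^esub> PArr F f))
      = (\<Gamma> ?Z \<lhd>\<^bsub>D\<^esub> PArr F (g \<odot>\<^bsub>C\<^esub> f)) \<cdot>\<^bsub>D\<^esub> PCmp F g f"
      using F.D.exchange[of "PCmp F g f" "\<Gamma> ?Z"] fg by simp
    have 3: "TCell \<tau> (g \<odot>\<^bsub>C\<^esub> f) \<cdot>\<^bsub>D\<^esub> (PArr F (g \<odot>\<^bsub>C\<^esub> f) \<rhd>\<^bsub>D\<^esub> \<Gamma> ?X) = \<Gamma> ?Z \<lhd>\<^bsub>D\<^esub> PArr F (g \<odot>\<^bsub>C\<^esub> f)"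
      using nat[OF gf] fg by simp
    have 4: "(PArr F g \<rhd>\<^bsub>D\<^esub> TCell \<tau> f) \<cdot>\<^bsub>D\<^esub> ((PArr F g \<odot>\<^bsub>D\<^esub> PArr F f) \<rhd>\<^bsub>D\<^esub> \<Gamma> ?X) = PArr F g \<rhd>\<^bsub>D\<^esub> \<Gamma> ?Y \<lhd>\<^bsub>D\<^esub> PArr F f"
      using arg_cong[OF nat[OF fg(1)], of "\<lambda>x. PArr F g \<rhd>\<^bsub>D\<^esub> x"] fg by (simp del: nat)
    have 5: "(TCell \<tau> g \<lhd>\<^bsub>D\<^esub> PArr F f) \<cdot>\<^bsub>D\<^esub> (PArr F g \<rhd>\<^bsub>D\<^esub> \<Gamma> ?Y \<lhd>\<^bsub>D\<^esub> PArr F f) = \<Gamma> ?Z \<lhd>\<^bsub>D\<^esub> (PArr F g \<odot>\<^bsub>D\<^esub> PArr F f)"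
      using arg_cong[OF nat[OF fg(2)], of "\<lambda>x. x \<lhd>\<^bsub>D\<^esub> PArr F f"] fg by (simp del: nat)
    show "TCell \<tau> (g \<odot>\<^bsub>C\<^esub> f) \<cdot>\<^bsub>D\<^esub> (PCmp F g f \<lhd>\<^bsub>D\<^esub> TArr \<tau> ?X) =
       (TArr \<tau> ?Z \<rhd>\<^bsub>D\<^esub> PCmp F g f) \<cdot>\<^bsub>D\<^esub> (TCell \<tau> g \<lhd>\<^bsub>D\<^esub> PArr F f) \<cdot>\<^bsub>D\<^esub> (PArr F g \<rhd>\<^bsub>D\<^esub> TCell \<tau> f)"
      by (rule F.D.iso_right_cancel[of "(PArr F g \<odot>\<^bsub>D\<^esub> PArr F f) \<rhd>\<^bsub>D\<^esub> \<Gamma> ?X"])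
        (use fg in \<open>simp_all add: 1 2 F.D.reassoc[OF 3] 4 5\<close>)
  qed (auto simp: assms(1))
  show ?thesis
    by unfold_locales (auto simp: nat)
qed

text \<open>The inverse components form a modification out of the identity, so the preceding lemma
  applies to them and yields the pseudonaturality of \<tau>.\<close>

lemma invertible_modification_to_tr_id:
  assumes "pseudofunctor C D F"
    and TArr: "\<And>X. X \<in> Obj C \<Longrightarrow> TArr \<tau> X \<in> Arr D \<and> src D (TArr \<tau> X) = PObj F X \<and> tgt D (TArr \<tau> X) = PObj F X"
    and TCell: "\<And>f. f \<in> Arr C \<Longrightarrow> isocell D (TCell \<tau> f) \<and> dom2 D (TCell \<tau> f) = PArr F f \<odot>\<^bsub>D\<^esub> TArr \<tau> (src C f) \<and>
           cod2 D (TCell \<tau> f) = TArr \<tau> (tgt C f) \<odot>\<^bsub>D\<^esub> PArr F f"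
    and mod: "\<And>X. X \<in> Obj C \<Longrightarrow> isocell D (\<Gamma> X) \<and> dom2 D (\<Gamma> X) = TArr \<tau> X \<and> cod2 D (\<Gamma> X) = id1 D (PObj F X)"
    and nat: "\<And>f. f \<in> Arr C \<Longrightarrow> (\<Gamma> (tgt C f) \<lhd>\<^bsub>D\<^esub> PArr F f) \<cdot>\<^bsub>D\<^esub> TCell \<tau> f = PArr F f \<rhd>\<^bsub>D\<^esub> \<Gamma> (src C f)"
  shows "invertible_modification C D F F \<tau> (tr_id D F) \<Gamma>"
proof -
  interpret F: pseudofunctor C D F by fact
  note [simp] = TArr mod TCell
  have [simp]: "\<Gamma> X \<in> Cell D" if "X \<in> Obj C" for X
    using mod that by auto
  have [simp]: "TCell \<tau> f \<in> Cell D" if "f \<in> Arr C" for f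
    using TCell that by auto
  have "TCell \<tau> f \<cdot>\<^bsub>D\<^esub> (PArr F f \<rhd>\<^bsub>D\<^esub> inv2 D (\<Gamma> (src C f))) = inv2 D (\<Gamma> (tgt C f)) \<lhd>\<^bsub>D\<^esub> PArr F f"
    if f: "f \<in> Arr C" for f
  proof (rule F.D.iso_left_cancel[of "\<Gamma> (tgt C f) \<lhd>\<^bsub>D\<^esub> PArr F f"])
    have 1: "(PArr F f \<rhd>\<^bsub>D\<^esub> \<Gamma> (src C f)) \<cdot>\<^bsub>D\<^esub> (PArr F f \<rhd>\<^bsub>D\<^esub> inv2 D (\<Gamma> (src C f))) = id2 D (PArr F f)"
      using F.D.whisk_vcmp(1)[of "inv2 D (\<Gamma> (src C f))" "\<Gamma> (src C f)" "PArr F f"] f by simp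
    have 2: "(\<Gamma> (tgt C f) \<lhd>\<^bsub>D\<^esub> PArr F f) \<cdot>\<^bsub>D\<^esub> (inv2 D (\<Gamma> (tgt C f)) \<lhd>\<^bsub>D\<^esub> PArr F f) = id2 D (PArr F f)"
      using F.D.whisk_vcmp(2)[of "inv2 D (\<Gamma> (tgt C f))" "\<Gamma> (tgt C f)" "PArr F f"] f by simp
    show "(\<Gamma> (tgt C f) \<lhd>\<^bsub>D\<^esub> PArr F f) \<cdot>\<^bsub>D\<^esub> TCell \<tau> f \<cdot>\<^bsub>D\<^esub> (PArr F f \<rhd>\<^bsub>D\<^esub> inv2 D (\<Gamma> (src C f)))
      = (\<Gamma> (tgt C f) \<lhd>\<^bsub>D\<^esub> PArr F f) \<cdot>\<^bsub>D\<^esub> (inv2 D (\<Gamma> (tgt C f)) \<lhd>\<^bsub>D\<^esub> PArr F f)"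
      using f by (simp add: F.D.reassoc[OF nat[OF f]] 1 2)
  qed (use f in simp_all)
  then interpret invertible_modification C D F F "tr_id D F" \<tau> "\<lambda>X. inv2 D (\<Gamma> X)"
    by (intro invertible_modification_from_tr_id assms(1)) auto
  show ?thesis
    by unfold_locales (auto simp: nat)
qed

section \<open>Biadjunctions from universal arrows\<close>

text \<open>The axiom \<open>universal\<close> says that transposition along \<epsilon> is fully
  faithful. Essential surjectivity is demanded only at identities: \<open>u X\<close> is a preimage
  of the identity of \<open>E X\<close> and \<open>s X\<close> the isomorphism witnessing it. These
  two become the unit and the first triangle cell.\<close>

locale universal_counit =
  E: pseudofunctor B A E + R: pseudofunctor A B R
  + \<epsilon>: pseudonatural A A "ps_comp A E R" "ps_id A" \<epsilon>
  for B :: "('ob, 'mb, 'cb) two_cat" and A :: "('oa, 'ma, 'ca) two_cat"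
    and E :: "('ob, 'mb, 'cb, 'oa, 'ma, 'ca) psfun" and R :: "('oa, 'ma, 'ca, 'ob, 'mb, 'cb) psfun"
    and \<epsilon> :: "('oa, 'ma, 'ma, 'ca) pstrans" +
  fixes u :: "'ob \<Rightarrow> 'mb" and s :: "'ob \<Rightarrow> 'ca"
  assumes universal: "\<lbrakk>Y \<in> Obj A; g \<in> Arr B; g' \<in> Arr B; src B g' = src B g; tgt B g = PObj R Y; tgt B g' = PObj R Y\<rbrakk>
      \<Longrightarrow> bij_betw (\<lambda>\<alpha>. TArr \<epsilon> Y \<rhd>\<^bsub>A\<^esub> PCell E \<alpha>) (hom2 B g g')
           (hom2 A (TArr \<epsilon> Y \<odot>\<^bsub>A\<^esub> PArr E g) (TArr \<epsilon> Y \<odot>\<^bsub>A\<^esub> PArr E g'))"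
    and unit_arr: "X \<in> Obj B \<Longrightarrow> u X \<in> hom1 B X (PObj R (PObj E X))"
    and unit_iso: "X \<in> Obj B
      \<Longrightarrow> s X \<in> iso2 A (id1 A (PObj E X)) (TArr \<epsilon> (PObj E X) \<odot>\<^bsub>A\<^esub> PArr E (u X))"
begin

abbreviation e where "e \<equiv> TArr \<epsilon>"

lemma e_simps [simp]:
  assumes "Y \<in> Obj A"
  shows "e Y \<in> Arr A" "src A (e Y) = PObj E (PObj R Y)" "tgt A (e Y) = Y"
  using \<epsilon>.TArr_simps[OF assms] by simp_all

lemma \<epsilon>_cell_simps [simp]:
  assumes "h \<in> Arr A"
  shows "isocell A (TCell \<epsilon> h)" "TCell \<epsilon> h \<in> Cell A" "dom2 A (TCell \<epsilon> h) = h \<odot>\<^bsub>A\<^esub> e (src A h)"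
    "cod2 A (TCell \<epsilon> h) = e (tgt A h) \<odot>\<^bsub>A\<^esub> PArr E (PArr R h)"
  using \<epsilon>.TCell_simps[OF assms] by simp_all

lemma u_simps [simp]:
  assumes "X \<in> Obj B"
  shows "u X \<in> Arr B" "src B (u X) = X" "tgt B (u X) = PObj R (PObj E X)"
  using unit_arr[OF assms] by simp_all

lemma s_simps [simp]:
  assumes "X \<in> Obj B"
  shows "isocell A (s X)" "s X \<in> Cell A" "dom2 A (s X) = id1 A (PObj E X)"
    "cod2 A (s X) = e (PObj E X) \<odot>\<^bsub>A\<^esub> PArr E (u X)"
  using unit_iso[OF assms] by simp_all

text \<open>
  The functors \<open>\<Phi> Y : B(X, R Y) \<rightarrow> A(E X, Y)\<close>, \<open>g \<mapsto> \<epsilon> Y \<odot> E g\<close>, form a morphism of bimodules up to the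
  coherent isomorphisms \<open>p g f : \<Phi> g \<odot> E f \<Rightarrow> \<Phi> (g \<odot> f)\<close> and \<open>q h g : h \<odot> \<Phi> g \<Rightarrow> \<Phi> (R h \<odot> g)\<close>.
\<close>

definition \<Phi> where "\<Phi> Y \<alpha> = e Y \<rhd>\<^bsub>A\<^esub> PCell E \<alpha>"

definition p where "p Y g f = e Y \<rhd>\<^bsub>A\<^esub> PCmp E g f"

definition q where
  "q h g = (e (tgt A h) \<rhd>\<^bsub>A\<^esub> PCmp E (PArr R h) g) \<cdot>\<^bsub>A\<^esub> (TCell \<epsilon> h \<lhd>\<^bsub>A\<^esub> PArr E g)"

text \<open>Identifies the counit with the transpose of the identity of \<open>R Y\<close>; it is
  the target value in the equation that defines \<open>t\<close>.\<close>

definition unit_cell where "unit_cell Y = e Y \<rhd>\<^bsub>A\<^esub> PUnit E (PObj R Y)"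

text \<open>Spreads essential surjectivity from identities to all
  \<open>k : E X \<rightarrow> Y\<close>: whiskering \<open>s X\<close> gives
  \<open>k \<Rightarrow> k \<odot> \<Phi> (u X)\<close>, and \<open>q\<close> carries this on to
  \<open>\<Phi> (R k \<odot> u X)\<close>.\<close>

definition \<sigma> where "\<sigma> X k = q k (u X) \<cdot>\<^bsub>A\<^esub> (k \<rhd>\<^bsub>A\<^esub> s X)"

lemma \<Phi>_simps [simp]:
  assumes "\<alpha> \<in> Cell B" "tgt B (dom2 B \<alpha>) = PObj R Y" "Y \<in> Obj A"
  shows "\<Phi> Y \<alpha> \<in> Cell A" "dom2 A (\<Phi> Y \<alpha>) = e Y \<odot>\<^bsub>A\<^esub> PArr E (dom2 B \<alpha>)"
    "cod2 A (\<Phi> Y \<alpha>) = e Y \<odot>\<^bsub>A\<^esub> PArr E (cod2 B \<alpha>)"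
  using assms by (simp_all add: \<Phi>_def)

lemma \<Phi>_vcmp [simp]:
  "\<lbrakk>\<alpha> \<in> Cell B; \<beta> \<in> Cell B; dom2 B \<beta> = cod2 B \<alpha>; tgt B (dom2 B \<alpha>) = PObj R Y; Y \<in> Obj A\<rbrakk>
     \<Longrightarrow> \<Phi> Y (\<beta> \<cdot>\<^bsub>B\<^esub> \<alpha>) = \<Phi> Y \<beta> \<cdot>\<^bsub>A\<^esub> \<Phi> Y \<alpha>"
  by (simp add: \<Phi>_def)

lemma \<Phi>_id2 [simp]:
  "\<lbrakk>g \<in> Arr B; tgt B g = PObj R Y; Y \<in> Obj A\<rbrakk> \<Longrightarrow> \<Phi> Y (id2 B g) = id2 A (e Y \<odot>\<^bsub>A\<^esub> PArr E g)"
  by (simp add: \<Phi>_def)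

lemma p_simps [simp]:
  assumes "f \<in> Arr B" "g \<in> Arr B" "src B g = tgt B f" "tgt B g = PObj R Y" "Y \<in> Obj A"
  shows "isocell A (p Y g f)" "p Y g f \<in> Cell A" "dom2 A (p Y g f) = e Y \<odot>\<^bsub>A\<^esub> PArr E g \<odot>\<^bsub>A\<^esub> PArr E f"
    "cod2 A (p Y g f) = e Y \<odot>\<^bsub>A\<^esub> PArr E (g \<odot>\<^bsub>B\<^esub> f)"
  using assms by (simp_all add: p_def)

lemma q_simps [simp]:
  assumes "h \<in> Arr A" "g \<in> Arr B" "tgt B g = PObj R (src A h)"
  shows "isocell A (q h g)" "q h g \<in> Cell A" "dom2 A (q h g) = h \<odot>\<^bsub>A\<^esub> e (src A h) \<odot>\<^bsub>A\<^esub> PArr E g"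
    "cod2 A (q h g) = e (tgt A h) \<odot>\<^bsub>A\<^esub> PArr E (PArr R h \<odot>\<^bsub>B\<^esub> g)"
  using assms by (simp_all add: q_def)

lemma unit_cell_simps [simp]:
  assumes "Y \<in> Obj A"
  shows "isocell A (unit_cell Y)" "unit_cell Y \<in> Cell A" "dom2 A (unit_cell Y) = e Y"
    "cod2 A (unit_cell Y) = e Y \<odot>\<^bsub>A\<^esub> PArr E (id1 B (PObj R Y))"
  using assms by (simp_all add: unit_cell_def)

lemma \<sigma>_simps [simp]:
  assumes "k \<in> Arr A" "X \<in> Obj B" "src A k = PObj E X"
  shows "isocell A (\<sigma> X k)" "\<sigma> X k \<in> Cell A" "dom2 A (\<sigma> X k) = k"
    "cod2 A (\<sigma> X k) = e (tgt A k) \<odot>\<^bsub>A\<^esub> PArr E (PArr R k \<odot>\<^bsub>B\<^esub> u X)"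
  using assms by (simp_all add: \<sigma>_def)

section \<open>Naturality and coherence of the comparison cells of the transposition\<close>

lemma p_natural_left:
  assumes "\<alpha> \<in> Cell B" "dom2 B \<alpha> = g" "cod2 B \<alpha> = g'" "f \<in> Arr B" "src B g = tgt B f" "tgt B g = PObj R Y" "Y \<in> Obj A"
  shows "p Y g' f \<cdot>\<^bsub>A\<^esub> (\<Phi> Y \<alpha> \<lhd>\<^bsub>A\<^esub> PArr E f) = \<Phi> Y (\<alpha> \<lhd>\<^bsub>B\<^esub> f) \<cdot>\<^bsub>A\<^esub> p Y g f"
  using arg_cong[OF E.PCmp_rwhisk[OF assms(1-5)], of "\<lambda>x. e Y \<rhd>\<^bsub>A\<^esub> x"] assms
  by (auto simp: \<Phi>_def p_def)

lemma p_natural_right: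
  assumes "\<phi> \<in> Cell B" "dom2 B \<phi> = f" "cod2 B \<phi> = f'" "g \<in> Arr B" "src B g = tgt B f" "tgt B g = PObj R Y" "Y \<in> Obj A"
  shows "p Y g f' \<cdot>\<^bsub>A\<^esub> ((e Y \<odot>\<^bsub>A\<^esub> PArr E g) \<rhd>\<^bsub>A\<^esub> PCell E \<phi>) = \<Phi> Y (g \<rhd>\<^bsub>B\<^esub> \<phi>) \<cdot>\<^bsub>A\<^esub> p Y g f"
  using arg_cong[OF E.PCmp_lwhisk[OF assms(1-5)], of "\<lambda>x. e Y \<rhd>\<^bsub>A\<^esub> x"] assms
  by (auto simp: \<Phi>_def p_def)

lemma q_natural_left:
  assumes "\<kappa> \<in> Cell A" "dom2 A \<kappa> = h" "cod2 A \<kappa> = h'" "src A h = Y" "tgt A h = Z" "g \<in> Arr B" "tgt B g = PObj R Y"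
  shows "q h' g \<cdot>\<^bsub>A\<^esub> (\<kappa> \<lhd>\<^bsub>A\<^esub> (e Y \<odot>\<^bsub>A\<^esub> PArr E g)) = \<Phi> Z (PCell R \<kappa> \<lhd>\<^bsub>B\<^esub> g) \<cdot>\<^bsub>A\<^esub> q h g"
proof -
  have h: "h \<in> Arr A" "h' \<in> Arr A" "src A h' = Y" "tgt A h' = Z" "Y \<in> Obj A" "Z \<in> Obj A"
    using assms by auto
  have 1: "(TCell \<epsilon> h' \<lhd>\<^bsub>A\<^esub> PArr E g) \<cdot>\<^bsub>A\<^esub> (\<kappa> \<lhd>\<^bsub>A\<^esub> (e Y \<odot>\<^bsub>A\<^esub> PArr E g))
     = (e Z \<rhd>\<^bsub>A\<^esub> PCell E (PCell R \<kappa>) \<lhd>\<^bsub>A\<^esub> PArr E g) \<cdot>\<^bsub>A\<^esub> (TCell \<epsilon> h \<lhd>\<^bsub>A\<^esub> PArr E g)"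
    using arg_cong[OF \<epsilon>.TCell_natural_simp[OF assms(1-5), symmetric], of "\<lambda>x. x \<lhd>\<^bsub>A\<^esub> PArr E g"] assms h
    by simp
  have 2: "(e Z \<rhd>\<^bsub>A\<^esub> PCmp E (PArr R h') g) \<cdot>\<^bsub>A\<^esub> (e Z \<rhd>\<^bsub>A\<^esub> PCell E (PCell R \<kappa>) \<lhd>\<^bsub>A\<^esub> PArr E g)
    = (e Z \<rhd>\<^bsub>A\<^esub> PCell E (PCell R \<kappa> \<lhd>\<^bsub>B\<^esub> g)) \<cdot>\<^bsub>A\<^esub> (e Z \<rhd>\<^bsub>A\<^esub> PCmp E (PArr R h) g)"
    using arg_cong[OF E.PCmp_rwhisk[of "PCell R \<kappa>" "PArr R h" "PArr R h'" g], of "\<lambda>x. e Z \<rhd>\<^bsub>A\<^esub> x"] assms h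
    by simp
  show ?thesis
    using assms h by (simp add: q_def \<Phi>_def 1 E.D.reassoc[OF 2])
qed

lemma q_natural_right:
  assumes "\<alpha> \<in> Cell B" "dom2 B \<alpha> = g" "cod2 B \<alpha> = g'" "tgt B g = PObj R Y" "h \<in> Arr A" "src A h = Y" "tgt A h = Z"
  shows "q h g' \<cdot>\<^bsub>A\<^esub> (h \<rhd>\<^bsub>A\<^esub> \<Phi> Y \<alpha>) = \<Phi> Z (PArr R h \<rhd>\<^bsub>B\<^esub> \<alpha>) \<cdot>\<^bsub>A\<^esub> q h g"
proof -
  have g: "g \<in> Arr B" "g' \<in> Arr B" "src B g' = src B g" "tgt B g' = PObj R Y" "Y \<in> Obj A" "Z \<in> Obj A"
    using assms by auto
  have 1: "(TCell \<epsilon> h \<lhd>\<^bsub>A\<^esub> PArr E g') \<cdot>\<^bsub>A\<^esub> ((h \<odot>\<^bsub>A\<^esub> e Y) \<rhd>\<^bsub>A\<^esub> PCell E \<alpha>)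
    = ((e Z \<odot>\<^bsub>A\<^esub> PArr E (PArr R h)) \<rhd>\<^bsub>A\<^esub> PCell E \<alpha>) \<cdot>\<^bsub>A\<^esub> (TCell \<epsilon> h \<lhd>\<^bsub>A\<^esub> PArr E g)"
    using E.D.exchange[of "PCell E \<alpha>" "TCell \<epsilon> h"] assms g by simp
  have 2: "(e Z \<rhd>\<^bsub>A\<^esub> PCmp E (PArr R h) g') \<cdot>\<^bsub>A\<^esub> ((e Z \<odot>\<^bsub>A\<^esub> PArr E (PArr R h)) \<rhd>\<^bsub>A\<^esub> PCell E \<alpha>)
    = (e Z \<rhd>\<^bsub>A\<^esub> PCell E (PArr R h \<rhd>\<^bsub>B\<^esub> \<alpha>)) \<cdot>\<^bsub>A\<^esub> (e Z \<rhd>\<^bsub>A\<^esub> PCmp E (PArr R h) g)"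
    using arg_cong[OF E.PCmp_lwhisk[of \<alpha> g g' "PArr R h"], of "\<lambda>x. e Z \<rhd>\<^bsub>A\<^esub> x"] assms g
    by simp
  show ?thesis
    using assms g by (simp add: q_def \<Phi>_def 1 E.D.reassoc[OF 2])
qed

lemma p_assoc:
  assumes "g \<in> Arr B" "f \<in> Arr B" "d \<in> Arr B" "src B g = tgt B f" "src B f = tgt B d" "tgt B g = PObj R Y" "Y \<in> Obj A"
  shows "p Y g (f \<odot>\<^bsub>B\<^esub> d) \<cdot>\<^bsub>A\<^esub> ((e Y \<odot>\<^bsub>A\<^esub> PArr E g) \<rhd>\<^bsub>A\<^esub> PCmp E f d)
    = p Y (g \<odot>\<^bsub>B\<^esub> f) d \<cdot>\<^bsub>A\<^esub> (p Y g f \<lhd>\<^bsub>A\<^esub> PArr E d)"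
  using arg_cong[OF E.PCmp_assoc_simp[of d f g], of "\<lambda>x. e Y \<rhd>\<^bsub>A\<^esub> x"] assms
  by (simp add: p_def)

text \<open>The left and right actions on the bimodule are compatible: associativity of
  \<open>PCmp E\<close>, plus the exchange of the cell of \<epsilon> at \<open>h\<close> with
  \<open>PCmp E g f\<close>.\<close>

lemma p_q:
  assumes "h \<in> Arr A" "g \<in> Arr B" "f \<in> Arr B" "src A h = Y" "tgt A h = Z" "tgt B g = PObj R Y" "src B g = tgt B f"
  shows "p Z (PArr R h \<odot>\<^bsub>B\<^esub> g) f \<cdot>\<^bsub>A\<^esub> (q h g \<lhd>\<^bsub>A\<^esub> PArr E f) = q h (g \<odot>\<^bsub>B\<^esub> f) \<cdot>\<^bsub>A\<^esub> (h \<rhd>\<^bsub>A\<^esub> p Y g f)"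
proof -
  have YZ: "Y \<in> Obj A" "Z \<in> Obj A" using assms by auto
  have 1: "(e Z \<rhd>\<^bsub>A\<^esub> PCmp E (PArr R h \<odot>\<^bsub>B\<^esub> g) f) \<cdot>\<^bsub>A\<^esub> (e Z \<rhd>\<^bsub>A\<^esub> PCmp E (PArr R h) g \<lhd>\<^bsub>A\<^esub> PArr E f)
     = (e Z \<rhd>\<^bsub>A\<^esub> PCmp E (PArr R h) (g \<odot>\<^bsub>B\<^esub> f)) \<cdot>\<^bsub>A\<^esub> ((e Z \<odot>\<^bsub>A\<^esub> PArr E (PArr R h)) \<rhd>\<^bsub>A\<^esub> PCmp E g f)"
    using arg_cong[OF E.PCmp_assoc_simp[of f g "PArr R h"], of "\<lambda>x. e Z \<rhd>\<^bsub>A\<^esub> x"] assms YZ by simp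
  have 2: "(TCell \<epsilon> h \<lhd>\<^bsub>A\<^esub> PArr E (g \<odot>\<^bsub>B\<^esub> f)) \<cdot>\<^bsub>A\<^esub> ((h \<odot>\<^bsub>A\<^esub> e Y) \<rhd>\<^bsub>A\<^esub> PCmp E g f)
    = ((e Z \<odot>\<^bsub>A\<^esub> PArr E (PArr R h)) \<rhd>\<^bsub>A\<^esub> PCmp E g f) \<cdot>\<^bsub>A\<^esub> (TCell \<epsilon> h \<lhd>\<^bsub>A\<^esub> (PArr E g \<odot>\<^bsub>A\<^esub> PArr E f))"
    using E.D.exchange[of "PCmp E g f" "TCell \<epsilon> h"] assms YZ by simp
  show ?thesis
    using assms YZ by (simp add: q_def p_def E.D.reassoc[OF 1] 2)
qed

text \<open>The composition axiom of \<epsilon>, whiskered by \<open>PArr E g\<close>. The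
  comparison cell of \<open>E R\<close> occurring in it contains \<open>PCmp R k h\<close> under
  \<open>E\<close>, which accounts for the first factor.\<close>

lemma q_assoc:
  assumes "h \<in> Arr A" "k \<in> Arr A" "g \<in> Arr B" "src A h = Y" "tgt A h = Z" "src A k = Z" "tgt A k = W"
    "tgt B g = PObj R Y"
  shows "\<Phi> W (PCmp R k h \<lhd>\<^bsub>B\<^esub> g) \<cdot>\<^bsub>A\<^esub> q k (PArr R h \<odot>\<^bsub>B\<^esub> g) \<cdot>\<^bsub>A\<^esub> (k \<rhd>\<^bsub>A\<^esub> q h g) = q (k \<odot>\<^bsub>A\<^esub> h) g"
proof -
  have YZ: "Y \<in> Obj A" "Z \<in> Obj A" "W \<in> Obj A" using assms by auto
  have 1: "TCell \<epsilon> (k \<odot>\<^bsub>A\<^esub> h) \<lhd>\<^bsub>A\<^esub> PArr E g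
     = (e W \<rhd>\<^bsub>A\<^esub> PCell E (PCmp R k h) \<lhd>\<^bsub>A\<^esub> PArr E g) \<cdot>\<^bsub>A\<^esub>
       (e W \<rhd>\<^bsub>A\<^esub> PCmp E (PArr R k) (PArr R h) \<lhd>\<^bsub>A\<^esub> PArr E g) \<cdot>\<^bsub>A\<^esub>
       (TCell \<epsilon> k \<lhd>\<^bsub>A\<^esub> (PArr E (PArr R h) \<odot>\<^bsub>A\<^esub> PArr E g)) \<cdot>\<^bsub>A\<^esub> (k \<rhd>\<^bsub>A\<^esub> TCell \<epsilon> h \<lhd>\<^bsub>A\<^esub> PArr E g)"
    using arg_cong[OF \<epsilon>.TCell_cmp_simp[of h k Y W], of "\<lambda>x. x \<lhd>\<^bsub>A\<^esub> PArr E g"] assms YZ by simp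
  have 2: "(TCell \<epsilon> k \<lhd>\<^bsub>A\<^esub> PArr E (PArr R h \<odot>\<^bsub>B\<^esub> g)) \<cdot>\<^bsub>A\<^esub> ((k \<odot>\<^bsub>A\<^esub> e Z) \<rhd>\<^bsub>A\<^esub> PCmp E (PArr R h) g)
    = ((e W \<odot>\<^bsub>A\<^esub> PArr E (PArr R k)) \<rhd>\<^bsub>A\<^esub> PCmp E (PArr R h) g) \<cdot>\<^bsub>A\<^esub>
      (TCell \<epsilon> k \<lhd>\<^bsub>A\<^esub> (PArr E (PArr R h) \<odot>\<^bsub>A\<^esub> PArr E g))"
    using E.D.exchange[of "PCmp E (PArr R h) g" "TCell \<epsilon> k"] assms YZ by simp
  have 3: "(e W \<rhd>\<^bsub>A\<^esub> PCmp E (PArr R (k \<odot>\<^bsub>A\<^esub> h)) g) \<cdot>\<^bsub>A\<^esub> (e W \<rhd>\<^bsub>A\<^esub> PCell E (PCmp R k h) \<lhd>\<^bsub>A\<^esub> PArr E g)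
    = (e W \<rhd>\<^bsub>A\<^esub> PCell E (PCmp R k h \<lhd>\<^bsub>B\<^esub> g)) \<cdot>\<^bsub>A\<^esub> (e W \<rhd>\<^bsub>A\<^esub> PCmp E (PArr R k \<odot>\<^bsub>B\<^esub> PArr R h) g)"
    using arg_cong[OF E.PCmp_rwhisk[of "PCmp R k h" "PArr R k \<odot>\<^bsub>B\<^esub> PArr R h" "PArr R (k \<odot>\<^bsub>A\<^esub> h)" g], of "\<lambda>x. e W \<rhd>\<^bsub>A\<^esub> x"] assms YZ by simp
  have 4: "(e W \<rhd>\<^bsub>A\<^esub> PCmp E (PArr R k \<odot>\<^bsub>B\<^esub> PArr R h) g) \<cdot>\<^bsub>A\<^esub>
      (e W \<rhd>\<^bsub>A\<^esub> PCmp E (PArr R k) (PArr R h) \<lhd>\<^bsub>A\<^esub> PArr E g)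
    = (e W \<rhd>\<^bsub>A\<^esub> PCmp E (PArr R k) (PArr R h \<odot>\<^bsub>B\<^esub> g)) \<cdot>\<^bsub>A\<^esub>
      ((e W \<odot>\<^bsub>A\<^esub> PArr E (PArr R k)) \<rhd>\<^bsub>A\<^esub> PCmp E (PArr R h) g)"
    using arg_cong[OF E.PCmp_assoc_simp[of g "PArr R h" "PArr R k"], of "\<lambda>x. e W \<rhd>\<^bsub>A\<^esub> x"] assms YZ by simp
  show ?thesis
    using assms YZ
    by (simp add: q_def \<Phi>_def 1 E.D.reassoc[OF 2] E.D.reassoc[OF 3] E.D.reassoc[OF 4])
qed

lemma p_unit_left:
  assumes "g \<in> Arr B" "tgt B g = PObj R Y" "Y \<in> Obj A"
  shows "p Y (id1 B (PObj R Y)) g \<cdot>\<^bsub>A\<^esub> (unit_cell Y \<lhd>\<^bsub>A\<^esub> PArr E g) = id2 A (e Y \<odot>\<^bsub>A\<^esub> PArr E g)"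
  using arg_cong[OF E.PUnit_unit_simps(1)[of g "PObj R Y"], of "\<lambda>x. e Y \<rhd>\<^bsub>A\<^esub> x"] assms
  by (simp add: p_def unit_cell_def)

lemma p_unit_right:
  assumes "g \<in> Arr B" "tgt B g = PObj R Y" "Y \<in> Obj A" "src B g = X"
  shows "p Y g (id1 B X) \<cdot>\<^bsub>A\<^esub> ((e Y \<odot>\<^bsub>A\<^esub> PArr E g) \<rhd>\<^bsub>A\<^esub> PUnit E X) = id2 A (e Y \<odot>\<^bsub>A\<^esub> PArr E g)"
  using arg_cong[OF E.PUnit_unit_simps(2)[of g X], of "\<lambda>x. e Y \<rhd>\<^bsub>A\<^esub> x"] assms
  by (auto simp: p_def)

lemma q_unit_left:
  assumes "g \<in> Arr B" "tgt B g = PObj R Y" "Y \<in> Obj A"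
  shows "q (id1 A Y) g = \<Phi> Y (PUnit R Y \<lhd>\<^bsub>B\<^esub> g)"
proof -
  have 1: "TCell \<epsilon> (id1 A Y) \<lhd>\<^bsub>A\<^esub> PArr E g
    = (e Y \<rhd>\<^bsub>A\<^esub> PCell E (PUnit R Y) \<lhd>\<^bsub>A\<^esub> PArr E g) \<cdot>\<^bsub>A\<^esub> (unit_cell Y \<lhd>\<^bsub>A\<^esub> PArr E g)"
    using arg_cong[OF \<epsilon>.TCell_unit[of Y], of "\<lambda>x. x \<lhd>\<^bsub>A\<^esub> PArr E g"] assms by (simp add: unit_cell_def)
  have 2: "(e Y \<rhd>\<^bsub>A\<^esub> PCmp E (PArr R (id1 A Y)) g) \<cdot>\<^bsub>A\<^esub> (e Y \<rhd>\<^bsub>A\<^esub> PCell E (PUnit R Y) \<lhd>\<^bsub>A\<^esub> PArr E g)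
    = \<Phi> Y (PUnit R Y \<lhd>\<^bsub>B\<^esub> g) \<cdot>\<^bsub>A\<^esub> p Y (id1 B (PObj R Y)) g"
    using arg_cong[OF E.PCmp_rwhisk[of "PUnit R Y" "id1 B (PObj R Y)" "PArr R (id1 A Y)" g], of "\<lambda>x. e Y \<rhd>\<^bsub>A\<^esub> x"] assms
    by (simp add: \<Phi>_def p_def)
  show ?thesis
    using assms by (simp add: q_def 1 E.D.reassoc[OF 2] p_unit_left)
qed

text \<open>Acting on an identity recovers the 2-cell of the counit itself; this closes the
  computation in \<open>t_natural\<close>.\<close>

lemma q_unit_right:
  assumes "h \<in> Arr A" "src A h = Y" "tgt A h = Z"
  shows "q h (id1 B (PObj R Y)) \<cdot>\<^bsub>A\<^esub> (h \<rhd>\<^bsub>A\<^esub> unit_cell Y) = TCell \<epsilon> h"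
proof -
  have YZ: "Y \<in> Obj A" "Z \<in> Obj A" using assms by auto
  have 1: "(TCell \<epsilon> h \<lhd>\<^bsub>A\<^esub> PArr E (id1 B (PObj R Y))) \<cdot>\<^bsub>A\<^esub> ((h \<odot>\<^bsub>A\<^esub> e Y) \<rhd>\<^bsub>A\<^esub> PUnit E (PObj R Y))
    = ((e Z \<odot>\<^bsub>A\<^esub> PArr E (PArr R h)) \<rhd>\<^bsub>A\<^esub> PUnit E (PObj R Y)) \<cdot>\<^bsub>A\<^esub> TCell \<epsilon> h"
    using E.D.exchange[of "PUnit E (PObj R Y)" "TCell \<epsilon> h"] assms YZ by simp
  have 2: "(e Z \<rhd>\<^bsub>A\<^esub> PCmp E (PArr R h) (id1 B (PObj R Y))) \<cdot>\<^bsub>A\<^esub>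
      ((e Z \<odot>\<^bsub>A\<^esub> PArr E (PArr R h)) \<rhd>\<^bsub>A\<^esub> PUnit E (PObj R Y)) = id2 A (e Z \<odot>\<^bsub>A\<^esub> PArr E (PArr R h))"
    using p_unit_right[of "PArr R h" Z "PObj R Y"] assms YZ by (simp add: p_def)
  show ?thesis
    using assms YZ by (simp add: q_def unit_cell_def 1 E.D.reassoc[OF 2])
qed

lemma \<sigma>_natural:
  assumes "\<kappa> \<in> Cell A" "dom2 A \<kappa> = k" "cod2 A \<kappa> = k'" "X \<in> Obj B" "src A k = PObj E X" "tgt A k = Y"
  shows "\<Phi> Y (PCell R \<kappa> \<lhd>\<^bsub>B\<^esub> u X) \<cdot>\<^bsub>A\<^esub> \<sigma> X k = \<sigma> X k' \<cdot>\<^bsub>A\<^esub> \<kappa>"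
proof -
  have k: "k \<in> Arr A" "k' \<in> Arr A" "src A k' = PObj E X" "tgt A k' = Y" "Y \<in> Obj A"
    using assms by auto
  have 1: "(k' \<rhd>\<^bsub>A\<^esub> s X) \<cdot>\<^bsub>A\<^esub> \<kappa> = (\<kappa> \<lhd>\<^bsub>A\<^esub> (e (PObj E X) \<odot>\<^bsub>A\<^esub> PArr E (u X))) \<cdot>\<^bsub>A\<^esub> (k \<rhd>\<^bsub>A\<^esub> s X)"
    using E.D.exchange[of "s X" \<kappa>] assms k by simp
  have 2: "q k' (u X) \<cdot>\<^bsub>A\<^esub> (\<kappa> \<lhd>\<^bsub>A\<^esub> (e (PObj E X) \<odot>\<^bsub>A\<^esub> PArr E (u X))) = \<Phi> Y (PCell R \<kappa> \<lhd>\<^bsub>B\<^esub> u X) \<cdot>\<^bsub>A\<^esub> q k (u X)"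
    by (rule q_natural_left) (use assms k in auto)
  show ?thesis
    using assms k by (simp add: \<sigma>_def 1 E.D.reassoc[OF 2])
qed

text \<open>This is \<open>q_assoc\<close> at \<open>u X\<close>, with the whiskered
  \<open>s X\<close> carried along as a tail.\<close>

lemma \<sigma>_cmp:
  assumes "k \<in> Arr A" "h \<in> Arr A" "X \<in> Obj B" "src A k = PObj E X" "src A h = tgt A k" "tgt A h = Z"
  shows "\<Phi> Z (PCmp R h k \<lhd>\<^bsub>B\<^esub> u X) \<cdot>\<^bsub>A\<^esub> q h (PArr R k \<odot>\<^bsub>B\<^esub> u X) \<cdot>\<^bsub>A\<^esub> (h \<rhd>\<^bsub>A\<^esub> \<sigma> X k) = \<sigma> X (h \<odot>\<^bsub>A\<^esub> k)"
proof -
  have "Z \<in> Obj A" using assms by auto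
  moreover have "\<Phi> Z (PCmp R h k \<lhd>\<^bsub>B\<^esub> u X) \<cdot>\<^bsub>A\<^esub> q h (PArr R k \<odot>\<^bsub>B\<^esub> u X) \<cdot>\<^bsub>A\<^esub> (h \<rhd>\<^bsub>A\<^esub> q k (u X)) = q (h \<odot>\<^bsub>A\<^esub> k) (u X)"
    by (rule q_assoc) (use assms in auto)
  ultimately show ?thesis
    using assms by (simp add: \<sigma>_def E.D.reassoc3)
qed

lemma \<sigma>_id:
  assumes "X \<in> Obj B"
  shows "\<sigma> X (id1 A (PObj E X)) = \<Phi> (PObj E X) (PUnit R (PObj E X) \<lhd>\<^bsub>B\<^esub> u X) \<cdot>\<^bsub>A\<^esub> s X"
  using assms by (simp add: \<sigma>_def q_unit_left)

section \<open>Reflecting 2-cells along the fully faithful transposition\<close>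

text \<open>Faithfulness of the transposition. The axioms for the unit, the naturality of
  \<open>t\<close> and the first swallowtail equation, all equations in \<open>B\<close>, are proved
  by applying \<Phi> and computing in \<open>A\<close>.\<close>

lemma \<Phi>_eqD:
  assumes "\<Phi> Y \<alpha> = \<Phi> Y \<beta>" "\<alpha> \<in> Cell B" "\<beta> \<in> Cell B" "dom2 B \<beta> = dom2 B \<alpha>" "cod2 B \<beta> = cod2 B \<alpha>"
    "tgt B (dom2 B \<alpha>) = PObj R Y" "Y \<in> Obj A"
  shows "\<alpha> = \<beta>"
  using universal[of Y "dom2 B \<alpha>" "cod2 B \<alpha>"] assms
  by (auto simp: bij_betw_def inj_on_def \<Phi>_def)

lemma \<Phi>_surj:
  assumes "\<gamma> \<in> Cell A" "dom2 A \<gamma> = e Y \<odot>\<^bsub>A\<^esub> PArr E g" "cod2 A \<gamma> = e Y \<odot>\<^bsub>A\<^esub> PArr E g'"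
    "Y \<in> Obj A" "g \<in> Arr B" "g' \<in> Arr B" "src B g' = src B g" "tgt B g = PObj R Y" "tgt B g' = PObj R Y"
  shows "\<exists>\<alpha>. \<alpha> \<in> Cell B \<and> dom2 B \<alpha> = g \<and> cod2 B \<alpha> = g' \<and> \<Phi> Y \<alpha> = \<gamma>"
proof -
  have "\<gamma> \<in> (\<lambda>\<alpha>. e Y \<rhd>\<^bsub>A\<^esub> PCell E \<alpha>) ` hom2 B g g'"
    using bij_betw_imp_surj_on[OF universal[of Y g g']] assms by auto
  then show ?thesis
    by (auto simp: \<Phi>_def)
qed

lemma \<Phi>_iso_reflect:
  assumes "isocell A (\<Phi> Y \<alpha>)" "\<alpha> \<in> Cell B" "tgt B (dom2 B \<alpha>) = PObj R Y" "Y \<in> Obj A"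
  shows "isocell B \<alpha>"
proof -
  have "dom2 A (inv2 A (\<Phi> Y \<alpha>)) = e Y \<odot>\<^bsub>A\<^esub> PArr E (cod2 B \<alpha>)" "cod2 A (inv2 A (\<Phi> Y \<alpha>)) = e Y \<odot>\<^bsub>A\<^esub> PArr E (dom2 B \<alpha>)"
    "inv2 A (\<Phi> Y \<alpha>) \<in> Cell A"
    using assms by simp_all
  then obtain \<beta> where \<beta>: "\<beta> \<in> Cell B" "dom2 B \<beta> = cod2 B \<alpha>" "cod2 B \<beta> = dom2 B \<alpha>" "\<Phi> Y \<beta> = inv2 A (\<Phi> Y \<alpha>)"
    using \<Phi>_surj[of "inv2 A (\<Phi> Y \<alpha>)" Y "cod2 B \<alpha>" "dom2 B \<alpha>"] assms by auto
  show ?thesis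
  proof (rule E.C.isocellI[of _ \<beta>])
    show "\<beta> \<cdot>\<^bsub>B\<^esub> \<alpha> = id2 B (dom2 B \<alpha>)"
      by (rule \<Phi>_eqD[of Y]) (use assms \<beta> in simp_all)
    show "\<alpha> \<cdot>\<^bsub>B\<^esub> \<beta> = id2 B (cod2 B \<alpha>)"
      by (rule \<Phi>_eqD[of Y]) (use assms \<beta> in simp_all)
  qed (use assms \<beta> in auto)
qed

text \<open>\<open>\<sigma> X k\<close> exhibits \<open>R k \<odot> u X\<close> as representing \<open>k\<close>: invertible 2-cells \<open>k \<Rightarrow> \<Phi> g\<close> factor through it.\<close>

lemma extension_exists:
  assumes "isocell A \<gamma>" "dom2 A \<gamma> = k" "cod2 A \<gamma> = e Y \<odot>\<^bsub>A\<^esub> PArr E g" "X \<in> Obj B" "src A k = PObj E X"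
    "tgt A k = Y" "g \<in> Arr B" "src B g = X" "tgt B g = PObj R Y"
  shows "\<exists>\<alpha>. isocell B \<alpha> \<and> dom2 B \<alpha> = PArr R k \<odot>\<^bsub>B\<^esub> u X \<and> cod2 B \<alpha> = g \<and> \<Phi> Y \<alpha> \<cdot>\<^bsub>A\<^esub> \<sigma> X k = \<gamma>"
proof -
  have k: "k \<in> Arr A" "Y \<in> Obj A" "\<gamma> \<in> Cell A" using assms by auto
  have "\<exists>\<alpha>. \<alpha> \<in> Cell B \<and> dom2 B \<alpha> = PArr R k \<odot>\<^bsub>B\<^esub> u X \<and> cod2 B \<alpha> = g \<and> \<Phi> Y \<alpha> = \<gamma> \<cdot>\<^bsub>A\<^esub> inv2 A (\<sigma> X k)"
    by (rule \<Phi>_surj) (use assms k in simp_all)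
  then obtain \<alpha> where \<alpha>: "\<alpha> \<in> Cell B" "dom2 B \<alpha> = PArr R k \<odot>\<^bsub>B\<^esub> u X" "cod2 B \<alpha> = g"
    "\<Phi> Y \<alpha> = \<gamma> \<cdot>\<^bsub>A\<^esub> inv2 A (\<sigma> X k)"
    by blast
  have "isocell B \<alpha>"
    by (rule \<Phi>_iso_reflect[of Y]) (use assms k \<alpha> in simp_all)
  moreover have "\<Phi> Y \<alpha> \<cdot>\<^bsub>A\<^esub> \<sigma> X k = \<gamma>"
    using assms k \<alpha> by simp
  ultimately show ?thesis
    using \<alpha> by blast
qed

section \<open>The cells of the unit and the second triangle, defined by the equations they must
  satisfy\<close>

text \<open>The equation imposed is the modification axiom of \<open>s\<close> at \<open>f\<close>,
  solved for the cell of the unit. \<open>extension_exists\<close> provides a solution, and it is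
  unique because \<sigma> is invertible and \<Phi> faithful.\<close>

definition \<eta>_cell where
  "\<eta>_cell f = (SOME \<alpha>. isocell B \<alpha> \<and> dom2 B \<alpha> = PArr R (PArr E f) \<odot>\<^bsub>B\<^esub> u (src B f) \<and> cod2 B \<alpha> = u (tgt B f) \<odot>\<^bsub>B\<^esub> f \<and>
     \<Phi> (PObj E (tgt B f)) \<alpha> \<cdot>\<^bsub>A\<^esub> \<sigma> (src B f) (PArr E f) =
     p (PObj E (tgt B f)) (u (tgt B f)) f \<cdot>\<^bsub>A\<^esub> (s (tgt B f) \<lhd>\<^bsub>A\<^esub> PArr E f))"

definition \<eta> where "\<eta> = \<lparr>TArr = u, TCell = \<eta>_cell\<rparr>"

text \<open>The equation imposed is the swallowtail equation of the counit, solved for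
  \<open>t Y\<close>.\<close>

definition t where
  "t Y = (SOME \<alpha>. isocell B \<alpha> \<and> dom2 B \<alpha> = PArr R (e Y) \<odot>\<^bsub>B\<^esub> u (PObj R Y) \<and> cod2 B \<alpha> = id1 B (PObj R Y) \<and>
     \<Phi> Y \<alpha> \<cdot>\<^bsub>A\<^esub> \<sigma> (PObj R Y) (e Y) = unit_cell Y)"

lemma \<eta>_sel [simp]: "TArr \<eta> X = u X" "TCell \<eta> f = \<eta>_cell f"
  by (simp_all add: \<eta>_def)

lemma \<eta>_cell_props:
  assumes "f \<in> Arr B"
  shows "isocell B (\<eta>_cell f)" "\<eta>_cell f \<in> Cell B" "dom2 B (\<eta>_cell f) = PArr R (PArr E f) \<odot>\<^bsub>B\<^esub> u (src B f)"
    "cod2 B (\<eta>_cell f) = u (tgt B f) \<odot>\<^bsub>B\<^esub> f"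
    "\<lbrakk>src B f = X; tgt B f = X'\<rbrakk> \<Longrightarrow> \<Phi> (PObj E X') (\<eta>_cell f) \<cdot>\<^bsub>A\<^esub> \<sigma> X (PArr E f) =
     p (PObj E X') (u X') f \<cdot>\<^bsub>A\<^esub> (s X' \<lhd>\<^bsub>A\<^esub> PArr E f)"
proof -
  have "\<exists>\<alpha>. isocell B \<alpha> \<and> dom2 B \<alpha> = PArr R (PArr E f) \<odot>\<^bsub>B\<^esub> u (src B f) \<and> cod2 B \<alpha> = u (tgt B f) \<odot>\<^bsub>B\<^esub> f \<and>
     \<Phi> (PObj E (tgt B f)) \<alpha> \<cdot>\<^bsub>A\<^esub> \<sigma> (src B f) (PArr E f) =
     p (PObj E (tgt B f)) (u (tgt B f)) f \<cdot>\<^bsub>A\<^esub> (s (tgt B f) \<lhd>\<^bsub>A\<^esub> PArr E f)"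
    by (rule extension_exists) (use assms in simp_all)
  from someI_ex[OF this]
  show "isocell B (\<eta>_cell f)" "\<eta>_cell f \<in> Cell B" "dom2 B (\<eta>_cell f) = PArr R (PArr E f) \<odot>\<^bsub>B\<^esub> u (src B f)"
    "cod2 B (\<eta>_cell f) = u (tgt B f) \<odot>\<^bsub>B\<^esub> f"
    "\<lbrakk>src B f = X; tgt B f = X'\<rbrakk> \<Longrightarrow> \<Phi> (PObj E X') (\<eta>_cell f) \<cdot>\<^bsub>A\<^esub> \<sigma> X (PArr E f) =
     p (PObj E X') (u X') f \<cdot>\<^bsub>A\<^esub> (s X' \<lhd>\<^bsub>A\<^esub> PArr E f)"
    unfolding \<eta>_cell_def[symmetric] by auto
qed

declare \<eta>_cell_props(1-4) [simp]

lemma t_props: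
  assumes "Y \<in> Obj A"
  shows "isocell B (t Y)" "t Y \<in> Cell B" "dom2 B (t Y) = PArr R (e Y) \<odot>\<^bsub>B\<^esub> u (PObj R Y)"
    "cod2 B (t Y) = id1 B (PObj R Y)" "\<Phi> Y (t Y) \<cdot>\<^bsub>A\<^esub> \<sigma> (PObj R Y) (e Y) = unit_cell Y"
proof -
  have "\<exists>\<alpha>. isocell B \<alpha> \<and> dom2 B \<alpha> = PArr R (e Y) \<odot>\<^bsub>B\<^esub> u (PObj R Y) \<and> cod2 B \<alpha> = id1 B (PObj R Y) \<and>
     \<Phi> Y \<alpha> \<cdot>\<^bsub>A\<^esub> \<sigma> (PObj R Y) (e Y) = unit_cell Y"
    by (rule extension_exists) (use assms in simp_all)
  from someI_ex[OF this]
  show "isocell B (t Y)" "t Y \<in> Cell B" "dom2 B (t Y) = PArr R (e Y) \<odot>\<^bsub>B\<^esub> u (PObj R Y)"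
    "cod2 B (t Y) = id1 B (PObj R Y)" "\<Phi> Y (t Y) \<cdot>\<^bsub>A\<^esub> \<sigma> (PObj R Y) (e Y) = unit_cell Y"
    unfolding t_def[symmetric] by auto
qed

declare t_props(1-4) [simp]

section \<open>Pseudonaturality of the unit\<close>

text \<open>After \<Phi> and composition with the invertible \<sigma>, the defining equation of
  \<open>\<eta>_cell\<close> replaces it on both sides by \<open>p\<close> and \<open>s\<close>,
  whose compatibility with \<alpha> is naturality and exchange.\<close>

lemma u_natural:
  assumes "\<alpha> \<in> Cell B" "dom2 B \<alpha> = f" "cod2 B \<alpha> = f'" "src B f = X" "tgt B f = X'"
  shows "(u X' \<rhd>\<^bsub>B\<^esub> \<alpha>) \<cdot>\<^bsub>B\<^esub> \<eta>_cell f = \<eta>_cell f' \<cdot>\<^bsub>B\<^esub> (PCell R (PCell E \<alpha>) \<lhd>\<^bsub>B\<^esub> u X)" (is "?l = ?r")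
proof (rule \<Phi>_eqD[of "PObj E X'"])
  have f: "f \<in> Arr B" "f' \<in> Arr B" "src B f' = X" "tgt B f' = X'" "X \<in> Obj B" "X' \<in> Obj B"
    using assms by auto
  have 1: "p (PObj E X') (u X') f' \<cdot>\<^bsub>A\<^esub> ((e (PObj E X') \<odot>\<^bsub>A\<^esub> PArr E (u X')) \<rhd>\<^bsub>A\<^esub> PCell E \<alpha>)
    = \<Phi> (PObj E X') (u X' \<rhd>\<^bsub>B\<^esub> \<alpha>) \<cdot>\<^bsub>A\<^esub> p (PObj E X') (u X') f"
    by (rule p_natural_right) (use assms f in auto)
  have 2: "(s X' \<lhd>\<^bsub>A\<^esub> PArr E f') \<cdot>\<^bsub>A\<^esub> PCell E \<alpha>
    = ((e (PObj E X') \<odot>\<^bsub>A\<^esub> PArr E (u X')) \<rhd>\<^bsub>A\<^esub> PCell E \<alpha>) \<cdot>\<^bsub>A\<^esub> (s X' \<lhd>\<^bsub>A\<^esub> PArr E f)"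
    using E.D.exchange[of "PCell E \<alpha>" "s X'"] assms f by simp
  have 3: "\<Phi> (PObj E X') (PCell R (PCell E \<alpha>) \<lhd>\<^bsub>B\<^esub> u X) \<cdot>\<^bsub>A\<^esub> \<sigma> X (PArr E f) = \<sigma> X (PArr E f') \<cdot>\<^bsub>A\<^esub> PCell E \<alpha>"
    by (rule \<sigma>_natural) (use assms f in auto)
  note 4 = \<eta>_cell_props(5)[OF f(1) assms(4,5)] \<eta>_cell_props(5)[OF f(2-4)]
  show "\<Phi> (PObj E X') ?l = \<Phi> (PObj E X') ?r"
    by (rule E.D.iso_right_cancel[of "\<sigma> X (PArr E f)"])
      (use assms f in \<open>simp_all add: 4 3 2 E.D.reassoc[OF 4(2)] E.D.reassoc[OF 1]\<close>)
qed (use assms in auto)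

lemma u_unit:
  assumes "X \<in> Obj B"
  shows "\<eta>_cell (id1 B X) \<cdot>\<^bsub>B\<^esub> (PCell R (PUnit E X) \<lhd>\<^bsub>B\<^esub> u X) \<cdot>\<^bsub>B\<^esub> (PUnit R (PObj E X) \<lhd>\<^bsub>B\<^esub> u X) = id2 B (u X)" (is "?l = ?r")
proof (rule \<Phi>_eqD[of "PObj E X"])
  let ?Y = "PObj E X"
  have 1: "\<Phi> ?Y (PCell R (PUnit E X) \<lhd>\<^bsub>B\<^esub> u X) \<cdot>\<^bsub>A\<^esub> \<sigma> X (id1 A ?Y) = \<sigma> X (PArr E (id1 B X)) \<cdot>\<^bsub>A\<^esub> PUnit E X"
    by (rule \<sigma>_natural) (use assms in auto)
  have 2: "\<Phi> ?Y (\<eta>_cell (id1 B X)) \<cdot>\<^bsub>A\<^esub> \<sigma> X (PArr E (id1 B X)) = p ?Y (u X) (id1 B X) \<cdot>\<^bsub>A\<^esub> (s X \<lhd>\<^bsub>A\<^esub> PArr E (id1 B X))"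
    by (rule \<eta>_cell_props) (use assms in auto)
  have 3: "(s X \<lhd>\<^bsub>A\<^esub> PArr E (id1 B X)) \<cdot>\<^bsub>A\<^esub> PUnit E X = ((e ?Y \<odot>\<^bsub>A\<^esub> PArr E (u X)) \<rhd>\<^bsub>A\<^esub> PUnit E X) \<cdot>\<^bsub>A\<^esub> s X"
    using E.D.exchange[of "PUnit E X" "s X"] assms by simp
  have 4: "p ?Y (u X) (id1 B X) \<cdot>\<^bsub>A\<^esub> ((e ?Y \<odot>\<^bsub>A\<^esub> PArr E (u X)) \<rhd>\<^bsub>A\<^esub> PUnit E X) = id2 A (e ?Y \<odot>\<^bsub>A\<^esub> PArr E (u X))"
    by (rule p_unit_right) (use assms in auto)
  show "\<Phi> ?Y ?l = \<Phi> ?Y ?r"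
    by (rule E.D.iso_right_cancel[of "s X"])
      (use assms in \<open>simp_all add: \<sigma>_id[symmetric] 1 E.D.reassoc[OF 2] 3 E.D.reassoc[OF 4]\<close>)
qed (use assms in simp_all)

text \<open>Both sides are transposed and tested on the isomorphism that exhibits
  \<open>R (E g) \<odot> R (E f) \<odot> u X\<close> as representing \<open>E g \<odot> E f\<close>.
  On the left \<open>\<sigma>_cmp\<close> absorbs it; on the right it is consumed one 1-cell at a
  time, first by the cell at \<open>f\<close>, then by the cell at \<open>g\<close>.\<close>

lemma u_cmp:
  assumes "f \<in> Arr B" "g \<in> Arr B" "src B g = tgt B f" "src B f = X" "tgt B g = Z"
  shows "\<eta>_cell (g \<odot>\<^bsub>B\<^esub> f) \<cdot>\<^bsub>B\<^esub> (PCell R (PCmp E g f) \<lhd>\<^bsub>B\<^esub> u X) \<cdot>\<^bsub>B\<^esub> (PCmp R (PArr E g) (PArr E f) \<lhd>\<^bsub>B\<^esub> u X)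
    = (\<eta>_cell g \<lhd>\<^bsub>B\<^esub> f) \<cdot>\<^bsub>B\<^esub> (PArr R (PArr E g) \<rhd>\<^bsub>B\<^esub> \<eta>_cell f)" (is "?l = ?r")
proof (rule \<Phi>_eqD[of "PObj E Z"])
  let ?Ef = "PArr E f"
  let ?Eg = "PArr E g"
  let ?Z = "PObj E Z" and ?Y = "tgt B f"
  have XZ: "X \<in> Obj B" "Z \<in> Obj B" using assms by auto
  have 1: "\<Phi> ?Z (PCmp R ?Eg ?Ef \<lhd>\<^bsub>B\<^esub> u X) \<cdot>\<^bsub>A\<^esub> q ?Eg (PArr R ?Ef \<odot>\<^bsub>B\<^esub> u X) \<cdot>\<^bsub>A\<^esub>
      (PArr E g \<rhd>\<^bsub>A\<^esub> \<sigma> X ?Ef) = \<sigma> X (PArr E g \<odot>\<^bsub>A\<^esub> PArr E f)"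
    by (rule \<sigma>_cmp) (use assms XZ in auto)
  have 2: "\<Phi> ?Z (PCell R (PCmp E g f) \<lhd>\<^bsub>B\<^esub> u X) \<cdot>\<^bsub>A\<^esub> \<sigma> X (PArr E g \<odot>\<^bsub>A\<^esub> PArr E f)
      = \<sigma> X (PArr E (g \<odot>\<^bsub>B\<^esub> f)) \<cdot>\<^bsub>A\<^esub> PCmp E g f"
    by (rule \<sigma>_natural) (use assms XZ in auto)
  have 3: "\<Phi> ?Z (\<eta>_cell (g \<odot>\<^bsub>B\<^esub> f)) \<cdot>\<^bsub>A\<^esub> \<sigma> X (PArr E (g \<odot>\<^bsub>B\<^esub> f))
      = p ?Z (u Z) (g \<odot>\<^bsub>B\<^esub> f) \<cdot>\<^bsub>A\<^esub> (s Z \<lhd>\<^bsub>A\<^esub> PArr E (g \<odot>\<^bsub>B\<^esub> f))"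
    by (rule \<eta>_cell_props) (use assms XZ in auto)
  have 4: "(s Z \<lhd>\<^bsub>A\<^esub> PArr E (g \<odot>\<^bsub>B\<^esub> f)) \<cdot>\<^bsub>A\<^esub> PCmp E g f
      = ((e ?Z \<odot>\<^bsub>A\<^esub> PArr E (u Z)) \<rhd>\<^bsub>A\<^esub> PCmp E g f) \<cdot>\<^bsub>A\<^esub> (s Z \<lhd>\<^bsub>A\<^esub> (PArr E g \<odot>\<^bsub>A\<^esub> PArr E f))"
    using E.D.exchange[of "PCmp E g f" "s Z"] assms XZ by simp
  have 5: "p ?Z (u Z) (g \<odot>\<^bsub>B\<^esub> f) \<cdot>\<^bsub>A\<^esub> ((e ?Z \<odot>\<^bsub>A\<^esub> PArr E (u Z)) \<rhd>\<^bsub>A\<^esub> PCmp E g f)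
      = p ?Z (u Z \<odot>\<^bsub>B\<^esub> g) f \<cdot>\<^bsub>A\<^esub> (p ?Z (u Z) g \<lhd>\<^bsub>A\<^esub> PArr E f)"
    by (rule p_assoc) (use assms XZ in auto)
  have 6: "\<Phi> ?Z (PArr R ?Eg \<rhd>\<^bsub>B\<^esub> \<eta>_cell f) \<cdot>\<^bsub>A\<^esub> q ?Eg (PArr R ?Ef \<odot>\<^bsub>B\<^esub> u X)
      = q ?Eg (u ?Y \<odot>\<^bsub>B\<^esub> f) \<cdot>\<^bsub>A\<^esub> (PArr E g \<rhd>\<^bsub>A\<^esub> \<Phi> (PObj E ?Y) (\<eta>_cell f))"
    by (rule q_natural_right[symmetric]) (use assms XZ in auto)
  have 7: "\<Phi> (PObj E ?Y) (\<eta>_cell f) \<cdot>\<^bsub>A\<^esub> \<sigma> X ?Ef = p (PObj E ?Y) (u ?Y) f \<cdot>\<^bsub>A\<^esub> (s ?Y \<lhd>\<^bsub>A\<^esub> PArr E f)"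
    by (rule \<eta>_cell_props) (use assms XZ in auto)
  have 8: "(PArr E g \<rhd>\<^bsub>A\<^esub> \<Phi> (PObj E ?Y) (\<eta>_cell f)) \<cdot>\<^bsub>A\<^esub> (PArr E g \<rhd>\<^bsub>A\<^esub> \<sigma> X ?Ef)
      = (PArr E g \<rhd>\<^bsub>A\<^esub> p (PObj E ?Y) (u ?Y) f) \<cdot>\<^bsub>A\<^esub> (PArr E g \<rhd>\<^bsub>A\<^esub> s ?Y \<lhd>\<^bsub>A\<^esub> PArr E f)"
    using arg_cong[OF 7, of "\<lambda>x. PArr E g \<rhd>\<^bsub>A\<^esub> x"] assms XZ by simp
  have 9: "q ?Eg (u ?Y \<odot>\<^bsub>B\<^esub> f) \<cdot>\<^bsub>A\<^esub> (PArr E g \<rhd>\<^bsub>A\<^esub> p (PObj E ?Y) (u ?Y) f)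
      = p ?Z (PArr R ?Eg \<odot>\<^bsub>B\<^esub> u ?Y) f \<cdot>\<^bsub>A\<^esub> (q ?Eg (u ?Y) \<lhd>\<^bsub>A\<^esub> PArr E f)"
    by (rule p_q[symmetric]) (use assms XZ in auto)
  have 10: "(q ?Eg (u ?Y) \<lhd>\<^bsub>A\<^esub> PArr E f) \<cdot>\<^bsub>A\<^esub> (PArr E g \<rhd>\<^bsub>A\<^esub> s ?Y \<lhd>\<^bsub>A\<^esub> PArr E f) = \<sigma> ?Y ?Eg \<lhd>\<^bsub>A\<^esub> PArr E f"
    using assms XZ by (simp add: \<sigma>_def)
  have 11: "\<Phi> ?Z (\<eta>_cell g \<lhd>\<^bsub>B\<^esub> f) \<cdot>\<^bsub>A\<^esub> p ?Z (PArr R ?Eg \<odot>\<^bsub>B\<^esub> u ?Y) f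
      = p ?Z (u Z \<odot>\<^bsub>B\<^esub> g) f \<cdot>\<^bsub>A\<^esub> (\<Phi> ?Z (\<eta>_cell g) \<lhd>\<^bsub>A\<^esub> PArr E f)"
    by (rule p_natural_left[symmetric]) (use assms XZ in auto)
  have 12: "\<Phi> ?Z (\<eta>_cell g) \<cdot>\<^bsub>A\<^esub> \<sigma> ?Y ?Eg = p ?Z (u Z) g \<cdot>\<^bsub>A\<^esub> (s Z \<lhd>\<^bsub>A\<^esub> PArr E g)"
    by (rule \<eta>_cell_props) (use assms XZ in auto)
  have 13: "(\<Phi> ?Z (\<eta>_cell g) \<lhd>\<^bsub>A\<^esub> PArr E f) \<cdot>\<^bsub>A\<^esub> (\<sigma> ?Y ?Eg \<lhd>\<^bsub>A\<^esub> PArr E f)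
      = (p ?Z (u Z) g \<lhd>\<^bsub>A\<^esub> PArr E f) \<cdot>\<^bsub>A\<^esub> (s Z \<lhd>\<^bsub>A\<^esub> (PArr E g \<odot>\<^bsub>A\<^esub> PArr E f))"
    using arg_cong[OF 12, of "\<lambda>x. x \<lhd>\<^bsub>A\<^esub> PArr E f"] assms XZ by simp
  show "\<Phi> ?Z ?l = \<Phi> ?Z ?r"
    by (rule E.D.iso_right_cancel[of "q ?Eg (PArr R ?Ef \<odot>\<^bsub>B\<^esub> u X) \<cdot>\<^bsub>A\<^esub> (PArr E g \<rhd>\<^bsub>A\<^esub> \<sigma> X ?Ef)"])
      (use assms XZ in \<open>simp_all add: 1 2 E.D.reassoc[OF 3] 4 E.D.reassoc[OF 5]
         E.D.reassoc[OF 6] 8 E.D.reassoc[OF 9] 10 E.D.reassoc[OF 11] 13\<close>)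
qed (use assms in auto)

lemma pseudonatural_\<eta>: "pseudonatural B B (ps_id B) (ps_comp B R E) \<eta>"
proof (rule pseudonaturalI)
  show "pseudofunctor B B (ps_id B)" "pseudofunctor B B (ps_comp B R E)"
    by (intro pseudofunctor_ps_id pseudofunctor_ps_comp[of B A] E.C.two_category_axioms
        E.pseudofunctor_axioms R.pseudofunctor_axioms)+
qed (simp_all add: u_natural u_unit u_cmp)

text \<open>Both the naturality of \<open>t\<close> and the swallowtail equation for the unit reduce to this identity.\<close>

lemma extension_counit:
  assumes "g \<in> Arr B" "src B g = X" "tgt B g = PObj R Y" "Y \<in> Obj A"
  shows "\<Phi> Y ((t Y \<lhd>\<^bsub>B\<^esub> g) \<cdot>\<^bsub>B\<^esub> (PArr R (e Y) \<rhd>\<^bsub>B\<^esub> \<eta>_cell g) \<cdot>\<^bsub>B\<^esub> (inv2 B (PCmp R (e Y) (PArr E g)) \<lhd>\<^bsub>B\<^esub> u X))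
     \<cdot>\<^bsub>A\<^esub> \<sigma> X (e Y \<odot>\<^bsub>A\<^esub> PArr E g) = id2 A (e Y \<odot>\<^bsub>A\<^esub> PArr E g)"
proof -
  have X: "X \<in> Obj B" using assms by auto
  let ?E = "PObj E (PObj R Y)" and ?c = "PCmp R (e Y) (PArr E g)"
  \<comment> \<open>Expanding \<sigma> at this composite 1-cell produces the comparison cell of
    \<open>R\<close> that cancels the inverse in the statement. What remains meets the defining
    equation of \<open>\<eta>_cell g\<close> and, once \<open>p_q\<close> has brought
    \<open>q\<close> next to \<open>s\<close>, that of \<open>t Y\<close>.\<close>
  have 1: "\<sigma> X (e Y \<odot>\<^bsub>A\<^esub> PArr E g) = \<Phi> Y (?c \<lhd>\<^bsub>B\<^esub> u X) \<cdot>\<^bsub>A\<^esub> q (e Y) (PArr R (PArr E g) \<odot>\<^bsub>B\<^esub> u X) \<cdot>\<^bsub>A\<^esub>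
      (e Y \<rhd>\<^bsub>A\<^esub> \<sigma> X (PArr E g))"
    by (rule \<sigma>_cmp[symmetric]) (use assms X in auto)
  have 2: "\<Phi> Y (inv2 B ?c \<lhd>\<^bsub>B\<^esub> u X) \<cdot>\<^bsub>A\<^esub> \<Phi> Y (?c \<lhd>\<^bsub>B\<^esub> u X) = id2 A (e Y \<odot>\<^bsub>A\<^esub> PArr E (PArr R (e Y) \<odot>\<^bsub>B\<^esub> PArr R (PArr E g) \<odot>\<^bsub>B\<^esub> u X))"
  proof -
    have "(inv2 B ?c \<lhd>\<^bsub>B\<^esub> u X) \<cdot>\<^bsub>B\<^esub> (?c \<lhd>\<^bsub>B\<^esub> u X) = id2 B (PArr R (e Y) \<odot>\<^bsub>B\<^esub> PArr R (PArr E g) \<odot>\<^bsub>B\<^esub> u X)"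
      using E.C.whisk_vcmp(2)[of ?c "inv2 B ?c" "u X"] assms X by simp
    from arg_cong[OF this, of "\<Phi> Y"] show ?thesis
      using assms X by simp
  qed
  have 3: "\<Phi> Y (PArr R (e Y) \<rhd>\<^bsub>B\<^esub> \<eta>_cell g) \<cdot>\<^bsub>A\<^esub> q (e Y) (PArr R (PArr E g) \<odot>\<^bsub>B\<^esub> u X)
      = q (e Y) (u (PObj R Y) \<odot>\<^bsub>B\<^esub> g) \<cdot>\<^bsub>A\<^esub> (e Y \<rhd>\<^bsub>A\<^esub> \<Phi> ?E (\<eta>_cell g))"
    by (rule q_natural_right[symmetric]) (use assms X in auto)
  have 4: "\<Phi> ?E (\<eta>_cell g) \<cdot>\<^bsub>A\<^esub> \<sigma> X (PArr E g) = p ?E (u (PObj R Y)) g \<cdot>\<^bsub>A\<^esub> (s (PObj R Y) \<lhd>\<^bsub>A\<^esub> PArr E g)"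
    by (rule \<eta>_cell_props) (use assms X in auto)
  have 5: "(e Y \<rhd>\<^bsub>A\<^esub> \<Phi> ?E (\<eta>_cell g)) \<cdot>\<^bsub>A\<^esub> (e Y \<rhd>\<^bsub>A\<^esub> \<sigma> X (PArr E g))
      = (e Y \<rhd>\<^bsub>A\<^esub> p ?E (u (PObj R Y)) g) \<cdot>\<^bsub>A\<^esub> (e Y \<rhd>\<^bsub>A\<^esub> s (PObj R Y) \<lhd>\<^bsub>A\<^esub> PArr E g)"
    using arg_cong[OF 4, of "\<lambda>x. e Y \<rhd>\<^bsub>A\<^esub> x"] assms X by simp
  have 6: "q (e Y) (u (PObj R Y) \<odot>\<^bsub>B\<^esub> g) \<cdot>\<^bsub>A\<^esub> (e Y \<rhd>\<^bsub>A\<^esub> p ?E (u (PObj R Y)) g)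
      = p Y (PArr R (e Y) \<odot>\<^bsub>B\<^esub> u (PObj R Y)) g \<cdot>\<^bsub>A\<^esub> (q (e Y) (u (PObj R Y)) \<lhd>\<^bsub>A\<^esub> PArr E g)"
    by (rule p_q[symmetric]) (use assms X in auto)
  have 7: "(q (e Y) (u (PObj R Y)) \<lhd>\<^bsub>A\<^esub> PArr E g) \<cdot>\<^bsub>A\<^esub> (e Y \<rhd>\<^bsub>A\<^esub> s (PObj R Y) \<lhd>\<^bsub>A\<^esub> PArr E g)
      = \<sigma> (PObj R Y) (e Y) \<lhd>\<^bsub>A\<^esub> PArr E g"
    using assms X by (simp add: \<sigma>_def)
  have 8: "\<Phi> Y (t Y \<lhd>\<^bsub>B\<^esub> g) \<cdot>\<^bsub>A\<^esub> p Y (PArr R (e Y) \<odot>\<^bsub>B\<^esub> u (PObj R Y)) g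
      = p Y (id1 B (PObj R Y)) g \<cdot>\<^bsub>A\<^esub> (\<Phi> Y (t Y) \<lhd>\<^bsub>A\<^esub> PArr E g)"
    by (rule p_natural_left[symmetric]) (use assms X in auto)
  have 9: "(\<Phi> Y (t Y) \<lhd>\<^bsub>A\<^esub> PArr E g) \<cdot>\<^bsub>A\<^esub> (\<sigma> (PObj R Y) (e Y) \<lhd>\<^bsub>A\<^esub> PArr E g) = unit_cell Y \<lhd>\<^bsub>A\<^esub> PArr E g"
    using arg_cong[OF t_props(5)[OF assms(4)], of "\<lambda>x. x \<lhd>\<^bsub>A\<^esub> PArr E g"] assms X by simp
  show ?thesis
    using assms X by (simp add: 1 E.D.reassoc[OF 2] E.D.reassoc[OF 3] 5 E.D.reassoc[OF 6] 7
        E.D.reassoc[OF 8] 9 p_unit_left)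
qed

section \<open>Triangle modifications and swallowtail equations\<close>

text \<open>After transposing, both sides become the counit cell at \<open>h\<close>: the left by
  \<open>extension_counit\<close> at \<open>PArr R h\<close>, the right by the defining equation of
  \<open>t Y\<close> together with \<open>q_unit_right\<close>.\<close>

lemma t_natural:
  assumes "h \<in> Arr A" "src A h = Y" "tgt A h = Z"
  shows "(t Z \<lhd>\<^bsub>B\<^esub> PArr R h) \<cdot>\<^bsub>B\<^esub> (PArr R (e Z) \<rhd>\<^bsub>B\<^esub> \<eta>_cell (PArr R h)) \<cdot>\<^bsub>B\<^esub>
      (inv2 B (PCmp R (e Z) (PArr E (PArr R h))) \<lhd>\<^bsub>B\<^esub> u (PObj R Y)) \<cdot>\<^bsub>B\<^esub> (PCell R (TCell \<epsilon> h) \<lhd>\<^bsub>B\<^esub> u (PObj R Y)) \<cdot>\<^bsub>B\<^esub>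
      (PCmp R h (e Y) \<lhd>\<^bsub>B\<^esub> u (PObj R Y)) = PArr R h \<rhd>\<^bsub>B\<^esub> t Y" (is "?l = ?r")
proof (rule \<Phi>_eqD[of Z])
  have YZ: "Y \<in> Obj A" "Z \<in> Obj A" using assms by auto
  let ?X = "PObj R Y"
  have 1: "\<Phi> Z (PCmp R h (e Y) \<lhd>\<^bsub>B\<^esub> u ?X) \<cdot>\<^bsub>A\<^esub> q h (PArr R (e Y) \<odot>\<^bsub>B\<^esub> u ?X) \<cdot>\<^bsub>A\<^esub> (h \<rhd>\<^bsub>A\<^esub> \<sigma> ?X (e Y)) = \<sigma> ?X (h \<odot>\<^bsub>A\<^esub> e Y)"
    by (rule \<sigma>_cmp) (use assms YZ in auto)
  have 2: "\<Phi> Z (PCell R (TCell \<epsilon> h) \<lhd>\<^bsub>B\<^esub> u ?X) \<cdot>\<^bsub>A\<^esub> \<sigma> ?X (h \<odot>\<^bsub>A\<^esub> e Y) = \<sigma> ?X (e Z \<odot>\<^bsub>A\<^esub> PArr E (PArr R h)) \<cdot>\<^bsub>A\<^esub> TCell \<epsilon> h"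
    by (rule \<sigma>_natural) (use assms YZ in auto)
  have "\<Phi> Z ((t Z \<lhd>\<^bsub>B\<^esub> PArr R h) \<cdot>\<^bsub>B\<^esub> (PArr R (e Z) \<rhd>\<^bsub>B\<^esub> \<eta>_cell (PArr R h)) \<cdot>\<^bsub>B\<^esub>
       (inv2 B (PCmp R (e Z) (PArr E (PArr R h))) \<lhd>\<^bsub>B\<^esub> u ?X)) \<cdot>\<^bsub>A\<^esub> \<sigma> ?X (e Z \<odot>\<^bsub>A\<^esub> PArr E (PArr R h))
     = id2 A (e Z \<odot>\<^bsub>A\<^esub> PArr E (PArr R h))"
    by (rule extension_counit) (use assms YZ in auto)
  from arg_cong[OF this, of "\<lambda>x. x \<cdot>\<^bsub>A\<^esub> TCell \<epsilon> h"] have 3: "\<Phi> Z (t Z \<lhd>\<^bsub>B\<^esub> PArr R h) \<cdot>\<^bsub>A\<^esub> \<Phi> Z (PArr R (e Z) \<rhd>\<^bsub>B\<^esub> \<eta>_cell (PArr R h)) \<cdot>\<^bsub>A\<^esub>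
       \<Phi> Z (inv2 B (PCmp R (e Z) (PArr E (PArr R h))) \<lhd>\<^bsub>B\<^esub> u ?X) \<cdot>\<^bsub>A\<^esub> \<sigma> ?X (e Z \<odot>\<^bsub>A\<^esub> PArr E (PArr R h)) \<cdot>\<^bsub>A\<^esub> TCell \<epsilon> h
     = TCell \<epsilon> h"
    using assms YZ by simp
  have 4: "\<Phi> Z (PArr R h \<rhd>\<^bsub>B\<^esub> t Y) \<cdot>\<^bsub>A\<^esub> q h (PArr R (e Y) \<odot>\<^bsub>B\<^esub> u ?X) = q h (id1 B ?X) \<cdot>\<^bsub>A\<^esub> (h \<rhd>\<^bsub>A\<^esub> \<Phi> Y (t Y))"
    by (rule q_natural_right[symmetric]) (use assms YZ in auto)
  have 5: "(h \<rhd>\<^bsub>A\<^esub> \<Phi> Y (t Y)) \<cdot>\<^bsub>A\<^esub> (h \<rhd>\<^bsub>A\<^esub> \<sigma> ?X (e Y)) = h \<rhd>\<^bsub>A\<^esub> unit_cell Y"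
    using arg_cong[OF t_props(5)[OF YZ(1)], of "\<lambda>x. h \<rhd>\<^bsub>A\<^esub> x"] assms YZ by simp
  show "\<Phi> Z ?l = \<Phi> Z ?r"
    by (rule E.D.iso_right_cancel[of "q h (PArr R (e Y) \<odot>\<^bsub>B\<^esub> u ?X) \<cdot>\<^bsub>A\<^esub> (h \<rhd>\<^bsub>A\<^esub> \<sigma> ?X (e Y))"])
      (use assms YZ in \<open>simp_all add: 1 2 3 E.D.reassoc[OF 4] 5 q_unit_right\<close>)
qed (use assms in auto)

text \<open>An instance of \<open>extension_counit\<close> at the 1-cell \<open>u X\<close> itself;
  \<open>\<sigma>_id\<close> and \<open>\<sigma>_natural\<close> bring the remaining factors into
  the required shape, and \<open>s X\<close> is cancelled at the end.\<close>

lemma unit_swallowtail: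
  assumes "X \<in> Obj B"
  shows "(t (PObj E X) \<lhd>\<^bsub>B\<^esub> u X) \<cdot>\<^bsub>B\<^esub> (PArr R (e (PObj E X)) \<rhd>\<^bsub>B\<^esub> \<eta>_cell (u X)) \<cdot>\<^bsub>B\<^esub>
      (inv2 B (PCmp R (e (PObj E X)) (PArr E (u X))) \<lhd>\<^bsub>B\<^esub> u X) \<cdot>\<^bsub>B\<^esub> (PCell R (s X) \<lhd>\<^bsub>B\<^esub> u X) \<cdot>\<^bsub>B\<^esub>
      (PUnit R (PObj E X) \<lhd>\<^bsub>B\<^esub> u X) = id2 B (u X)" (is "?l = ?r")
proof (rule \<Phi>_eqD[of "PObj E X"])
  let ?Y = "PObj E X"
  have 1: "\<Phi> ?Y (PCell R (s X) \<lhd>\<^bsub>B\<^esub> u X) \<cdot>\<^bsub>A\<^esub> \<sigma> X (id1 A ?Y) = \<sigma> X (e ?Y \<odot>\<^bsub>A\<^esub> PArr E (u X)) \<cdot>\<^bsub>A\<^esub> s X"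
    by (rule \<sigma>_natural) (use assms in auto)
  have "\<Phi> ?Y ((t ?Y \<lhd>\<^bsub>B\<^esub> u X) \<cdot>\<^bsub>B\<^esub> (PArr R (e ?Y) \<rhd>\<^bsub>B\<^esub> \<eta>_cell (u X)) \<cdot>\<^bsub>B\<^esub>
       (inv2 B (PCmp R (e ?Y) (PArr E (u X))) \<lhd>\<^bsub>B\<^esub> u X)) \<cdot>\<^bsub>A\<^esub> \<sigma> X (e ?Y \<odot>\<^bsub>A\<^esub> PArr E (u X))
     = id2 A (e ?Y \<odot>\<^bsub>A\<^esub> PArr E (u X))"
    by (rule extension_counit) (use assms in auto)
  from arg_cong[OF this, of "\<lambda>x. x \<cdot>\<^bsub>A\<^esub> s X"] have 2: "\<Phi> ?Y (t ?Y \<lhd>\<^bsub>B\<^esub> u X) \<cdot>\<^bsub>A\<^esub> \<Phi> ?Y (PArr R (e ?Y) \<rhd>\<^bsub>B\<^esub> \<eta>_cell (u X)) \<cdot>\<^bsub>A\<^esub>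
       \<Phi> ?Y (inv2 B (PCmp R (e ?Y) (PArr E (u X))) \<lhd>\<^bsub>B\<^esub> u X) \<cdot>\<^bsub>A\<^esub> \<sigma> X (e ?Y \<odot>\<^bsub>A\<^esub> PArr E (u X)) \<cdot>\<^bsub>A\<^esub> s X
     = s X"
    using assms by simp
  show "\<Phi> ?Y ?l = \<Phi> ?Y ?r"
    by (rule E.D.iso_right_cancel[of "s X"])
      (use assms in \<open>simp_all add: \<sigma>_id[symmetric] 1 2\<close>)
qed (use assms in simp_all)

text \<open>The defining equation of \<open>t Y\<close> with \<sigma>, \<open>q\<close> and \<Phi>
  unfolded, followed by the cancellation of \<open>PUnit E\<close>.\<close>

lemma counit_swallowtail:
  assumes "Y \<in> Obj A"
  shows "(e Y \<rhd>\<^bsub>A\<^esub> inv2 A (PUnit E (PObj R Y))) \<cdot>\<^bsub>A\<^esub> (e Y \<rhd>\<^bsub>A\<^esub> PCell E (t Y)) \<cdot>\<^bsub>A\<^esub>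
      (e Y \<rhd>\<^bsub>A\<^esub> PCmp E (PArr R (e Y)) (u (PObj R Y))) \<cdot>\<^bsub>A\<^esub> (TCell \<epsilon> (e Y) \<lhd>\<^bsub>A\<^esub> PArr E (u (PObj R Y))) \<cdot>\<^bsub>A\<^esub>
      (e Y \<rhd>\<^bsub>A\<^esub> s (PObj R Y)) = id2 A (e Y)"
proof -
  have 1: "(e Y \<rhd>\<^bsub>A\<^esub> PCell E (t Y)) \<cdot>\<^bsub>A\<^esub> (e Y \<rhd>\<^bsub>A\<^esub> PCmp E (PArr R (e Y)) (u (PObj R Y))) \<cdot>\<^bsub>A\<^esub>
      (TCell \<epsilon> (e Y) \<lhd>\<^bsub>A\<^esub> PArr E (u (PObj R Y))) \<cdot>\<^bsub>A\<^esub> (e Y \<rhd>\<^bsub>A\<^esub> s (PObj R Y)) = e Y \<rhd>\<^bsub>A\<^esub> PUnit E (PObj R Y)"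
    using t_props(5)[OF assms] assms by (simp add: \<sigma>_def q_def \<Phi>_def unit_cell_def)
  have "(e Y \<rhd>\<^bsub>A\<^esub> inv2 A (PUnit E (PObj R Y))) \<cdot>\<^bsub>A\<^esub> (e Y \<rhd>\<^bsub>A\<^esub> PUnit E (PObj R Y)) = id2 A (e Y)"
    using E.D.whisk_vcmp(1)[of "PUnit E (PObj R Y)" "inv2 A (PUnit E (PObj R Y))" "e Y"] assms by simp
  then show ?thesis
    by (simp only: 1)
qed

text \<open>The defining equation of \<open>\<eta>_cell f\<close> with \<sigma>, \<open>q\<close>,
  \<Phi> and \<open>p\<close> unfolded, followed by the cancellation of
  \<open>PCmp E (u X') f\<close>.\<close>

lemma s_natural:
  assumes "f \<in> Arr B" "src B f = X" "tgt B f = X'"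
  shows "(e (PObj E X') \<rhd>\<^bsub>A\<^esub> inv2 A (PCmp E (u X') f)) \<cdot>\<^bsub>A\<^esub> (e (PObj E X') \<rhd>\<^bsub>A\<^esub> PCell E (\<eta>_cell f)) \<cdot>\<^bsub>A\<^esub>
     (e (PObj E X') \<rhd>\<^bsub>A\<^esub> PCmp E (PArr R (PArr E f)) (u X)) \<cdot>\<^bsub>A\<^esub> (TCell \<epsilon> (PArr E f) \<lhd>\<^bsub>A\<^esub> PArr E (u X)) \<cdot>\<^bsub>A\<^esub>
     (PArr E f \<rhd>\<^bsub>A\<^esub> s X) = s X' \<lhd>\<^bsub>A\<^esub> PArr E f"
proof -
  let ?e = "e (PObj E X')"
  let ?uf = "PCmp E (u X') f"
  have X: "X \<in> Obj B" "X' \<in> Obj B" using assms by auto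
  have 1: "(?e \<rhd>\<^bsub>A\<^esub> PCell E (\<eta>_cell f)) \<cdot>\<^bsub>A\<^esub> (?e \<rhd>\<^bsub>A\<^esub> PCmp E (PArr R (PArr E f)) (u X)) \<cdot>\<^bsub>A\<^esub>
     (TCell \<epsilon> (PArr E f) \<lhd>\<^bsub>A\<^esub> PArr E (u X)) \<cdot>\<^bsub>A\<^esub> (PArr E f \<rhd>\<^bsub>A\<^esub> s X)
     = (?e \<rhd>\<^bsub>A\<^esub> PCmp E (u X') f) \<cdot>\<^bsub>A\<^esub> (s X' \<lhd>\<^bsub>A\<^esub> PArr E f)"
    using \<eta>_cell_props(5)[OF assms] assms X by (simp add: \<sigma>_def q_def \<Phi>_def p_def)
  have 2: "(?e \<rhd>\<^bsub>A\<^esub> inv2 A ?uf) \<cdot>\<^bsub>A\<^esub> (?e \<rhd>\<^bsub>A\<^esub> PCmp E (u X') f) = id2 A (?e \<odot>\<^bsub>A\<^esub> PArr E (u X') \<odot>\<^bsub>A\<^esub> PArr E f)"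
    using E.D.whisk_vcmp(1)[of "PCmp E (u X') f" "inv2 A ?uf" ?e] assms X by simp
  show ?thesis
    unfolding 1 using assms X by (simp add: E.D.reassoc[OF 2])
qed

theorem biadjunction: "biadjunction B A E R \<eta> \<epsilon> s t"
proof -
  have s: "invertible_modification B A E E
      (tr_id A E) (tr_comp B A (tr_pre \<epsilon> E) (tr_post B A E (ps_id B) (ps_comp B R E) \<eta>)) s"
    by (rule invertible_modification_from_tr_id[OF E.pseudofunctor_axioms])
      (simp_all add: tr_post_def s_natural)
  have t: "invertible_modification A B R R
      (tr_comp A B (tr_post A B R (ps_comp A E R) (ps_id A) \<epsilon>) (tr_pre \<eta> R)) (tr_id B R) t"
    by (rule invertible_modification_to_tr_id[OF R.pseudofunctor_axioms])
      (simp_all add: tr_post_def t_natural)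
  show ?thesis
    by (intro biadjunction.intro biadjunction_axioms.intro s t pseudonatural_\<eta> E.pseudofunctor_axioms
        R.pseudofunctor_axioms \<epsilon>.pseudonatural_axioms)
      (simp_all add: unit_swallowtail counit_swallowtail)
qed

end

section \<open>Equivalences of categories\<close>

lemma Hom_Ob:
  assumes "category K" "a \<in> Hom K x y"
  shows "x \<in> Ob K" "y \<in> Ob K"
  using assms category.Dom_Ob[of K a] category.Cod_Ob[of K a] by (auto simp: Hom_def)

lemma IsoE:
  assumes "a \<in> Iso K x y"
  obtains b where "a \<in> Hom K x y" "b \<in> Hom K y x" "b \<in> Iso K y x" "Cmp K b a = Idn K x" "Cmp K a b = Idn K y"
  using assms by (force simp: Iso_def inverse_in_def Hom_def)

lemma IsoI:
  assumes "a \<in> Hom K x y" "b \<in> Hom K y x" "Cmp K b a = Idn K x" "Cmp K a b = Idn K y"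
  shows "a \<in> Iso K x y"
  using assms by (auto simp: Iso_def inverse_in_def Hom_def)

context category
begin

lemma Idn_Iso: "x \<in> Ob K \<Longrightarrow> Idn K x \<in> Iso K x x"
  by (rule IsoI) (auto intro: Idn_Hom Cmp_Idn_left)

lemma Cmp_Iso:
  assumes "a \<in> Iso K x y" "b \<in> Iso K y z"
  shows "Cmp K b a \<in> Iso K x z"
proof -
  obtain a' where a: "a \<in> Hom K x y" "a' \<in> Hom K y x" "Cmp K a' a = Idn K x" "Cmp K a a' = Idn K y"
    using assms(1) by (rule IsoE)
  obtain b' where b: "b \<in> Hom K y z" "b' \<in> Hom K z y" "Cmp K b' b = Idn K y" "Cmp K b b' = Idn K z"
    using assms(2) by (rule IsoE)
  have "Cmp K (Cmp K a' b') (Cmp K b a) = Idn K x"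
    using Cmp_assoc[OF Cmp_Hom[OF a(1) b(1)] b(2) a(2)] Cmp_assoc[OF a(1) b(1,2)] a b by (simp add: Cmp_Idn_left)
  moreover have "Cmp K (Cmp K b a) (Cmp K a' b') = Idn K z"
    using Cmp_assoc[OF Cmp_Hom[OF b(2) a(2)] a(1) b(1)] Cmp_assoc[OF b(2) a(2,1)] a b by (simp add: Cmp_Idn_left)
  ultimately show ?thesis
    using a b by (intro IsoI[of _ _ _ _ "Cmp K a' b'"] Cmp_Hom)
qed

lemma Iso_left_cancel:
  assumes "c \<in> Iso K y z" "a \<in> Hom K x y" "b \<in> Hom K x y" "Cmp K c a = Cmp K c b"
  shows "a = b"
proof -
  obtain d where d: "c \<in> Hom K y z" "d \<in> Hom K z y" "Cmp K d c = Idn K y"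
    using assms(1) by (rule IsoE)
  have "Cmp K (Cmp K d c) a = Cmp K (Cmp K d c) b"
    using Cmp_assoc[OF assms(2) d(1,2)] Cmp_assoc[OF assms(3) d(1,2)] assms(4) by simp
  then show ?thesis
    using assms d by (simp add: Cmp_Idn_left)
qed

lemma Iso_right_cancel:
  assumes "c \<in> Iso K w x" "a \<in> Hom K x y" "b \<in> Hom K x y" "Cmp K a c = Cmp K b c"
  shows "a = b"
proof -
  obtain d where d: "c \<in> Hom K w x" "d \<in> Hom K x w" "Cmp K c d = Idn K x"
    using assms(1) by (rule IsoE)
  have "Cmp K a (Cmp K c d) = Cmp K b (Cmp K c d)"
    using Cmp_assoc[OF d(2,1) assms(2)] Cmp_assoc[OF d(2,1) assms(3)] assms(4) by simp
  then show ?thesis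
    using assms d by (simp add: Cmp_Idn_right)
qed

lemma Iso_left_lift:
  assumes "c \<in> Iso K y z" "a \<in> Hom K x z"
  shows "\<exists>b \<in> Hom K x y. Cmp K c b = a"
proof -
  obtain d where d: "c \<in> Hom K y z" "d \<in> Hom K z y" "Cmp K c d = Idn K z"
    using assms(1) by (rule IsoE)
  then have "Cmp K c (Cmp K d a) = a"
    using Cmp_assoc[OF assms(2) d(2,1)] Cmp_Idn_left[OF assms(2)] by simp
  then show ?thesis
    using Cmp_Hom[OF assms(2) d(2)] by blast
qed

end

section \<open>Fully faithful and essentially surjective functors\<close>

text \<open>In this form the cancellation properties below are proved arrow by arrow, without
  composing quasi-inverses. The official notion is converted on entry in
  \<open>counit_internal_equivalence\<close> and restored in
  \<open>local_equivalence_R\<close>.\<close>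

definition weak_equivalence :: "('o, 'a, 'y) cat_scheme \<Rightarrow> ('p, 'b, 'z) cat_scheme \<Rightarrow> ('o, 'a, 'p, 'b) fnc \<Rightarrow> bool" where
  "weak_equivalence J K F \<longleftrightarrow> functor_between J K F \<and>
     (\<forall>x\<in>Ob J. \<forall>y\<in>Ob J. bij_betw (FAr F) (Hom J x y) (Hom K (FOb F x) (FOb F y))) \<and>
     (\<forall>z\<in>Ob K. \<exists>x\<in>Ob J. Iso K (FOb F x) z \<noteq> {})"

lemma weak_equivalenceI:
  assumes "functor_between J K F"
    and "\<And>x y a b. \<lbrakk>a \<in> Hom J x y; b \<in> Hom J x y; FAr F a = FAr F b\<rbrakk> \<Longrightarrow> a = b"
    and "\<And>x y c. \<lbrakk>x \<in> Ob J; y \<in> Ob J; c \<in> Hom K (FOb F x) (FOb F y)\<rbrakk> \<Longrightarrow> \<exists>a \<in> Hom J x y. FAr F a = c"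
    and "\<And>z. z \<in> Ob K \<Longrightarrow> \<exists>x\<in>Ob J. \<exists>a. a \<in> Iso K (FOb F x) z"
  shows "weak_equivalence J K F"
  unfolding weak_equivalence_def
proof (intro conjI ballI)
  fix x y assume xy: "x \<in> Ob J" "y \<in> Ob J"
  show "bij_betw (FAr F) (Hom J x y) (Hom K (FOb F x) (FOb F y))"
    unfolding bij_betw_def
  proof
    show "inj_on (FAr F) (Hom J x y)"
      using assms(2) by (auto intro: inj_onI)
    show "FAr F ` Hom J x y = Hom K (FOb F x) (FOb F y)"
      using assms(3)[OF xy] functor_between.FAr_Hom[OF assms(1)] by blast
  qed
qed (use assms in fastforce)+

lemma weak_equivalenceD:
  assumes "weak_equivalence J K F"
  shows "functor_between J K F"
    and "\<lbrakk>a \<in> Hom J x y; b \<in> Hom J x y; FAr F a = FAr F b\<rbrakk> \<Longrightarrow> a = b"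
    and "\<lbrakk>x \<in> Ob J; y \<in> Ob J; c \<in> Hom K (FOb F x) (FOb F y)\<rbrakk> \<Longrightarrow> \<exists>a \<in> Hom J x y. FAr F a = c"
    and "z \<in> Ob K \<Longrightarrow> \<exists>x\<in>Ob J. \<exists>a. a \<in> Iso K (FOb F x) z"
proof -
  show F: "functor_between J K F"
    using assms by (simp add: weak_equivalence_def)
  interpret functor_between J K F by (rule F)
  show "\<lbrakk>a \<in> Hom J x y; b \<in> Hom J x y; FAr F a = FAr F b\<rbrakk> \<Longrightarrow> a = b"
    using assms Hom_Ob[OF J.category_axioms, of a x y]
    unfolding weak_equivalence_def by (meson bij_betw_imp_inj_on inj_onD)
  show "\<lbrakk>x \<in> Ob J; y \<in> Ob J; c \<in> Hom K (FOb F x) (FOb F y)\<rbrakk> \<Longrightarrow> \<exists>a \<in> Hom J x y. FAr F a = c"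
    using assms unfolding weak_equivalence_def by (metis bij_betw_imp_surj_on imageE)
  show "z \<in> Ob K \<Longrightarrow> \<exists>x\<in>Ob J. \<exists>a. a \<in> Iso K (FOb F x) z"
    using assms unfolding weak_equivalence_def by blast
qed

lemma (in functor_between) FAr_Iso:
  assumes "a \<in> Iso J x y"
  shows "FAr F a \<in> Iso K (FOb F x) (FOb F y)"
proof -
  obtain b where b: "a \<in> Hom J x y" "b \<in> Hom J y x" "Cmp J b a = Idn J x" "Cmp J a b = Idn J y"
    using assms by (rule IsoE)
  then show ?thesis
    using Hom_Ob[OF J.category_axioms b(1)]
    by (intro IsoI[of _ _ _ _ "FAr F b"]) (simp_all add: FAr_Hom flip: FAr_Cmp FAr_Idn)
qed

lemma weak_equivalence_reflects_Iso:
  assumes F: "weak_equivalence J K F" and "x \<in> Ob J" "y \<in> Ob J" "a \<in> Iso K (FOb F x) (FOb F y)"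
  shows "\<exists>b. b \<in> Iso J x y \<and> FAr F b = a"
proof -
  interpret functor_between J K F by (rule weak_equivalenceD(1)[OF F])
  obtain a' where a: "a \<in> Hom K (FOb F x) (FOb F y)" "a' \<in> Hom K (FOb F y) (FOb F x)"
    "Cmp K a' a = Idn K (FOb F x)" "Cmp K a a' = Idn K (FOb F y)"
    using assms(4) by (rule IsoE)
  obtain b where b: "b \<in> Hom J x y" "FAr F b = a"
    using weak_equivalenceD(3)[OF F assms(2,3) a(1)] by blast
  obtain b' where b': "b' \<in> Hom J y x" "FAr F b' = a'"
    using weak_equivalenceD(3)[OF F assms(3,2) a(2)] by blast
  have "b \<in> Iso J x y"
  proof (rule IsoI[OF b(1) b'(1)])
    show "Cmp J b' b = Idn J x"
      using a b b' assms(2) by (intro weak_equivalenceD(2)[OF F, of _ x x])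
        (auto simp: FAr_Cmp[OF b(1) b'(1)] FAr_Idn intro: J.Cmp_Hom J.Idn_Hom)
    show "Cmp J b b' = Idn J y"
      using a b b' assms(3) by (intro weak_equivalenceD(2)[OF F, of _ y y])
        (auto simp: FAr_Cmp[OF b'(1) b(1)] FAr_Idn intro: J.Cmp_Hom J.Idn_Hom)
  qed
  with b show ?thesis by blast
qed

lemma fnc_id_simps [simp]: "FOb fnc_id x = x" "FAr fnc_id a = a"
  by (simp_all add: fnc_id_def)

lemma fnc_comp_simps [simp]:
  "FOb (fnc_comp G F) x = FOb G (FOb F x)" "FAr (fnc_comp G F) a = FAr G (FAr F a)"
  by (simp_all add: fnc_comp_def)

lemma functor_between_id: "category J \<Longrightarrow> functor_between J J fnc_id"
  by (simp add: functor_between_def functor_between_axioms_def)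

lemma functor_between_comp:
  assumes "functor_between J K F" "functor_between K M G"
  shows "functor_between J M (fnc_comp G F)"
proof -
  interpret F: functor_between J K F by fact
  interpret G: functor_between K M G by fact
  show ?thesis
    by unfold_locales
      (auto intro: F.FOb_Ob G.FOb_Ob F.FAr_Hom G.FAr_Hom simp: F.FAr_Idn G.FAr_Idn[OF F.FOb_Ob] F.FAr_Cmp G.FAr_Cmp[OF F.FAr_Hom F.FAr_Hom])
qed

lemma weak_equivalence_id: "category J \<Longrightarrow> weak_equivalence J J fnc_id"
  by (rule weak_equivalenceI) (auto intro: functor_between_id category.Idn_Iso)

lemma weak_equivalence_comp:
  assumes F: "weak_equivalence J K F" and G: "weak_equivalence K M G"
  shows "weak_equivalence J M (fnc_comp G F)"
proof -
  interpret F: functor_between J K F by (rule weak_equivalenceD(1)[OF F])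
  interpret G: functor_between K M G by (rule weak_equivalenceD(1)[OF G])
  show ?thesis
  proof (rule weak_equivalenceI)
    show "functor_between J M (fnc_comp G F)"
      using F.functor_between_axioms G.functor_between_axioms by (rule functor_between_comp)
  next
    fix x y a b assume "a \<in> Hom J x y" "b \<in> Hom J x y" "FAr (fnc_comp G F) a = FAr (fnc_comp G F) b"
    then show "a = b"
      using weak_equivalenceD(2)[OF G F.FAr_Hom F.FAr_Hom] weak_equivalenceD(2)[OF F] by simp
  next
    fix x y c assume "x \<in> Ob J" "y \<in> Ob J" "c \<in> Hom M (FOb (fnc_comp G F) x) (FOb (fnc_comp G F) y)"
    then show "\<exists>a\<in>Hom J x y. FAr (fnc_comp G F) a = c"
      using weak_equivalenceD(3)[OF G F.FOb_Ob F.FOb_Ob] weak_equivalenceD(3)[OF F] by fastforce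
  next
    fix z assume "z \<in> Ob M"
    then obtain y a where y: "y \<in> Ob K" "a \<in> Iso M (FOb G y) z"
      using weak_equivalenceD(4)[OF G] by blast
    then obtain x b where "x \<in> Ob J" "b \<in> Iso K (FOb F x) y"
      using weak_equivalenceD(4)[OF F] by blast
    with y show "\<exists>x\<in>Ob J. \<exists>a. a \<in> Iso M (FOb (fnc_comp G F) x) z"
      using G.FAr_Iso G.K.Cmp_Iso by (fastforce intro!: bexI[of _ x])
  qed
qed

text \<open>Fullness: a preimage of \<open>G c\<close> under the composite is one of
  \<open>c\<close> under \<open>F\<close>, since \<open>G\<close> is faithful. Essential
  surjectivity: \<open>G\<close> reflects isomorphisms.\<close>

lemma weak_equivalence_right_factor:
  assumes GF: "weak_equivalence J M (fnc_comp G F)" and G: "weak_equivalence K M G" and F: "functor_between J K F"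
  shows "weak_equivalence J K F"
proof -
  interpret F: functor_between J K F by fact
  interpret G: functor_between K M G by (rule weak_equivalenceD(1)[OF G])
  show ?thesis
  proof (rule weak_equivalenceI[OF F])
    fix x y a b assume "a \<in> Hom J x y" "b \<in> Hom J x y" "FAr F a = FAr F b"
    then show "a = b"
      using weak_equivalenceD(2)[OF GF] by simp
  next
    fix x y c assume xy: "x \<in> Ob J" "y \<in> Ob J" and c: "c \<in> Hom K (FOb F x) (FOb F y)"
    then obtain a where "a \<in> Hom J x y" "FAr G (FAr F a) = FAr G c"
      using weak_equivalenceD(3)[OF GF xy, of "FAr G c"] G.FAr_Hom[OF c] by auto
    then show "\<exists>a\<in>Hom J x y. FAr F a = c"
      using weak_equivalenceD(2)[OF G F.FAr_Hom c] by blast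
  next
    fix z assume z: "z \<in> Ob K"
    obtain x a where x: "x \<in> Ob J" "a \<in> Iso M (FOb G (FOb F x)) (FOb G z)"
      using weak_equivalenceD(4)[OF GF G.FOb_Ob[OF z]] by auto
    then show "\<exists>x\<in>Ob J. \<exists>a. a \<in> Iso K (FOb F x) z"
      using weak_equivalence_reflects_Iso[OF G F.FOb_Ob[OF x(1)] z x(2)] by blast
  qed
qed

text \<open>Two-out-of-six for the string \<open>F\<close>, \<open>G\<close>, \<open>F\<close>.
  Faithfulness comes from \<open>G F\<close>, essential surjectivity from \<open>F G\<close>; for
  fullness, a preimage of \<open>G c\<close> under \<open>G F\<close> is one of \<open>c\<close>
  because \<open>F G\<close>, hence \<open>G\<close>, is faithful.\<close>

lemma weak_equivalence_2_of_6:
  assumes GF: "weak_equivalence J J (fnc_comp G F)" and FG: "weak_equivalence K K (fnc_comp F G)"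
    and F: "functor_between J K F" and G: "functor_between K J G"
  shows "weak_equivalence J K F"
proof -
  interpret F: functor_between J K F by fact
  interpret G: functor_between K J G by fact
  show ?thesis
  proof (rule weak_equivalenceI[OF F])
    fix x y a b assume "a \<in> Hom J x y" "b \<in> Hom J x y" "FAr F a = FAr F b"
    then show "a = b"
      using weak_equivalenceD(2)[OF GF] by simp
  next
    fix x y c assume xy: "x \<in> Ob J" "y \<in> Ob J" and c: "c \<in> Hom K (FOb F x) (FOb F y)"
    then obtain a where "a \<in> Hom J x y" "FAr G (FAr F a) = FAr G c"
      using weak_equivalenceD(3)[OF GF xy, of "FAr G c"] G.FAr_Hom[OF c] by auto
    then show "\<exists>a\<in>Hom J x y. FAr F a = c"
      using weak_equivalenceD(2)[OF FG F.FAr_Hom c] by fastforce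
  next
    fix z assume "z \<in> Ob K"
    then show "\<exists>x\<in>Ob J. \<exists>a. a \<in> Iso K (FOb F x) z"
      using weak_equivalenceD(4)[OF FG] G.FOb_Ob by fastforce
  qed
qed

text \<open>Objects of \<open>K\<close> lie in the image of \<open>F\<close> only up to isomorphism,
  so arrows are conjugated by such isomorphisms \<open>i\<close>, \<open>j\<close> until the full
  faithfulness of \<open>F\<close> and of the composite applies.\<close>

lemma weak_equivalence_left_factor:
  assumes GF: "weak_equivalence J M (fnc_comp G F)" and F: "weak_equivalence J K F" and G: "functor_between K M G"
  shows "weak_equivalence K M G"
proof -
  interpret F: functor_between J K F by (rule weak_equivalenceD(1)[OF F])
  interpret G: functor_between K M G by fact
  show ?thesis
  proof (rule weak_equivalenceI[OF G])
    fix x y a b assume ab: "a \<in> Hom K x y" "b \<in> Hom K x y" "FAr G a = FAr G b"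
    obtain x' i where x': "x' \<in> Ob J" "i \<in> Iso K (FOb F x') x"
      using weak_equivalenceD(4)[OF F Hom_Ob(1)[OF F.K.category_axioms ab(1)]] by blast
    obtain y' j where y': "y' \<in> Ob J" "j \<in> Iso K (FOb F y') y"
      using weak_equivalenceD(4)[OF F Hom_Ob(2)[OF F.K.category_axioms ab(1)]] by blast
    obtain j' where j: "j \<in> Hom K (FOb F y') y" "j' \<in> Hom K y (FOb F y')" "j' \<in> Iso K y (FOb F y')"
      using y'(2) by (rule IsoE)
    have i: "i \<in> Hom K (FOb F x') x"
      using x'(2) by (rule IsoE)
    have ji: "Cmp K j' (Cmp K a i) \<in> Hom K (FOb F x') (FOb F y')" "Cmp K j' (Cmp K b i) \<in> Hom K (FOb F x') (FOb F y')"
      using i j ab by (meson F.K.Cmp_Hom)+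
    obtain a' where a': "a' \<in> Hom J x' y'" "FAr F a' = Cmp K j' (Cmp K a i)"
      using weak_equivalenceD(3)[OF F x'(1) y'(1) ji(1)] by blast
    obtain b' where b': "b' \<in> Hom J x' y'" "FAr F b' = Cmp K j' (Cmp K b i)"
      using weak_equivalenceD(3)[OF F x'(1) y'(1) ji(2)] by blast
    have "FAr G (Cmp K j' (Cmp K a i)) = FAr G (Cmp K j' (Cmp K b i))"
      using i j ab G.FAr_Cmp[OF F.K.Cmp_Hom[OF i ab(1)] j(2)] G.FAr_Cmp[OF F.K.Cmp_Hom[OF i ab(2)] j(2)]
        G.FAr_Cmp[OF i ab(1)] G.FAr_Cmp[OF i ab(2)] by simp
    then have "a' = b'"
      using a' b' weak_equivalenceD(2)[OF GF, of a' x' y' b'] by simp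
    then have "Cmp K j' (Cmp K a i) = Cmp K j' (Cmp K b i)"
      using a' b' by simp
    then have "Cmp K a i = Cmp K b i"
      using F.K.Iso_left_cancel[OF j(3) F.K.Cmp_Hom[OF i ab(1)] F.K.Cmp_Hom[OF i ab(2)]] by simp
    then show "a = b"
      using F.K.Iso_right_cancel[OF x'(2) ab(1,2)] by simp
  next
    fix x y c assume xy: "x \<in> Ob K" "y \<in> Ob K" and c: "c \<in> Hom M (FOb G x) (FOb G y)"
    obtain x' i where x': "x' \<in> Ob J" "i \<in> Iso K (FOb F x') x"
      using weak_equivalenceD(4)[OF F xy(1)] by blast
    obtain y' j where y': "y' \<in> Ob J" "j \<in> Iso K (FOb F y') y"
      using weak_equivalenceD(4)[OF F xy(2)] by blast
    obtain i' where i: "i \<in> Hom K (FOb F x') x" "i' \<in> Hom K x (FOb F x')" "Cmp K i' i = Idn K (FOb F x')" "i' \<in> Iso K x (FOb F x')"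
      using x'(2) by (rule IsoE)
    have j: "j \<in> Hom K (FOb F y') y"
      using y'(2) by (rule IsoE)
    \<comment> \<open>\<open>d\<close> is \<open>c\<close> conjugated by the images of
      \<open>i\<close> and \<open>j\<close>; its preimage \<open>a\<close> under the composite,
      conjugated back in \<open>K\<close>, is the required arrow.\<close>
    obtain d where d: "d \<in> Hom M (FOb G (FOb F x')) (FOb G (FOb F y'))" "Cmp M (FAr G j) d = Cmp M c (FAr G i)"
      using G.K.Iso_left_lift[OF G.FAr_Iso[OF y'(2)] G.K.Cmp_Hom[OF G.FAr_Hom[OF i(1)] c]] by blast
    obtain a where a: "a \<in> Hom J x' y'" "FAr G (FAr F a) = d"
      using weak_equivalenceD(3)[OF GF x'(1) y'(1), of d] d by auto
    have Fa: "FAr F a \<in> Hom K (FOb F x') (FOb F y')"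
      using a by (intro F.FAr_Hom)
    have jFa: "Cmp K j (FAr F a) \<in> Hom K (FOb F x') y"
      using Fa j by (rule F.K.Cmp_Hom)
    let ?b = "Cmp K (Cmp K j (FAr F a)) i'"
    have b: "?b \<in> Hom K x y"
      using i(2) jFa by (rule F.K.Cmp_Hom)
    have "Cmp K ?b i = Cmp K j (FAr F a)"
      using F.K.Cmp_assoc[OF i(1,2) jFa] i(3) F.K.Cmp_Idn_right[OF jFa] by simp
    then have "Cmp M (FAr G ?b) (FAr G i) = Cmp M c (FAr G i)"
      using G.FAr_Cmp[OF i(1) b] G.FAr_Cmp[OF Fa j] a d by simp
    then have "FAr G ?b = c"
      by (rule G.K.Iso_right_cancel[OF G.FAr_Iso[OF x'(2)] G.FAr_Hom[OF b] c])
    with b show "\<exists>a\<in>Hom K x y. FAr G a = c"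
      by blast
  next
    fix z assume "z \<in> Ob M"
    then show "\<exists>x\<in>Ob K. \<exists>a. a \<in> Iso M (FOb G x) z"
      using weak_equivalenceD(4)[OF GF] F.FOb_Ob by fastforce
  qed
qed

lemma natural_isomorphism_sym:
  assumes "natural_isomorphism J K F G \<theta>"
  shows "\<exists>\<theta>'. natural_isomorphism J K G F \<theta>'"
proof -
  interpret natural_isomorphism J K F G \<theta> by fact
  have "\<exists>b. b \<in> Iso K (FOb G x) (FOb F x) \<and> Cmp K b (\<theta> x) = Idn K (FOb F x) \<and> Cmp K (\<theta> x) b = Idn K (FOb G x)"
    if "x \<in> Ob J" for x
    using component_Iso[OF that] by (rule IsoE) blast
  then obtain \<theta>' where \<theta>': "\<And>x. x \<in> Ob J \<Longrightarrow> \<theta>' x \<in> Iso K (FOb G x) (FOb F x)"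
    "\<And>x. x \<in> Ob J \<Longrightarrow> Cmp K (\<theta>' x) (\<theta> x) = Idn K (FOb F x)"
    "\<And>x. x \<in> Ob J \<Longrightarrow> Cmp K (\<theta> x) (\<theta>' x) = Idn K (FOb G x)"
    by metis
  have "natural_isomorphism J K G F \<theta>'"
  proof
    fix a x y assume a: "a \<in> Hom J x y"
    note xy = Hom_Ob[OF F.J.category_axioms a]
    have h: "\<theta> x \<in> Hom K (FOb F x) (FOb G x)" "\<theta> y \<in> Hom K (FOb F y) (FOb G y)"
      "\<theta>' x \<in> Hom K (FOb G x) (FOb F x)" "\<theta>' y \<in> Hom K (FOb G y) (FOb F y)"
      using xy component_Iso \<theta>'(1) by (auto simp: Iso_def)
    note Fa = F.FAr_Hom[OF a] and Ga = G.FAr_Hom[OF a]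
    have "Cmp K (\<theta> y) (Cmp K (FAr F a) (\<theta>' x)) = Cmp K (Cmp K (FAr G a) (\<theta> x)) (\<theta>' x)"
      using F.K.Cmp_assoc[OF h(3) Fa h(2)] naturality[OF a] by simp
    also have "\<dots> = FAr G a"
      using F.K.Cmp_assoc[OF h(3) h(1) Ga] \<theta>'(3)[OF xy(1)] F.K.Cmp_Idn_right[OF Ga] by simp
    also have "\<dots> = Cmp K (\<theta> y) (Cmp K (\<theta>' y) (FAr G a))"
      using F.K.Cmp_assoc[OF Ga h(4) h(2)] \<theta>'(3)[OF xy(2)] F.K.Cmp_Idn_left[OF Ga] by simp
    finally show "Cmp K (FAr F a) (\<theta>' x) = Cmp K (\<theta>' y) (FAr G a)"
      by (rule F.K.Iso_left_cancel[OF component_Iso[OF xy(2)] F.K.Cmp_Hom[OF h(3) Fa] F.K.Cmp_Hom[OF Ga h(4)]])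
  qed (rule \<theta>')
  then show ?thesis by blast
qed

text \<open>Conjugating with the components of \<theta> identifies the actions of \<open>F\<close>
  and \<open>G\<close> on arrows, and composing with them moves essential preimages from one functor
  to the other.\<close>

lemma weak_equivalence_natural_isomorphism:
  assumes "natural_isomorphism J K F G \<theta>" and wF: "weak_equivalence J K F"
  shows "weak_equivalence J K G"
proof -
  interpret natural_isomorphism J K F G \<theta> by fact
  have \<theta>: "\<theta> x \<in> Hom K (FOb F x) (FOb G x)" if "x \<in> Ob J" for x
    using component_Iso[OF that] by (simp add: Iso_def)
  show ?thesis
  proof (rule weak_equivalenceI[OF G.functor_between_axioms])
    fix x y a b assume ab: "a \<in> Hom J x y" "b \<in> Hom J x y" "FAr G a = FAr G b"
    have "Cmp K (\<theta> y) (FAr F a) = Cmp K (\<theta> y) (FAr F b)"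
      using naturality[OF ab(1)] naturality[OF ab(2)] ab(3) by simp
    then have "FAr F a = FAr F b"
      by (rule F.K.Iso_left_cancel[OF component_Iso[OF Hom_Ob(2)[OF F.J.category_axioms ab(1)]] F.FAr_Hom[OF ab(1)] F.FAr_Hom[OF ab(2)]])
    then show "a = b"
      by (rule weak_equivalenceD(2)[OF wF ab(1,2)])
  next
    fix x y c assume xy: "x \<in> Ob J" "y \<in> Ob J" and c: "c \<in> Hom K (FOb G x) (FOb G y)"
    obtain d where d: "d \<in> Hom K (FOb F x) (FOb F y)" "Cmp K (\<theta> y) d = Cmp K c (\<theta> x)"
      using F.K.Iso_left_lift[OF component_Iso[OF xy(2)] F.K.Cmp_Hom[OF \<theta>[OF xy(1)] c]] by blast
    obtain a where a: "a \<in> Hom J x y" "FAr F a = d"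
      using weak_equivalenceD(3)[OF wF xy d(1)] by blast
    then have "FAr G a = c"
      using naturality[OF a(1)] d(2) F.K.Iso_right_cancel[OF component_Iso[OF xy(1)] G.FAr_Hom[OF a(1)] c] by simp
    with a show "\<exists>a\<in>Hom J x y. FAr G a = c" by blast
  next
    fix z assume "z \<in> Ob K"
    then obtain x a where x: "x \<in> Ob J" "a \<in> Iso K (FOb F x) z"
      using weak_equivalenceD(4)[OF wF] by blast
    obtain b where "b \<in> Iso K (FOb G x) (FOb F x)"
      using component_Iso[OF x(1)] by (rule IsoE)
    with x show "\<exists>x\<in>Ob J. \<exists>a. a \<in> Iso K (FOb G x) z"
      using F.K.Cmp_Iso by blast
  qed
qed

lemma equivalence_imp_weak_equivalence:
  assumes "equivalence_of_categories J K F"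
  shows "weak_equivalence J K F"
proof -
  obtain G \<theta> \<kappa> where F: "functor_between J K F" and G: "functor_between K J G"
    and \<theta>: "natural_isomorphism J J fnc_id (fnc_comp G F) \<theta>"
    and \<kappa>: "natural_isomorphism K K (fnc_comp F G) fnc_id \<kappa>"
    using assms unfolding equivalence_of_categories_def by blast
  have J: "category J" and K: "category K"
    using F by (simp_all add: functor_between_def)
  obtain \<kappa>' where \<kappa>': "natural_isomorphism K K fnc_id (fnc_comp F G) \<kappa>'"
    using natural_isomorphism_sym[OF \<kappa>] by blast
  show ?thesis
    by (rule weak_equivalence_2_of_6[OF weak_equivalence_natural_isomorphism[OF \<theta> weak_equivalence_id[OF J]]
      weak_equivalence_natural_isomorphism[OF \<kappa>' weak_equivalence_id[OF K]] F G])
qed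

text \<open>Choosing \<open>g z\<close> and \<kappa> fixes the quasi-inverse on objects. Its value
  on an arrow is then the unique one making \<kappa> natural, and uniqueness yields
  functoriality.\<close>

lemma weak_equivalence_imp_equivalence:
  fixes J :: "('o, 'a) cat" and K :: "('p, 'b) cat"
  assumes wF: "weak_equivalence J K F"
  shows "equivalence_of_categories J K F"
proof -
  interpret F: functor_between J K F by (rule weak_equivalenceD(1)[OF wF])
  have "\<forall>z\<in>Ob K. \<exists>x k. x \<in> Ob J \<and> k \<in> Iso K (FOb F x) z"
    using weak_equivalenceD(4)[OF wF] by blast
  then obtain g \<kappa> where g: "\<And>z. z \<in> Ob K \<Longrightarrow> g z \<in> Ob J" and \<kappa>: "\<And>z. z \<in> Ob K \<Longrightarrow> \<kappa> z \<in> Iso K (FOb F (g z)) z"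
    by metis
  have \<kappa>_Hom: "\<kappa> z \<in> Hom K (FOb F (g z)) z" if "z \<in> Ob K" for z
    using \<kappa>[OF that] by (simp add: Iso_def)
  have "\<exists>b. b \<in> Hom J (g (Dom K a)) (g (Cod K a)) \<and> Cmp K (\<kappa> (Cod K a)) (FAr F b) = Cmp K a (\<kappa> (Dom K a))"
    if a: "a \<in> Ar K" for a
  proof -
    have zw: "Dom K a \<in> Ob K" "Cod K a \<in> Ob K" "a \<in> Hom K (Dom K a) (Cod K a)"
      using a by (auto simp: Hom_def intro: F.K.Dom_Ob F.K.Cod_Ob)
    obtain d where d: "d \<in> Hom K (FOb F (g (Dom K a))) (FOb F (g (Cod K a)))"
      "Cmp K (\<kappa> (Cod K a)) d = Cmp K a (\<kappa> (Dom K a))"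
      using F.K.Iso_left_lift[OF \<kappa>[OF zw(2)] F.K.Cmp_Hom[OF \<kappa>_Hom[OF zw(1)] zw(3)]] by blast
    then show ?thesis
      using weak_equivalenceD(3)[OF wF g[OF zw(1)] g[OF zw(2)] d(1)] by blast
  qed
  then obtain h where "\<And>a. a \<in> Ar K \<Longrightarrow> h a \<in> Hom J (g (Dom K a)) (g (Cod K a)) \<and>
      Cmp K (\<kappa> (Cod K a)) (FAr F (h a)) = Cmp K a (\<kappa> (Dom K a))"
    by metis
  then have h: "\<And>a z w. a \<in> Hom K z w \<Longrightarrow> h a \<in> Hom J (g z) (g w)"
    "\<And>a z w. a \<in> Hom K z w \<Longrightarrow> Cmp K (\<kappa> w) (FAr F (h a)) = Cmp K a (\<kappa> z)"
    unfolding Hom_def[of K] by auto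
  define G where "G = \<lparr>FOb = g, FAr = h\<rparr>"
  \<comment> \<open>Uniqueness of the lift: \<kappa> can be cancelled and \<open>F\<close> is
    faithful. Both functor laws follow by exhibiting a second solution.\<close>
  have h_eqI: "h a = b" if a: "a \<in> Hom K z w" and b: "b \<in> Hom J (g z) (g w)" "Cmp K (\<kappa> w) (FAr F b) = Cmp K a (\<kappa> z)" for a b z w
  proof (rule weak_equivalenceD(2)[OF wF h(1)[OF a] b(1)])
    show "FAr F (h a) = FAr F b"
      using F.K.Iso_left_cancel[OF \<kappa>[OF Hom_Ob(2)[OF F.K.category_axioms a]] F.FAr_Hom[OF h(1)[OF a]] F.FAr_Hom[OF b(1)]]
        h(2)[OF a] b(2) by simp
  qed
  have G: "functor_between K J G"
  proof
    fix z assume "z \<in> Ob K"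
    then show "FOb G z \<in> Ob J" by (simp add: G_def g)
  next
    fix a z w assume "a \<in> Hom K z w"
    then show "FAr G a \<in> Hom J (FOb G z) (FOb G w)" by (simp add: G_def h)
  next
    fix z assume z: "z \<in> Ob K"
    show "FAr G (Idn K z) = Idn J (FOb G z)"
      unfolding G_def fnc.simps
      by (rule h_eqI[OF F.K.Idn_Hom[OF z] F.J.Idn_Hom[OF g[OF z]]])
        (simp add: F.FAr_Idn[OF g[OF z]] F.K.Cmp_Idn_left[OF \<kappa>_Hom[OF z]] F.K.Cmp_Idn_right[OF \<kappa>_Hom[OF z]])
  next
    fix a b x y z assume a: "a \<in> Hom K x y" and b: "b \<in> Hom K y z"
    note xyz = Hom_Ob[OF F.K.category_axioms a] Hom_Ob[OF F.K.category_axioms b]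
    show "FAr G (Cmp K b a) = Cmp J (FAr G b) (FAr G a)"
      unfolding G_def fnc.simps
    proof (rule h_eqI[OF F.K.Cmp_Hom[OF a b] F.J.Cmp_Hom[OF h(1)[OF a] h(1)[OF b]]])
      have "Cmp K (\<kappa> z) (FAr F (Cmp J (h b) (h a))) = Cmp K (Cmp K b (\<kappa> y)) (FAr F (h a))"
        using F.FAr_Cmp[OF h(1)[OF a] h(1)[OF b]] h(2)[OF b]
          F.K.Cmp_assoc[OF F.FAr_Hom[OF h(1)[OF a]] F.FAr_Hom[OF h(1)[OF b]] \<kappa>_Hom[OF xyz(4)]] by simp
      also have "\<dots> = Cmp K (Cmp K b a) (\<kappa> x)"
        using F.K.Cmp_assoc[OF F.FAr_Hom[OF h(1)[OF a]] \<kappa>_Hom[OF xyz(2)] b] h(2)[OF a]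
          F.K.Cmp_assoc[OF \<kappa>_Hom[OF xyz(1)] a b] by simp
      finally show "Cmp K (\<kappa> z) (FAr F (Cmp J (h b) (h a))) = Cmp K (Cmp K b a) (\<kappa> x)" .
    qed
  qed
  have FG: "natural_isomorphism K K (fnc_comp F G) fnc_id \<kappa>"
    using \<kappa> h(2) F.functor_between_axioms G F.K.category_axioms
    by (intro natural_isomorphism.intro natural_isomorphism_axioms.intro functor_between_comp functor_between_id)
      (simp_all add: G_def)
  obtain \<kappa>' where \<kappa>': "natural_isomorphism K K fnc_id (fnc_comp F G) \<kappa>'"
    using natural_isomorphism_sym[OF FG] by blast
  \<comment> \<open>The component of \<theta> at \<open>x\<close> is the lift along \<open>F\<close>
    of the inverse of \<kappa> at \<open>F x\<close>, so its naturality, tested after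
    \<open>F\<close>, is that of \<kappa>'.\<close>
  have "\<exists>i. i \<in> Iso J x (g (FOb F x)) \<and> FAr F i = \<kappa>' (FOb F x)" if x: "x \<in> Ob J" for x
    using natural_isomorphism.component_Iso[OF \<kappa>' F.FOb_Ob[OF x]]
    by (intro weak_equivalence_reflects_Iso[OF wF x g[OF F.FOb_Ob[OF x]]]) (simp add: G_def)
  then obtain \<theta> where \<theta>: "\<And>x. x \<in> Ob J \<Longrightarrow> \<theta> x \<in> Iso J x (g (FOb F x))"
    "\<And>x. x \<in> Ob J \<Longrightarrow> FAr F (\<theta> x) = \<kappa>' (FOb F x)"
    by metis
  have "natural_isomorphism J J fnc_id (fnc_comp G F) \<theta>"
  proof (intro natural_isomorphism.intro natural_isomorphism_axioms.intro functor_between_comp[of J K] functor_between_id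
      F.J.category_axioms F.functor_between_axioms G)
    fix x assume "x \<in> Ob J"
    then show "\<theta> x \<in> Iso J (FOb fnc_id x) (FOb (fnc_comp G F) x)"
      by (simp add: G_def \<theta>)
  next
    fix a x y assume a: "a \<in> Hom J x y"
    note xy = Hom_Ob[OF F.J.category_axioms a]
    have \<theta>_Hom: "\<theta> x \<in> Hom J x (g (FOb F x))" "\<theta> y \<in> Hom J y (g (FOb F y))"
      using xy \<theta>(1) by (auto simp: Iso_def)
    note ha = h(1)[OF F.FAr_Hom[OF a]]
    show "Cmp J (FAr (fnc_comp G F) a) (\<theta> x) = Cmp J (\<theta> y) (FAr fnc_id a)"
    proof (rule weak_equivalenceD(2)[OF wF, of _ x "g (FOb F y)"])
      show "FAr F (Cmp J (FAr (fnc_comp G F) a) (\<theta> x)) = FAr F (Cmp J (\<theta> y) (FAr fnc_id a))"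
        using natural_isomorphism.naturality[OF \<kappa>' F.FAr_Hom[OF a]] F.FAr_Cmp[OF \<theta>_Hom(1) ha] F.FAr_Cmp[OF a \<theta>_Hom(2)]
          \<theta>(2)[OF xy(1)] \<theta>(2)[OF xy(2)]
        by (simp add: G_def)
    qed (use F.J.Cmp_Hom[OF \<theta>_Hom(1) ha] F.J.Cmp_Hom[OF a \<theta>_Hom(2)] in \<open>simp_all add: G_def\<close>)
  qed
  with FG G show ?thesis
    unfolding equivalence_of_categories_def using F.functor_between_axioms by blast
qed

section \<open>Hom-functors and internal equivalences\<close>

lemma functor_between_hom_catI:
  assumes "two_category C" "two_category D" "X \<in> Obj C" "Y \<in> Obj C" "X' \<in> Obj D" "Y' \<in> Obj D"
    and "\<And>f. \<lbrakk>f \<in> Arr C; src C f = X; tgt C f = Y\<rbrakk> \<Longrightarrow> FOb F f \<in> Arr D \<and> src D (FOb F f) = X' \<and> tgt D (FOb F f) = Y'"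
    and "\<And>a. \<lbrakk>a \<in> Cell C; src C (dom2 C a) = X; tgt C (dom2 C a) = Y\<rbrakk>
      \<Longrightarrow> FAr F a \<in> Cell D \<and> dom2 D (FAr F a) = FOb F (dom2 C a) \<and> cod2 D (FAr F a) = FOb F (cod2 C a)"
    and "\<And>f. \<lbrakk>f \<in> Arr C; src C f = X; tgt C f = Y\<rbrakk> \<Longrightarrow> FAr F (id2 C f) = id2 D (FOb F f)"
    and "\<And>a b. \<lbrakk>a \<in> Cell C; b \<in> Cell C; src C (dom2 C a) = X; tgt C (dom2 C a) = Y; dom2 C b = cod2 C a\<rbrakk>
      \<Longrightarrow> FAr F (b \<cdot>\<^bsub>C\<^esub> a) = FAr F b \<cdot>\<^bsub>D\<^esub> FAr F a"
  shows "functor_between (hom_cat C X Y) (hom_cat D X' Y') F"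
  by (intro functor_between.intro functor_between_axioms.intro two_category.hom_category[OF assms(1,3,4)]
      two_category.hom_category[OF assms(2,5,6)])
    (use assms(7-) in auto)

lemma natural_isomorphism_hom_catI:
  assumes "two_category D"
    and "functor_between (hom_cat C X Y) (hom_cat D X' Y') F" "functor_between (hom_cat C X Y) (hom_cat D X' Y') G"
    and "\<And>f. \<lbrakk>f \<in> Arr C; src C f = X; tgt C f = Y\<rbrakk>
      \<Longrightarrow> isocell D (\<theta> f) \<and> dom2 D (\<theta> f) = FOb F f \<and> cod2 D (\<theta> f) = FOb G f"
    and "\<And>a. \<lbrakk>a \<in> Cell C; src C (dom2 C a) = X; tgt C (dom2 C a) = Y\<rbrakk>
      \<Longrightarrow> FAr G a \<cdot>\<^bsub>D\<^esub> \<theta> (dom2 C a) = \<theta> (cod2 C a) \<cdot>\<^bsub>D\<^esub> FAr F a"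
  shows "natural_isomorphism (hom_cat C X Y) (hom_cat D X' Y') F G \<theta>"
proof (intro natural_isomorphism.intro natural_isomorphism_axioms.intro assms)
  fix f assume "f \<in> Ob (hom_cat C X Y)"
  then have f: "f \<in> Arr C" "src C f = X" "tgt C f = Y" by auto
  have "FOb F f \<in> Ob (hom_cat D X' Y')"
    using f by (intro functor_between.FOb_Ob[OF assms(2)]) auto
  then show "\<theta> f \<in> Iso (hom_cat D X' Y') (FOb F f) (FOb G f)"
    using assms(4)[OF f] by (simp add: two_category.Iso_hom_cat[OF assms(1)])
next
  fix a f g assume "a \<in> Hom (hom_cat C X Y) f g"
  then show "Cmp (hom_cat D X' Y') (FAr G a) (\<theta> f) = Cmp (hom_cat D X' Y') (\<theta> g) (FAr F a)"
    using assms(5)[of a] by auto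
qed

section \<open>Isomorphic 1-cells and internal equivalences\<close>

text \<open>Being an internal equivalence depends on a 1-cell only up to isomorphism, so the
  mediating cells are forgotten and arguments become chains of \<open>isom\<close> steps.\<close>

definition isom :: "('o, 'm, 'c, 'z) two_cat_scheme \<Rightarrow> 'm \<Rightarrow> 'm \<Rightarrow> bool" where
  "isom C f g \<longleftrightarrow> (\<exists>a. isocell C a \<and> dom2 C a = f \<and> cod2 C a = g)"

definition internal_equivalence :: "('o, 'm, 'c, 'z) two_cat_scheme \<Rightarrow> 'm \<Rightarrow> bool" where
  "internal_equivalence C e \<longleftrightarrow> e \<in> Arr C \<and>
     (\<exists>d. d \<in> Arr C \<and> src C d = tgt C e \<and> tgt C d = src C e \<and>
        isom C (d \<odot>\<^bsub>C\<^esub> e) (id1 C (src C e)) \<and> isom C (e \<odot>\<^bsub>C\<^esub> d) (id1 C (tgt C e)))"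

definition postcomp :: "('o, 'm, 'c, 'z) two_cat_scheme \<Rightarrow> 'm \<Rightarrow> ('m, 'c, 'm, 'c) fnc" where
  "postcomp C e = \<lparr>FOb = \<lambda>f. e \<odot>\<^bsub>C\<^esub> f, FAr = \<lambda>a. e \<rhd>\<^bsub>C\<^esub> a\<rparr>"

definition precomp :: "('o, 'm, 'c, 'z) two_cat_scheme \<Rightarrow> 'm \<Rightarrow> ('m, 'c, 'm, 'c) fnc" where
  "precomp C e = \<lparr>FOb = \<lambda>f. f \<odot>\<^bsub>C\<^esub> e, FAr = \<lambda>a. a \<lhd>\<^bsub>C\<^esub> e\<rparr>"

lemma postcomp_simps [simp]: "FOb (postcomp C e) f = e \<odot>\<^bsub>C\<^esub> f" "FAr (postcomp C e) a = e \<rhd>\<^bsub>C\<^esub> a"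
  by (simp_all add: postcomp_def)

lemma precomp_simps [simp]: "FOb (precomp C e) f = f \<odot>\<^bsub>C\<^esub> e" "FAr (precomp C e) a = a \<lhd>\<^bsub>C\<^esub> e"
  by (simp_all add: precomp_def)

lemma hom_functor_simps [simp]: "FOb (hom_functor F) f = PArr F f" "FAr (hom_functor F) a = PCell F a"
  by (simp_all add: hom_functor_def)

context two_category
begin

lemma isomI: "isocell C a \<Longrightarrow> isom C (dom2 C a) (cod2 C a)"
  by (auto simp: isom_def)

lemma isom_sym:
  assumes "isom C f g"
  shows "isom C g f"
proof -
  obtain a where "isocell C a" "dom2 C a = f" "cod2 C a = g"
    using assms by (auto simp: isom_def)
  then show ?thesis
    using isomI[of "inv2 C a"] by simp
qed

lemma isom_trans [trans]:
  assumes "isom C f g" "isom C g h"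
  shows "isom C f h"
proof -
  obtain a b where "isocell C a" "dom2 C a = f" "cod2 C a = g" "isocell C b" "dom2 C b = g" "cod2 C b = h"
    using assms by (auto simp: isom_def)
  then show ?thesis
    using isomI[of "b \<cdot> a"] by simp
qed

lemma isom_Arr:
  assumes "isom C f g"
  shows "f \<in> Arr C" "g \<in> Arr C" "src C g = src C f" "tgt C g = tgt C f"
proof -
  obtain a where a: "isocell C a" "dom2 C a = f" "cod2 C a = g"
    using assms by (auto simp: isom_def)
  then show "f \<in> Arr C" "g \<in> Arr C" "src C g = src C f" "tgt C g = tgt C f"
    using dom2_Arr[of a] cod2_simps[of a] by auto
qed

lemma isom_lwhisk:
  assumes "isom C f g" "h \<in> Arr C" "src C h = tgt C f"
  shows "isom C (h \<odot> f) (h \<odot> g)"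
proof -
  obtain a where "isocell C a" "dom2 C a = f" "cod2 C a = g"
    using assms by (auto simp: isom_def)
  then show ?thesis
    using isomI[of "h \<rhd> a"] assms by simp
qed

lemma isom_rwhisk:
  assumes "isom C f g" "h \<in> Arr C" "tgt C h = src C f"
  shows "isom C (f \<odot> h) (g \<odot> h)"
proof -
  obtain a where "isocell C a" "dom2 C a = f" "cod2 C a = g"
    using assms by (auto simp: isom_def)
  then show ?thesis
    using isomI[of "a \<lhd> h"] assms by simp
qed

lemma isom_id_left:
  assumes "isom C d (id1 C (tgt C f))" "f \<in> Arr C" "src C d = tgt C f"
  shows "isom C (d \<odot> f) f"
  using isom_rwhisk[OF assms(1,2)] assms by simp

lemma isom_id_right:
  assumes "isom C d (id1 C (src C f))" "f \<in> Arr C" "tgt C d = src C f"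
  shows "isom C (f \<odot> d) f"
  using isom_lwhisk[OF assms(1,2)] assms by simp

lemma internal_equivalenceE:
  assumes "internal_equivalence C e"
  obtains d where "e \<in> Arr C" "d \<in> Arr C" "src C d = tgt C e" "tgt C d = src C e"
    "isom C (d \<odot> e) (id1 C (src C e))" "isom C (e \<odot> d) (id1 C (tgt C e))" "internal_equivalence C d"
  using assms unfolding internal_equivalence_def by metis

lemma internal_equivalenceI:
  assumes "e \<in> Arr C" "d \<in> Arr C" "src C d = tgt C e" "tgt C d = src C e"
    "isom C (d \<odot> e) (id1 C (src C e))" "isom C (e \<odot> d) (id1 C (tgt C e))"
  shows "internal_equivalence C e"
  using assms by (auto simp: internal_equivalence_def)

lemma internal_equivalence_isom:
  assumes "internal_equivalence C e" "isom C e f"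
  shows "internal_equivalence C f"
proof -
  obtain d where d: "e \<in> Arr C" "d \<in> Arr C" "src C d = tgt C e" "tgt C d = src C e"
    "isom C (d \<odot> e) (id1 C (src C e))" "isom C (e \<odot> d) (id1 C (tgt C e))"
    using assms(1) by (rule internal_equivalenceE)
  note f = isom_Arr[OF assms(2)]
  show ?thesis
    using d f isom_trans[OF isom_sym[OF isom_lwhisk[OF assms(2), of d]] d(5)]
      isom_trans[OF isom_sym[OF isom_rwhisk[OF assms(2), of d]] d(6)]
    by (intro internal_equivalenceI[of _ d]) simp_all
qed

lemma internal_equivalence_cmp1:
  assumes "internal_equivalence C e" "internal_equivalence C f" "src C f = tgt C e"
  shows "internal_equivalence C (f \<odot> e)"
proof -
  obtain d where d: "e \<in> Arr C" "d \<in> Arr C" "src C d = tgt C e" "tgt C d = src C e"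
    "isom C (d \<odot> e) (id1 C (src C e))" "isom C (e \<odot> d) (id1 C (tgt C e))"
    using assms(1) by (rule internal_equivalenceE)
  obtain c where c: "f \<in> Arr C" "c \<in> Arr C" "src C c = tgt C f" "tgt C c = src C f"
    "isom C (c \<odot> f) (id1 C (src C f))" "isom C (f \<odot> c) (id1 C (tgt C f))"
    using assms(2) by (rule internal_equivalenceE)
  have "isom C (c \<odot> f \<odot> e) e"
    using isom_id_left[of "c \<odot> f" e] c d assms(3) by simp
  then have 1: "isom C (d \<odot> c \<odot> f \<odot> e) (id1 C (src C e))"
    using isom_trans[OF isom_lwhisk[of "c \<odot> f \<odot> e" e d] d(5)] c d assms(3) by simp
  have "isom C (e \<odot> d \<odot> c) c"
    using isom_id_left[of "e \<odot> d" c] c d assms(3) by simp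
  then have 2: "isom C (f \<odot> e \<odot> d \<odot> c) (id1 C (tgt C f))"
    using isom_trans[OF isom_lwhisk[of "e \<odot> d \<odot> c" c f] c(6)] c d assms(3) by simp
  show ?thesis
    using 1 2 c d assms(3) by (intro internal_equivalenceI[of _ "d \<odot> c"]) simp_all
qed

text \<open>A right inverse of an equivalence agrees with its quasi-inverse \<open>d\<close>: the
  composite \<open>d \<odot> e \<odot> f\<close> is isomorphic to both \<open>f\<close> and
  \<open>d\<close>.\<close>

lemma internal_equivalence_section:
  assumes "internal_equivalence C e" "f \<in> Arr C" "src C e = tgt C f" "isom C (e \<odot> f) (id1 C (tgt C e))"
  shows "internal_equivalence C f"
proof -
  obtain d where d: "e \<in> Arr C" "d \<in> Arr C" "src C d = tgt C e" "tgt C d = src C e"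
    "isom C (d \<odot> e) (id1 C (src C e))" "isom C (e \<odot> d) (id1 C (tgt C e))" "internal_equivalence C d"
    using assms(1) by (rule internal_equivalenceE)
  have "src C f = tgt C e"
    using isom_Arr(3)[OF assms(4)] assms d by simp
  then have "isom C (d \<odot> e \<odot> f) f" "isom C (d \<odot> e \<odot> f) d"
    using isom_id_left[of "d \<odot> e" f] isom_id_right[of "e \<odot> f" d] assms d by simp_all
  then show ?thesis
    using internal_equivalence_isom[OF d(7)] isom_trans isom_sym by blast
qed

text \<open>\<open>f\<close> is isomorphic to \<open>(f \<odot> e) \<odot> d\<close>, a composite of
  two equivalences.\<close>

lemma internal_equivalence_cancel_right:
  assumes "internal_equivalence C e" "internal_equivalence C (f \<odot> e)" "f \<in> Arr C" "src C f = tgt C e"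
  shows "internal_equivalence C f"
proof -
  obtain d where d: "e \<in> Arr C" "d \<in> Arr C" "src C d = tgt C e" "tgt C d = src C e"
    "isom C (e \<odot> d) (id1 C (tgt C e))" "internal_equivalence C d"
    using assms(1) by (rule internal_equivalenceE)
  have "isom C (f \<odot> e \<odot> d) f"
    using isom_id_right[of "e \<odot> d" f] assms d by simp
  moreover have "internal_equivalence C (f \<odot> e \<odot> d)"
    using internal_equivalence_cmp1[OF d(6) assms(2)] assms d by simp
  ultimately show ?thesis
    using internal_equivalence_isom by blast
qed

section \<open>Pre- and postcomposition with an internal equivalence\<close>

lemma functor_postcomp:
  assumes "e \<in> Arr C" "src C e = Y" "tgt C e = Z" "X \<in> Obj C"
  shows "functor_between (hom_cat C X Y) (hom_cat C X Z) (postcomp C e)"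
  by (rule functor_between_hom_catI) (use assms two_category_axioms in auto)

lemma functor_precomp:
  assumes "e \<in> Arr C" "src C e = X" "tgt C e = Y" "Z \<in> Obj C"
  shows "functor_between (hom_cat C Y Z) (hom_cat C X Z) (precomp C e)"
  by (rule functor_between_hom_catI) (use assms two_category_axioms in auto)

text \<open>Whiskering an isomorphism from the identity 1-cell to \<open>e \<odot> d\<close> gives a
  natural isomorphism from the identity functor; its naturality is \<open>exchange\<close>. Used for
  both orders of \<open>e\<close> and \<open>d\<close>, it feeds
  \<open>weak_equivalence_2_of_6\<close>.\<close>

lemma weak_equivalence_precomp_precomp:
  assumes "e \<in> Arr C" "d \<in> Arr C" "src C d = tgt C e" "tgt C d = src C e" "isom C (e \<odot> d) (id1 C (tgt C e))" "Z \<in> Obj C"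
  shows "weak_equivalence (hom_cat C (tgt C e) Z) (hom_cat C (tgt C e) Z) (fnc_comp (precomp C d) (precomp C e))"
proof -
  let ?F = "fnc_comp (precomp C d) (precomp C e)"
  let ?J = "hom_cat C (tgt C e) Z"
  obtain a where a: "isocell C a" "dom2 C a = id1 C (tgt C e)" "cod2 C a = e \<odot> d"
    using isom_sym[OF assms(5)] by (auto simp: isom_def)
  have cat: "category ?J"
    using assms by (intro hom_category) auto
  have "natural_isomorphism ?J ?J fnc_id
      ?F (\<lambda>f. f \<rhd> a)"
  proof (rule natural_isomorphism_hom_catI)
    show "functor_between ?J ?J ?F"
      using assms by (intro functor_between_comp[OF functor_precomp functor_precomp]) auto
  next
    fix b assume "b \<in> Cell C" "src C (dom2 C b) = tgt C e" "tgt C (dom2 C b) = Z"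
    then show "FAr ?F b \<cdot> dom2 C b \<rhd> a = (cod2 C b \<rhd> a) \<cdot> FAr fnc_id b"
      using exchange[of a b] a assms by simp
  qed (use a assms cat two_category_axioms in \<open>auto intro: functor_between_id\<close>)
  then show ?thesis
    by (rule weak_equivalence_natural_isomorphism[OF _ weak_equivalence_id[OF cat]])
qed

lemma weak_equivalence_precomp:
  assumes "internal_equivalence C e" "src C e = X" "tgt C e = Y" "Z \<in> Obj C"
  shows "weak_equivalence (hom_cat C Y Z) (hom_cat C X Z) (precomp C e)"
proof -
  obtain d where d: "e \<in> Arr C" "d \<in> Arr C" "src C d = tgt C e" "tgt C d = src C e"
    "isom C (d \<odot> e) (id1 C (src C e))" "isom C (e \<odot> d) (id1 C (tgt C e))"
    using assms(1) by (rule internal_equivalenceE)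
  show ?thesis
    by (rule weak_equivalence_2_of_6[where G = "precomp C d"])
      (use assms d weak_equivalence_precomp_precomp[of e d] weak_equivalence_precomp_precomp[of d e]
        functor_precomp in auto)
qed

lemma weak_equivalence_postcomp_postcomp:
  assumes "e \<in> Arr C" "d \<in> Arr C" "src C d = tgt C e" "tgt C d = src C e" "isom C (d \<odot> e) (id1 C (src C e))" "X \<in> Obj C"
  shows "weak_equivalence (hom_cat C X (src C e)) (hom_cat C X (src C e)) (fnc_comp (postcomp C d) (postcomp C e))"
proof -
  let ?F = "fnc_comp (postcomp C d) (postcomp C e)"
  let ?J = "hom_cat C X (src C e)"
  obtain a where a: "isocell C a" "dom2 C a = id1 C (src C e)" "cod2 C a = d \<odot> e"
    using isom_sym[OF assms(5)] by (auto simp: isom_def)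
  have cat: "category ?J"
    using assms by (intro hom_category) auto
  have "natural_isomorphism ?J ?J fnc_id
      ?F (\<lambda>f. a \<lhd> f)"
  proof (rule natural_isomorphism_hom_catI)
    show "functor_between ?J ?J ?F"
      using assms by (intro functor_between_comp[OF functor_postcomp functor_postcomp]) auto
  next
    fix b assume "b \<in> Cell C" "src C (dom2 C b) = X" "tgt C (dom2 C b) = src C e"
    then show "FAr ?F b \<cdot> a \<lhd> dom2 C b = (a \<lhd> cod2 C b) \<cdot> FAr fnc_id b"
      using exchange[of b a] a assms by simp
  qed (use a assms cat two_category_axioms in \<open>auto intro: functor_between_id\<close>)
  then show ?thesis
    by (rule weak_equivalence_natural_isomorphism[OF _ weak_equivalence_id[OF cat]])
qed

lemma weak_equivalence_postcomp:
  assumes "internal_equivalence C e" "src C e = Y" "tgt C e = Z" "X \<in> Obj C"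
  shows "weak_equivalence (hom_cat C X Y) (hom_cat C X Z) (postcomp C e)"
proof -
  obtain d where d: "e \<in> Arr C" "d \<in> Arr C" "src C d = tgt C e" "tgt C d = src C e"
    "isom C (d \<odot> e) (id1 C (src C e))" "isom C (e \<odot> d) (id1 C (tgt C e))"
    using assms(1) by (rule internal_equivalenceE)
  show ?thesis
    by (rule weak_equivalence_2_of_6[where G = "postcomp C d"])
      (use assms d weak_equivalence_postcomp_postcomp[of e d] weak_equivalence_postcomp_postcomp[of d e]
        functor_postcomp in auto)
qed

text \<open>Lets naturality of comparison cells be used for their inverses.\<close>

lemma inv2_square:
  assumes "b \<cdot> x = y \<cdot> a" "isocell C a" "isocell C b" "x \<in> Cell C" "y \<in> Cell C"
    "cod2 C x = dom2 C b" "dom2 C y = cod2 C a" "dom2 C x = dom2 C a"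
  shows "inv2 C b \<cdot> y = x \<cdot> inv2 C a"
proof -
  have "inv2 C b \<cdot> (b \<cdot> x) \<cdot> inv2 C a = inv2 C b \<cdot> (y \<cdot> a) \<cdot> inv2 C a"
    by (simp only: assms(1))
  then show ?thesis
    using assms(2-) arg_cong[OF assms(1), of "cod2 C"] by simp
qed

end

lemma weak_equivalence_reflects_isom:
  assumes "weak_equivalence (hom_cat C X Y) (hom_cat D X' Y') F" "two_category C" "two_category D"
    "isom D (FOb F f) (FOb F g)" "f \<in> Arr C" "src C f = X" "tgt C f = Y" "g \<in> Arr C" "src C g = X" "tgt C g = Y"
  shows "isom C f g"
proof -
  interpret C: two_category C by fact
  interpret D: two_category D by fact
  obtain a where a: "isocell D a" "dom2 D a = FOb F f" "cod2 D a = FOb F g"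
    using assms(4) by (auto simp: isom_def)
  have "FOb F f \<in> Ob (hom_cat D X' Y')"
    using assms by (intro functor_between.FOb_Ob[OF weak_equivalenceD(1)[OF assms(1)]]) auto
  then have "a \<in> Iso (hom_cat D X' Y') (FOb F f) (FOb F g)"
    using a by simp
  then show ?thesis
    using weak_equivalence_reflects_Iso[OF assms(1), of f g a] assms by (auto simp: isom_def)
qed

lemma weak_equivalence_essentially_surjective:
  assumes "weak_equivalence (hom_cat C X Y) (hom_cat D X' Y') F" "two_category D"
    "k \<in> Arr D" "src D k = X'" "tgt D k = Y'"
  shows "\<exists>f. f \<in> Arr C \<and> src C f = X \<and> tgt C f = Y \<and> isom D (FOb F f) k"
proof -
  interpret D: two_category D by fact
  have "k \<in> Ob (hom_cat D X' Y')"
    using assms(3-5) by simp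
  then obtain f a where "f \<in> Ob (hom_cat C X Y)" "a \<in> Iso (hom_cat D X' Y') (FOb F f) k"
    using weak_equivalenceD(4)[OF assms(1)] by blast
  then show ?thesis
    unfolding isom_def by (intro exI[of _ f]) auto
qed

context pseudofunctor
begin

lemma PArr_isom:
  assumes "isom C f g"
  shows "isom D (PArr F f) (PArr F g)"
proof -
  obtain a where "isocell C a" "dom2 C a = f" "cod2 C a = g"
    using assms by (auto simp: isom_def)
  then show ?thesis
    using D.isomI[of "PCell F a"] by simp
qed

lemma PCmp_isom:
  "\<lbrakk>f \<in> Arr C; g \<in> Arr C; src C g = tgt C f\<rbrakk> \<Longrightarrow> isom D (PArr F g \<odot>\<^bsub>D\<^esub> PArr F f) (PArr F (g \<odot>\<^bsub>C\<^esub> f))"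
  using D.isomI[of "PCmp F g f"] by simp

lemma PUnit_isom: "X \<in> Obj C \<Longrightarrow> isom D (id1 D (PObj F X)) (PArr F (id1 C X))"
  using D.isomI[of "PUnit F X"] by simp

lemma PArr_internal_equivalence:
  assumes "internal_equivalence C e"
  shows "internal_equivalence D (PArr F e)"
proof -
  obtain d where d: "e \<in> Arr C" "d \<in> Arr C" "src C d = tgt C e" "tgt C d = src C e"
    "isom C (d \<odot>\<^bsub>C\<^esub> e) (id1 C (src C e))" "isom C (e \<odot>\<^bsub>C\<^esub> d) (id1 C (tgt C e))"
    using assms(1) by (rule C.internal_equivalenceE)
  have "isom D (PArr F d \<odot>\<^bsub>D\<^esub> PArr F e) (id1 D (PObj F (src C e)))"
    "isom D (PArr F e \<odot>\<^bsub>D\<^esub> PArr F d) (id1 D (PObj F (tgt C e)))"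
    using D.isom_trans[OF D.isom_trans[OF PCmp_isom PArr_isom[OF d(5)]] D.isom_sym[OF PUnit_isom]]
      D.isom_trans[OF D.isom_trans[OF PCmp_isom PArr_isom[OF d(6)]] D.isom_sym[OF PUnit_isom]] d(1-4) by auto
  then show ?thesis
    using d(1-4) by (intro D.internal_equivalenceI[of _ "PArr F d"]) auto
qed

end

section \<open>Biadjunctions and hom-equivalences\<close>

context biadjunction
begin

abbreviation "h \<equiv> TArr \<eta>"
abbreviation "e \<equiv> TArr \<epsilon>"

lemma unit_counit_simps [simp]:
  "X \<in> Obj C \<Longrightarrow> h X \<in> Arr C" "X \<in> Obj C \<Longrightarrow> src C (h X) = X" "X \<in> Obj C \<Longrightarrow> tgt C (h X) = PObj U (PObj L X)"
  "Y \<in> Obj A \<Longrightarrow> e Y \<in> Arr A" "Y \<in> Obj A \<Longrightarrow> src A (e Y) = PObj L (PObj U Y)" "Y \<in> Obj A \<Longrightarrow> tgt A (e Y) = Y"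
  using \<eta>.TArr_simps[of X] \<epsilon>.TArr_simps[of Y] by simp_all

lemma unit_counit_cell_simps [simp]:
  "f \<in> Arr C \<Longrightarrow> isocell C (TCell \<eta> f)" "f \<in> Arr C \<Longrightarrow> TCell \<eta> f \<in> Cell C"
  "f \<in> Arr C \<Longrightarrow> dom2 C (TCell \<eta> f) = PArr U (PArr L f) \<odot>\<^bsub>C\<^esub> h (src C f)"
  "f \<in> Arr C \<Longrightarrow> cod2 C (TCell \<eta> f) = h (tgt C f) \<odot>\<^bsub>C\<^esub> f"
  "k \<in> Arr A \<Longrightarrow> isocell A (TCell \<epsilon> k)" "k \<in> Arr A \<Longrightarrow> TCell \<epsilon> k \<in> Cell A"
  "k \<in> Arr A \<Longrightarrow> dom2 A (TCell \<epsilon> k) = k \<odot>\<^bsub>A\<^esub> e (src A k)"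
  "k \<in> Arr A \<Longrightarrow> cod2 A (TCell \<epsilon> k) = e (tgt A k) \<odot>\<^bsub>A\<^esub> PArr L (PArr U k)"
  using \<eta>.TCell_simps[of f] \<epsilon>.TCell_simps[of k] by simp_all

lemma triangle_simps [simp]:
  "X \<in> Obj C \<Longrightarrow> isocell A (s X)" "X \<in> Obj C \<Longrightarrow> s X \<in> Cell A" "X \<in> Obj C \<Longrightarrow> dom2 A (s X) = id1 A (PObj L X)"
  "X \<in> Obj C \<Longrightarrow> cod2 A (s X) = e (PObj L X) \<odot>\<^bsub>A\<^esub> PArr L (h X)"
  "Y \<in> Obj A \<Longrightarrow> isocell C (t Y)" "Y \<in> Obj A \<Longrightarrow> t Y \<in> Cell C" "Y \<in> Obj A \<Longrightarrow> cod2 C (t Y) = id1 C (PObj U Y)"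
  "Y \<in> Obj A \<Longrightarrow> dom2 C (t Y) = PArr U (e Y) \<odot>\<^bsub>C\<^esub> h (PObj U Y)"
  using s.component_iso2[of X] t.component_iso2[of Y] by (simp_all add: tr_post_def)

section \<open>The hom-equivalence of a biadjunction\<close>

definition "left_transpose Y = fnc_comp (postcomp A (e Y)) (hom_functor L)"
definition "right_transpose X = fnc_comp (precomp C (h X)) (hom_functor U)"

lemma transpose_simps [simp]:
  "FOb (left_transpose Y) f = e Y \<odot>\<^bsub>A\<^esub> PArr L f" "FAr (left_transpose Y) a = e Y \<rhd>\<^bsub>A\<^esub> PCell L a"
  "FOb (right_transpose X) k = PArr U k \<odot>\<^bsub>C\<^esub> h X" "FAr (right_transpose X) b = PCell U b \<lhd>\<^bsub>C\<^esub> h X"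
  by (simp_all add: left_transpose_def right_transpose_def)

context
  fixes X Y assumes XY: "X \<in> Obj C" "Y \<in> Obj A"
begin

lemma functor_left_transpose:
  "functor_between (hom_cat C X (PObj U Y)) (hom_cat A (PObj L X) Y) (left_transpose Y)"
  by (rule functor_between_hom_catI) (use XY in \<open>auto intro: L.C.two_category_axioms L.D.two_category_axioms\<close>)

lemma functor_right_transpose:
  "functor_between (hom_cat A (PObj L X) Y) (hom_cat C X (PObj U Y)) (right_transpose X)"
  by (rule functor_between_hom_catI) (use XY in \<open>auto intro: L.C.two_category_axioms L.D.two_category_axioms\<close>)

lemma right_left_transpose:
  "weak_equivalence (hom_cat C X (PObj U Y)) (hom_cat C X (PObj U Y)) (fnc_comp (right_transpose X) (left_transpose Y))"
proof -
  let ?GF = "fnc_comp (right_transpose X) (left_transpose Y)"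
  let ?J = "hom_cat C X (PObj U Y)"
  \<comment> \<open>At \<open>f\<close> this runs \<open>U (e Y \<odot> L f) \<odot> h X
    \<Rightarrow> U (e Y) \<odot> U (L f) \<odot> h X \<Rightarrow> U (e Y) \<odot> h (U Y) \<odot>
    f \<Rightarrow> f\<close>, by the comparison of \<open>U\<close>, the pseudonaturality of \<eta>
    and the triangle cell \<open>t\<close>.\<close>
  let ?\<theta> = "\<lambda>f. (t Y \<lhd>\<^bsub>C\<^esub> f) \<cdot>\<^bsub>C\<^esub> (PArr U (e Y) \<rhd>\<^bsub>C\<^esub> TCell \<eta> f) \<cdot>\<^bsub>C\<^esub> (inv2 C (PCmp U (e Y) (PArr L f)) \<lhd>\<^bsub>C\<^esub> h X)"
  have cat: "category ?J"
    using XY by (intro L.C.hom_category) auto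
  have "natural_isomorphism ?J ?J
      ?GF fnc_id ?\<theta>"
  proof (rule natural_isomorphism_hom_catI)
    fix a assume a: "a \<in> Cell C" "src C (dom2 C a) = X" "tgt C (dom2 C a) = PObj U Y"
    let ?f = "dom2 C a" and ?g = "cod2 C a"
    have "PCmp U (e Y) (PArr L ?g) \<cdot>\<^bsub>C\<^esub> (PArr U (e Y) \<rhd>\<^bsub>C\<^esub> PCell U (PCell L a))
      = PCell U (e Y \<rhd>\<^bsub>A\<^esub> PCell L a) \<cdot>\<^bsub>C\<^esub> PCmp U (e Y) (PArr L ?f)"
      using a XY by (intro U.PCmp_lwhisk) auto
    then have "inv2 C (PCmp U (e Y) (PArr L ?g)) \<cdot>\<^bsub>C\<^esub> PCell U (e Y \<rhd>\<^bsub>A\<^esub> PCell L a)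
      = (PArr U (e Y) \<rhd>\<^bsub>C\<^esub> PCell U (PCell L a)) \<cdot>\<^bsub>C\<^esub> inv2 C (PCmp U (e Y) (PArr L ?f))"
      by (rule L.C.inv2_square) (use a XY in simp_all)
    from arg_cong[OF this, of "\<lambda>x. x \<lhd>\<^bsub>C\<^esub> h X"]
    have 1: "(inv2 C (PCmp U (e Y) (PArr L ?g)) \<lhd>\<^bsub>C\<^esub> h X) \<cdot>\<^bsub>C\<^esub> (PCell U (e Y \<rhd>\<^bsub>A\<^esub> PCell L a) \<lhd>\<^bsub>C\<^esub> h X)
      = (PArr U (e Y) \<rhd>\<^bsub>C\<^esub> PCell U (PCell L a) \<lhd>\<^bsub>C\<^esub> h X) \<cdot>\<^bsub>C\<^esub> (inv2 C (PCmp U (e Y) (PArr L ?f)) \<lhd>\<^bsub>C\<^esub> h X)"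
      using a XY by simp
    have "(h (PObj U Y) \<rhd>\<^bsub>C\<^esub> a) \<cdot>\<^bsub>C\<^esub> TCell \<eta> ?f = TCell \<eta> ?g \<cdot>\<^bsub>C\<^esub> (PCell U (PCell L a) \<lhd>\<^bsub>C\<^esub> h X)"
      using \<eta>.TCell_natural_simp[OF a(1) refl refl a(2,3)] by simp
    from arg_cong[OF this, of "\<lambda>x. PArr U (e Y) \<rhd>\<^bsub>C\<^esub> x"]
    have 2: "(PArr U (e Y) \<rhd>\<^bsub>C\<^esub> TCell \<eta> ?g) \<cdot>\<^bsub>C\<^esub> (PArr U (e Y) \<rhd>\<^bsub>C\<^esub> PCell U (PCell L a) \<lhd>\<^bsub>C\<^esub> h X)
      = ((PArr U (e Y) \<odot>\<^bsub>C\<^esub> h (PObj U Y)) \<rhd>\<^bsub>C\<^esub> a) \<cdot>\<^bsub>C\<^esub> (PArr U (e Y) \<rhd>\<^bsub>C\<^esub> TCell \<eta> ?f)"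
      using a XY by simp
    have 3: "(t Y \<lhd>\<^bsub>C\<^esub> ?g) \<cdot>\<^bsub>C\<^esub> ((PArr U (e Y) \<odot>\<^bsub>C\<^esub> h (PObj U Y)) \<rhd>\<^bsub>C\<^esub> a) = a \<cdot>\<^bsub>C\<^esub> (t Y \<lhd>\<^bsub>C\<^esub> ?f)"
      using L.C.exchange[of a "t Y"] a XY by simp
    show "FAr fnc_id a \<cdot>\<^bsub>C\<^esub> ?\<theta> ?f = ?\<theta> ?g \<cdot>\<^bsub>C\<^esub> FAr ?GF a"
      using a XY by (simp add: 1 L.C.reassoc[OF 2] L.C.reassoc[OF 3])
  qed (use XY cat in \<open>auto intro: L.C.two_category_axioms functor_between_id functor_between_comp
        functor_left_transpose functor_right_transpose\<close>)
  from natural_isomorphism_sym[OF this] show ?thesis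
    using weak_equivalence_natural_isomorphism[OF _ weak_equivalence_id[OF cat]] by blast
qed

lemma left_right_transpose:
  "weak_equivalence (hom_cat A (PObj L X) Y) (hom_cat A (PObj L X) Y) (fnc_comp (left_transpose Y) (right_transpose X))"
proof -
  let ?FG = "fnc_comp (left_transpose Y) (right_transpose X)"
  let ?J = "hom_cat A (PObj L X) Y"
  \<comment> \<open>At \<open>k\<close> this runs \<open>k \<Rightarrow> k \<odot> e (L X) \<odot> L
    (h X) \<Rightarrow> e Y \<odot> L (U k) \<odot> L (h X) \<Rightarrow> e Y \<odot> L (U k \<odot>
    h X)\<close>, by the triangle cell \<open>s\<close>, the pseudonaturality of \<epsilon> and the
    comparison of \<open>L\<close>.\<close>
  let ?\<theta> = "\<lambda>k. (e Y \<rhd>\<^bsub>A\<^esub> PCmp L (PArr U k) (h X)) \<cdot>\<^bsub>A\<^esub> (TCell \<epsilon> k \<lhd>\<^bsub>A\<^esub> PArr L (h X)) \<cdot>\<^bsub>A\<^esub> (k \<rhd>\<^bsub>A\<^esub> s X)"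
  have cat: "category ?J"
    using XY by (intro L.D.hom_category) auto
  have "natural_isomorphism ?J ?J fnc_id
      ?FG ?\<theta>"
  proof (rule natural_isomorphism_hom_catI)
    fix a assume a: "a \<in> Cell A" "src A (dom2 A a) = PObj L X" "tgt A (dom2 A a) = Y"
    let ?f = "dom2 A a" and ?g = "cod2 A a"
    have "PCmp L (PArr U ?g) (h X) \<cdot>\<^bsub>A\<^esub> (PCell L (PCell U a) \<lhd>\<^bsub>A\<^esub> PArr L (h X))
      = PCell L (PCell U a \<lhd>\<^bsub>C\<^esub> h X) \<cdot>\<^bsub>A\<^esub> PCmp L (PArr U ?f) (h X)"
      using a XY by (intro L.PCmp_rwhisk) auto
    from arg_cong[OF this, of "\<lambda>x. e Y \<rhd>\<^bsub>A\<^esub> x"]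
    have 1: "(e Y \<rhd>\<^bsub>A\<^esub> PCell L (PCell U a \<lhd>\<^bsub>C\<^esub> h X)) \<cdot>\<^bsub>A\<^esub> (e Y \<rhd>\<^bsub>A\<^esub> PCmp L (PArr U ?f) (h X))
      = (e Y \<rhd>\<^bsub>A\<^esub> PCmp L (PArr U ?g) (h X)) \<cdot>\<^bsub>A\<^esub> (e Y \<rhd>\<^bsub>A\<^esub> PCell L (PCell U a) \<lhd>\<^bsub>A\<^esub> PArr L (h X))"
      using a XY by simp
    have "(e Y \<rhd>\<^bsub>A\<^esub> PCell L (PCell U a)) \<cdot>\<^bsub>A\<^esub> TCell \<epsilon> ?f = TCell \<epsilon> ?g \<cdot>\<^bsub>A\<^esub> (a \<lhd>\<^bsub>A\<^esub> e (PObj L X))"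
      using \<epsilon>.TCell_natural_simp[OF a(1) refl refl a(2,3)] by simp
    from arg_cong[OF this, of "\<lambda>x. x \<lhd>\<^bsub>A\<^esub> PArr L (h X)"]
    have 2: "(e Y \<rhd>\<^bsub>A\<^esub> PCell L (PCell U a) \<lhd>\<^bsub>A\<^esub> PArr L (h X)) \<cdot>\<^bsub>A\<^esub> (TCell \<epsilon> ?f \<lhd>\<^bsub>A\<^esub> PArr L (h X))
      = (TCell \<epsilon> ?g \<lhd>\<^bsub>A\<^esub> PArr L (h X)) \<cdot>\<^bsub>A\<^esub> (a \<lhd>\<^bsub>A\<^esub> (e (PObj L X) \<odot>\<^bsub>A\<^esub> PArr L (h X)))"
      using a XY by simp
    have 3: "(a \<lhd>\<^bsub>A\<^esub> (e (PObj L X) \<odot>\<^bsub>A\<^esub> PArr L (h X))) \<cdot>\<^bsub>A\<^esub> (?f \<rhd>\<^bsub>A\<^esub> s X) = (?g \<rhd>\<^bsub>A\<^esub> s X) \<cdot>\<^bsub>A\<^esub> a"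
      using L.D.exchange[of "s X" a] a XY by simp
    show "FAr ?FG a \<cdot>\<^bsub>A\<^esub> ?\<theta> ?f = ?\<theta> ?g \<cdot>\<^bsub>A\<^esub> FAr fnc_id a"
      using a XY by (simp add: L.D.reassoc[OF 1] L.D.reassoc[OF 2] 3)
  qed (use XY cat in \<open>auto intro: L.D.two_category_axioms functor_between_id functor_between_comp
        functor_left_transpose functor_right_transpose\<close>)
  then show ?thesis
    by (rule weak_equivalence_natural_isomorphism[OF _ weak_equivalence_id[OF cat]])
qed

lemma weak_equivalence_left_transpose:
  "weak_equivalence (hom_cat C X (PObj U Y)) (hom_cat A (PObj L X) Y) (left_transpose Y)"
  by (rule weak_equivalence_2_of_6[OF right_left_transpose left_right_transpose
        functor_left_transpose functor_right_transpose])

lemma weak_equivalence_right_transpose: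
  "weak_equivalence (hom_cat A (PObj L X) Y) (hom_cat C X (PObj U Y)) (right_transpose X)"
  by (rule weak_equivalence_2_of_6[OF left_right_transpose right_left_transpose
        functor_right_transpose functor_left_transpose])

end

lemma triangle_isom:
  "X \<in> Obj C \<Longrightarrow> isom A (e (PObj L X) \<odot>\<^bsub>A\<^esub> PArr L (h X)) (id1 A (PObj L X))"
  "Y \<in> Obj A \<Longrightarrow> isom C (PArr U (e Y) \<odot>\<^bsub>C\<^esub> h (PObj U Y)) (id1 C (PObj U Y))"
  using L.D.isom_sym[OF L.D.isomI[of "s X"]] L.C.isomI[of "t Y"] by simp_all

section \<open>1-cells inverted by a biadjunction\<close>

text \<open>The bicategorical form of the fact that a fully faithful right adjoint has an invertible
  counit. One composite with the candidate inverse is recognised after applying \<open>U\<close>,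
  the other after right transposition; both times the triangle \<open>t\<close> decides.\<close>

lemma counit_internal_equivalence:
  assumes "local_equivalence A C U" and Y: "Y \<in> Obj A"
  shows "internal_equivalence A (e Y)"
proof -
  let ?V = "PObj U Y"
  have V: "?V \<in> Obj C" "PObj L ?V \<in> Obj A" "h ?V \<in> Arr C" using Y by auto
  have U: "weak_equivalence (hom_cat A Z W) (hom_cat C (PObj U Z) (PObj U W)) (hom_functor U)"
    if "Z \<in> Obj A" "W \<in> Obj A" for Z W
    using assms that by (auto simp: local_equivalence_def intro: equivalence_imp_weak_equivalence)
  \<comment> \<open>The quasi-inverse of the counit is an essential preimage of the unit at
    \<open>U Y\<close> under the local equivalence \<open>U\<close>.\<close>
  obtain g where g: "g \<in> Arr A" "src A g = Y" "tgt A g = PObj L ?V" "isom C (PArr U g) (h ?V)"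
    using weak_equivalence_essentially_surjective[OF U[OF Y V(2)] L.C.two_category_axioms, of "h ?V"] Y V by auto
  have Ug: "PArr U g \<in> Arr C" "src C (PArr U g) = ?V" "tgt C (PArr U g) = PObj U (PObj L ?V)"
    using g by simp_all
  have "isom C (PArr U (e Y \<odot>\<^bsub>A\<^esub> g)) (PArr U (e Y) \<odot>\<^bsub>C\<^esub> PArr U g)"
    using L.C.isom_sym[OF U.PCmp_isom[of g "e Y"]] g Y by simp
  also have "isom C (PArr U (e Y) \<odot>\<^bsub>C\<^esub> PArr U g) (PArr U (e Y) \<odot>\<^bsub>C\<^esub> h ?V)"
    by (rule L.C.isom_lwhisk) (use g Ug Y in simp_all)
  also have "isom C (PArr U (e Y) \<odot>\<^bsub>C\<^esub> h ?V) (id1 C ?V)"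
    by (rule triangle_isom(2)[OF Y])
  also have "isom C (id1 C ?V) (PArr U (id1 A Y))"
    by (rule U.PUnit_isom[OF Y])
  finally have 1: "isom A (e Y \<odot>\<^bsub>A\<^esub> g) (id1 A Y)"
    using g Y L.C.two_category_axioms L.D.two_category_axioms
    by (intro weak_equivalence_reflects_isom[OF U[OF Y Y]]) auto
  have "isom C (PArr U (g \<odot>\<^bsub>A\<^esub> e Y) \<odot>\<^bsub>C\<^esub> h ?V) ((PArr U g \<odot>\<^bsub>C\<^esub> PArr U (e Y)) \<odot>\<^bsub>C\<^esub> h ?V)"
    using L.C.isom_rwhisk[OF L.C.isom_sym[OF U.PCmp_isom[of "e Y" g]] V(3)] g Y V by simp
  also have "(PArr U g \<odot>\<^bsub>C\<^esub> PArr U (e Y)) \<odot>\<^bsub>C\<^esub> h ?V = PArr U g \<odot>\<^bsub>C\<^esub> (PArr U (e Y) \<odot>\<^bsub>C\<^esub> h ?V)"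
    using g Y V by simp
  also have "isom C (PArr U g \<odot>\<^bsub>C\<^esub> (PArr U (e Y) \<odot>\<^bsub>C\<^esub> h ?V)) (PArr U g)"
    by (rule L.C.isom_id_right) (use triangle_isom(2)[OF Y] g Ug Y V in simp_all)
  also have "isom C (PArr U g) (h ?V)"
    by (rule g)
  also have "isom C (h ?V) (PArr U (id1 A (PObj L ?V)) \<odot>\<^bsub>C\<^esub> h ?V)"
    using L.C.isom_rwhisk[OF U.PUnit_isom[OF V(2)] V(3)] V Y by simp
  finally have 2: "isom A (g \<odot>\<^bsub>A\<^esub> e Y) (id1 A (PObj L ?V))"
    using g Y V L.C.two_category_axioms L.D.two_category_axioms
    by (intro weak_equivalence_reflects_isom[OF weak_equivalence_right_transpose[OF V(1,2)]]) auto
  show ?thesis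
    by (rule L.D.internal_equivalenceI[of _ g]) (use 1 2 g Y in simp_all)
qed

text \<open>By the first triangle, \<open>L (h X)\<close> is a right inverse of the counit at
  \<open>L X\<close>.\<close>

lemma PArr_unit_internal_equivalence:
  assumes "X \<in> Obj C" "internal_equivalence A (e (PObj L X))"
  shows "internal_equivalence A (PArr L (h X))"
  by (rule L.D.internal_equivalence_section[OF assms(2)]) (use assms triangle_isom(1) in simp_all)

text \<open>Objects \<open>U Y\<close> see every 1-cell inverted by \<open>L\<close> as an equivalence.\<close>

lemma
  assumes n: "n \<in> Arr C" "internal_equivalence A (PArr L n)" and Y: "Y \<in> Obj A"
  shows extension_along: "\<lbrakk>k \<in> Arr C; src C k = src C n; tgt C k = PObj U Y\<rbrakk>
      \<Longrightarrow> \<exists>r. r \<in> Arr C \<and> src C r = tgt C n \<and> tgt C r = PObj U Y \<and> isom C (r \<odot>\<^bsub>C\<^esub> n) k"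
    and isom_cancel_along: "\<lbrakk>f \<in> Arr C; src C f = tgt C n; tgt C f = PObj U Y;
        g \<in> Arr C; src C g = tgt C n; tgt C g = PObj U Y; isom C (f \<odot>\<^bsub>C\<^esub> n) (g \<odot>\<^bsub>C\<^esub> n)\<rbrakk> \<Longrightarrow> isom C f g"
proof -
  obtain m where m': "m \<in> Arr A" "src A m = tgt A (PArr L n)" "tgt A m = src A (PArr L n)"
    "isom A (m \<odot>\<^bsub>A\<^esub> PArr L n) (id1 A (src A (PArr L n)))" "isom A (PArr L n \<odot>\<^bsub>A\<^esub> m) (id1 A (tgt A (PArr L n)))"
    using n(2) by (rule L.D.internal_equivalenceE)
  have m: "m \<in> Arr A" "src A m = PObj L (tgt C n)" "tgt A m = PObj L (src C n)"
    "isom A (m \<odot>\<^bsub>A\<^esub> PArr L n) (id1 A (PObj L (src C n)))" "isom A (PArr L n \<odot>\<^bsub>A\<^esub> m) (id1 A (PObj L (tgt C n)))"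
    using m' n by simp_all
  have Obs: "src C n \<in> Obj C" "tgt C n \<in> Obj C" using n by auto
  note wd = weak_equivalence_left_transpose[OF Obs(2) Y] and wc = weak_equivalence_left_transpose[OF Obs(1) Y]
  have transpose_cmp: "isom A (e Y \<odot>\<^bsub>A\<^esub> PArr L (f \<odot>\<^bsub>C\<^esub> n)) ((e Y \<odot>\<^bsub>A\<^esub> PArr L f) \<odot>\<^bsub>A\<^esub> PArr L n)"
    if "f \<in> Arr C" "src C f = tgt C n" "tgt C f = PObj U Y" for f
    using L.D.isom_sym[OF L.D.isom_lwhisk[OF L.PCmp_isom[of n f], of "e Y"]] that n Y by simp
  {
    assume k: "k \<in> Arr C" "src C k = src C n" "tgt C k = PObj U Y"
    have km: "e Y \<odot>\<^bsub>A\<^esub> PArr L k \<odot>\<^bsub>A\<^esub> m \<in> Arr A" "src A (e Y \<odot>\<^bsub>A\<^esub> PArr L k \<odot>\<^bsub>A\<^esub> m) = PObj L (tgt C n)"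
      "tgt A (e Y \<odot>\<^bsub>A\<^esub> PArr L k \<odot>\<^bsub>A\<^esub> m) = Y"
      using k m Y by simp_all
    \<comment> \<open>The transpose of \<open>k\<close> is extended along \<open>L n\<close> by
      precomposing with its quasi-inverse \<open>m\<close>; \<open>r\<close> transposes to that
      extension.\<close>
    obtain r where r: "r \<in> Arr C" "src C r = tgt C n" "tgt C r = PObj U Y"
      "isom A (e Y \<odot>\<^bsub>A\<^esub> PArr L r) (e Y \<odot>\<^bsub>A\<^esub> PArr L k \<odot>\<^bsub>A\<^esub> m)"
      using weak_equivalence_essentially_surjective[OF wd L.D.two_category_axioms km] by auto
    have "isom A (e Y \<odot>\<^bsub>A\<^esub> PArr L (r \<odot>\<^bsub>C\<^esub> n)) ((e Y \<odot>\<^bsub>A\<^esub> PArr L r) \<odot>\<^bsub>A\<^esub> PArr L n)"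
      by (rule transpose_cmp[OF r(1-3)])
    also have "isom A ((e Y \<odot>\<^bsub>A\<^esub> PArr L r) \<odot>\<^bsub>A\<^esub> PArr L n) ((e Y \<odot>\<^bsub>A\<^esub> PArr L k \<odot>\<^bsub>A\<^esub> m) \<odot>\<^bsub>A\<^esub> PArr L n)"
      by (rule L.D.isom_rwhisk) (use r n Y in simp_all)
    also have "(e Y \<odot>\<^bsub>A\<^esub> PArr L k \<odot>\<^bsub>A\<^esub> m) \<odot>\<^bsub>A\<^esub> PArr L n = (e Y \<odot>\<^bsub>A\<^esub> PArr L k) \<odot>\<^bsub>A\<^esub> (m \<odot>\<^bsub>A\<^esub> PArr L n)"
      using k m n Y by simp
    also have "isom A ((e Y \<odot>\<^bsub>A\<^esub> PArr L k) \<odot>\<^bsub>A\<^esub> (m \<odot>\<^bsub>A\<^esub> PArr L n)) (e Y \<odot>\<^bsub>A\<^esub> PArr L k)"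
      by (rule L.D.isom_id_right) (use m(4) k m n Y in simp_all)
    finally have "isom C (r \<odot>\<^bsub>C\<^esub> n) k"
      using r k n L.C.two_category_axioms L.D.two_category_axioms by (intro weak_equivalence_reflects_isom[OF wc]) auto
    with r show "\<exists>r. r \<in> Arr C \<and> src C r = tgt C n \<and> tgt C r = PObj U Y \<and> isom C (r \<odot>\<^bsub>C\<^esub> n) k"
      by blast
  next
    assume fg: "f \<in> Arr C" "src C f = tgt C n" "tgt C f = PObj U Y"
      "g \<in> Arr C" "src C g = tgt C n" "tgt C g = PObj U Y" and i: "isom C (f \<odot>\<^bsub>C\<^esub> n) (g \<odot>\<^bsub>C\<^esub> n)"
    have cancel: "isom A (((e Y \<odot>\<^bsub>A\<^esub> PArr L f) \<odot>\<^bsub>A\<^esub> PArr L n) \<odot>\<^bsub>A\<^esub> m) (e Y \<odot>\<^bsub>A\<^esub> PArr L f)"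
      if "f \<in> Arr C" "src C f = tgt C n" "tgt C f = PObj U Y" for f
      using L.D.isom_id_right[of "PArr L n \<odot>\<^bsub>A\<^esub> m" "e Y \<odot>\<^bsub>A\<^esub> PArr L f"] that m n Y by simp
    have "isom A ((e Y \<odot>\<^bsub>A\<^esub> PArr L f) \<odot>\<^bsub>A\<^esub> PArr L n) (e Y \<odot>\<^bsub>A\<^esub> PArr L (f \<odot>\<^bsub>C\<^esub> n))"
      by (rule L.D.isom_sym[OF transpose_cmp[OF fg(1-3)]])
    also have "isom A (e Y \<odot>\<^bsub>A\<^esub> PArr L (f \<odot>\<^bsub>C\<^esub> n)) (e Y \<odot>\<^bsub>A\<^esub> PArr L (g \<odot>\<^bsub>C\<^esub> n))"
      using fg n Y by (intro L.D.isom_lwhisk[OF L.PArr_isom[OF i]]) simp_all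
    also have "isom A (e Y \<odot>\<^bsub>A\<^esub> PArr L (g \<odot>\<^bsub>C\<^esub> n)) ((e Y \<odot>\<^bsub>A\<^esub> PArr L g) \<odot>\<^bsub>A\<^esub> PArr L n)"
      by (rule transpose_cmp[OF fg(4-6)])
    finally have "isom A (((e Y \<odot>\<^bsub>A\<^esub> PArr L f) \<odot>\<^bsub>A\<^esub> PArr L n) \<odot>\<^bsub>A\<^esub> m) (((e Y \<odot>\<^bsub>A\<^esub> PArr L g) \<odot>\<^bsub>A\<^esub> PArr L n) \<odot>\<^bsub>A\<^esub> m)"
      by (rule L.D.isom_rwhisk) (use fg m n Y in simp_all)
    then have "isom A (e Y \<odot>\<^bsub>A\<^esub> PArr L f) (e Y \<odot>\<^bsub>A\<^esub> PArr L g)"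
      using L.D.isom_trans[OF L.D.isom_trans[OF L.D.isom_sym[OF cancel[OF fg(1-3)]]] cancel[OF fg(4-6)]] by blast
    then show "isom C f g"
      using fg L.C.two_category_axioms L.D.two_category_axioms by (intro weak_equivalence_reflects_isom[OF wd]) auto
  }
qed

text \<open>By the cells of \<eta>, applying \<open>L\<close> and then right transposition is
  isomorphic to postcomposition with the unit at \<open>Z\<close>. Two of these three functors are
  equivalences, hence so is \<open>L\<close> here.\<close>

lemma weak_equivalence_hom_functor:
  assumes X: "X \<in> Obj C" "Z \<in> Obj C" and Z: "internal_equivalence C (h Z)"
  shows "weak_equivalence (hom_cat C X Z) (hom_cat A (PObj L X) (PObj L Z)) (hom_functor L)"
proof -
  have L: "functor_between (hom_cat C X Z) (hom_cat A (PObj L X) (PObj L Z)) (hom_functor L)"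
    using X by (rule L.hom_functor)
  have LZ: "PObj L Z \<in> Obj A" using X by simp
  have post: "weak_equivalence (hom_cat C X Z) (hom_cat C X (PObj U (PObj L Z))) (postcomp C (h Z))"
    using X by (intro L.C.weak_equivalence_postcomp Z) auto
  have "natural_isomorphism (hom_cat C X Z) (hom_cat C X (PObj U (PObj L Z)))
      (fnc_comp (right_transpose X) (hom_functor L)) (postcomp C (h Z)) (TCell \<eta>)"
  proof (rule natural_isomorphism_hom_catI)
    fix a assume a: "a \<in> Cell C" "src C (dom2 C a) = X" "tgt C (dom2 C a) = Z"
    show "FAr (postcomp C (h Z)) a \<cdot>\<^bsub>C\<^esub> TCell \<eta> (dom2 C a)
      = TCell \<eta> (cod2 C a) \<cdot>\<^bsub>C\<^esub> FAr (fnc_comp (right_transpose X) (hom_functor L)) a"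
      using \<eta>.TCell_natural_simp[OF a(1) refl refl a(2,3)] by simp
  qed (use X LZ weak_equivalenceD(1)[OF post] functor_between_comp[OF L functor_right_transpose[OF X(1) LZ]]
        L.C.two_category_axioms in auto)
  then have "weak_equivalence (hom_cat C X Z) (hom_cat C X (PObj U (PObj L Z))) (fnc_comp (right_transpose X) (hom_functor L))"
    using natural_isomorphism_sym weak_equivalence_natural_isomorphism[OF _ post] by blast
  then show ?thesis
    by (rule weak_equivalence_right_factor[OF _ weak_equivalence_right_transpose[OF X(1) LZ] L])
qed

end

section \<open>The right biadjoint of \<open>E\<close>\<close>

lemma pseudonatural_equivalence_component:
  assumes "pseudonatural_equivalence C D F G \<tau>" "X \<in> Obj C"
  shows "internal_equivalence D (TArr \<tau> X)"
proof -
  obtain \<sigma> \<Gamma> \<Delta> where T: "pseudonatural C D F G \<tau>" "pseudonatural C D G F \<sigma>"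
    and \<Gamma>: "invertible_modification C D F F (tr_id D F) (tr_comp C D \<sigma> \<tau>) \<Gamma>"
    and \<Delta>: "invertible_modification C D G G (tr_comp C D \<tau> \<sigma>) (tr_id D G) \<Delta>"
    using assms(1) unfolding pseudonatural_equivalence_def by blast
  interpret T: pseudonatural C D F G \<tau> by (rule T)
  interpret S: pseudonatural C D G F \<sigma> by (rule T)
  have "isom D (TArr \<sigma> X \<odot>\<^bsub>D\<^esub> TArr \<tau> X) (id1 D (PObj F X))" "isom D (TArr \<tau> X \<odot>\<^bsub>D\<^esub> TArr \<sigma> X) (id1 D (PObj G X))"
    using T.F.D.isom_sym[OF T.F.D.isomI[of "\<Gamma> X"]] T.F.D.isomI[of "\<Delta> X"]
      invertible_modification.component_iso2[OF \<Gamma> assms(2)] invertible_modification.component_iso2[OF \<Delta> assms(2)]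
    by simp_all
  then show ?thesis
    using assms(2) by (intro T.F.D.internal_equivalenceI[of _ "TArr \<sigma> X"]) simp_all
qed

text \<open>The pseudonatural equivalence enters through its pseudonaturality, needed to build the
  counit, and through its components being internal equivalences, needed to cancel them.\<close>

locale comparison =
  Ad: biadjunction C A L U \<eta> \<epsilon> s t + Ad': biadjunction C B L' U' \<eta>' \<epsilon>' s' t'
  + E: pseudofunctor B A E + \<tau>: pseudonatural C A "ps_comp A E L'" L \<tau>
  for A :: "('oa, 'ma, 'ca) two_cat" and B :: "('ob, 'mb, 'cb) two_cat" and C :: "('oc, 'mc, 'cc) two_cat"
    and L U \<eta> \<epsilon> s t L' U' \<eta>' \<epsilon>' s' t' and E :: "('ob, 'mb, 'cb, 'oa, 'ma, 'ca) psfun" and \<tau> +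
  assumes local_U: "local_equivalence A C U" and local_U': "local_equivalence B C U'"
    and \<tau>_equivalence: "X \<in> Obj C \<Longrightarrow> internal_equivalence A (TArr \<tau> X)"
begin

lemma \<tau>_simps [simp]:
  "X \<in> Obj C \<Longrightarrow> TArr \<tau> X \<in> Arr A" "X \<in> Obj C \<Longrightarrow> src A (TArr \<tau> X) = PObj E (PObj L' X)"
  "X \<in> Obj C \<Longrightarrow> tgt A (TArr \<tau> X) = PObj L X"
  using \<tau>.TArr_simps[of X] by simp_all

lemma \<tau>_cell_simps [simp]:
  "f \<in> Arr C \<Longrightarrow> isocell A (TCell \<tau> f)" "f \<in> Arr C \<Longrightarrow> TCell \<tau> f \<in> Cell A"
  "f \<in> Arr C \<Longrightarrow> dom2 A (TCell \<tau> f) = PArr L f \<odot>\<^bsub>A\<^esub> TArr \<tau> (src C f)"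
  "f \<in> Arr C \<Longrightarrow> cod2 A (TCell \<tau> f) = TArr \<tau> (tgt C f) \<odot>\<^bsub>A\<^esub> PArr E (PArr L' f)"
  using \<tau>.TCell_simps[of f] by simp_all

definition "R = ps_comp B L' U"
definition "counit = tr_comp A A \<epsilon> (tr_pre \<tau> U)"

lemma R_simps [simp]: "PObj R Y = PObj L' (PObj U Y)" "PArr R k = PArr L' (PArr U k)" "PCell R a = PCell L' (PCell U a)"
  by (simp_all add: R_def)

lemma pseudofunctor_R: "pseudofunctor A B R"
  unfolding R_def by (rule pseudofunctor_ps_comp[OF Ad.U.pseudofunctor_axioms Ad'.L.pseudofunctor_axioms])

lemma pseudonatural_counit: "pseudonatural A A (ps_comp A E R) (ps_id A) counit"
  unfolding R_def counit_def
  by (rule pseudonatural_comp_assoc[OF pseudonatural_tr_comp[OF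
        pseudonatural_tr_pre[OF Ad.U.pseudofunctor_axioms \<tau>.pseudonatural_axioms] Ad.\<epsilon>.pseudonatural_axioms]
      Ad.U.pseudofunctor_axioms Ad'.L.pseudofunctor_axioms E.pseudofunctor_axioms])

sublocale counit: pseudonatural A A "ps_comp A E R" "ps_id A" counit
  by (rule pseudonatural_counit)

lemma counit_arr: "TArr counit Y = TArr \<epsilon> Y \<odot>\<^bsub>A\<^esub> TArr \<tau> (PObj U Y)"
  by (simp add: counit_def)

lemma counit_simps [simp]:
  assumes "Y \<in> Obj A"
  shows "TArr counit Y \<in> Arr A" "src A (TArr counit Y) = PObj E (PObj L' (PObj U Y))" "tgt A (TArr counit Y) = Y"
  using counit.TArr_simps[OF assms] by simp_all

lemma counit_equivalence:
  assumes "Y \<in> Obj A"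
  shows "internal_equivalence A (TArr counit Y)"
  unfolding counit_arr
  using assms by (intro Ad.L.D.internal_equivalence_cmp1 \<tau>_equivalence Ad.counit_internal_equivalence[OF local_U]) simp_all

text \<open>Both biadjunctions are used on the 1-cell \<open>?n\<close>: it is inverted by
  \<open>L'\<close> through the primed triangle and by \<open>L\<close> through \<tau>. Its source
  \<open>U Y\<close> and its target, an object in the image of \<open>U'\<close>, then provide the
  two halves of a quasi-inverse.\<close>

lemma unit_equivalence:
  assumes Y: "Y \<in> Obj A"
  shows "internal_equivalence C (TArr \<eta>' (PObj U Y))"
proof -
  let ?c = "PObj U Y" let ?n = "TArr \<eta>' ?c"
  have c: "?c \<in> Obj C" "PObj L' ?c \<in> Obj B" and n: "?n \<in> Arr C" "src C ?n = ?c" "tgt C ?n = PObj U' (PObj L' ?c)"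
    using Y by auto
  have L'n: "internal_equivalence B (PArr L' ?n)"
    using c by (intro Ad'.PArr_unit_internal_equivalence Ad'.counit_internal_equivalence[OF local_U']) auto
  have "internal_equivalence A (TArr \<tau> (tgt C ?n) \<odot>\<^bsub>A\<^esub> PArr E (PArr L' ?n))"
    using n c by (intro Ad.L.D.internal_equivalence_cmp1 E.PArr_internal_equivalence L'n \<tau>_equivalence) auto
  moreover have "isom A (TArr \<tau> (tgt C ?n) \<odot>\<^bsub>A\<^esub> PArr E (PArr L' ?n)) (PArr L ?n \<odot>\<^bsub>A\<^esub> TArr \<tau> ?c)"
    using Ad.L.D.isom_sym[OF Ad.L.D.isomI[of "TCell \<tau> ?n"]] n by simp
  ultimately have "internal_equivalence A (PArr L ?n \<odot>\<^bsub>A\<^esub> TArr \<tau> ?c)"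
    by (rule Ad.L.D.internal_equivalence_isom)
  then have Ln: "internal_equivalence A (PArr L ?n)"
    by (rule Ad.L.D.internal_equivalence_cancel_right[OF \<tau>_equivalence[OF c(1)]]) (use n c in auto)
  \<comment> \<open>The retraction extends the identity of \<open>U Y\<close> along
    \<open>?n\<close>, possible because \<open>L\<close> inverts \<open>?n\<close>.\<close>
  obtain r where r: "r \<in> Arr C" "src C r = tgt C ?n" "tgt C r = ?c" "isom C (r \<odot>\<^bsub>C\<^esub> ?n) (id1 C ?c)"
    using Ad.extension_along[OF n(1) Ln Y, of "id1 C ?c"] n c by auto
  \<comment> \<open>\<open>?n \<odot> r\<close> and the identity agree after precomposition with
    \<open>?n\<close>; since their target lies in the image of \<open>U'\<close> and
    \<open>L'\<close> inverts \<open>?n\<close>, that factor can be cancelled.\<close>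
  have nrn: "isom C (?n \<odot>\<^bsub>C\<^esub> (r \<odot>\<^bsub>C\<^esub> ?n)) ?n"
    by (rule Ad.L.C.isom_id_right) (use r n c in simp_all)
  have "isom C (?n \<odot>\<^bsub>C\<^esub> r) (id1 C (tgt C ?n))"
    by (rule Ad'.isom_cancel_along[OF n(1) L'n c(2)]) (use nrn r n c in simp_all)
  then show ?thesis
    using r n by (intro Ad.L.C.internal_equivalenceI[of _ r]) simp_all
qed

section \<open>Transposition along the counit is an equivalence\<close>

definition "counit_transpose Y = fnc_comp (postcomp A (TArr counit Y)) (hom_functor E)"

lemma counit_transpose_simps [simp]:
  "FOb (counit_transpose Y) g = TArr counit Y \<odot>\<^bsub>A\<^esub> PArr E g" "FAr (counit_transpose Y) a = TArr counit Y \<rhd>\<^bsub>A\<^esub> PCell E a"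
  by (simp_all add: counit_transpose_def)

lemma functor_transpose:
  assumes "X \<in> Obj B" "Y \<in> Obj A"
  shows "functor_between (hom_cat B X (PObj R Y)) (hom_cat A (PObj E X) Y) (counit_transpose Y)"
  by (rule functor_between_hom_catI)
    (use assms in \<open>auto intro: Ad'.L.D.two_category_axioms Ad.L.D.two_category_axioms\<close>)

text \<open>The cells of \<tau>, whiskered by the counit of the first biadjunction, identify
  \<open>L'\<close> followed by transposition with the left transposition followed by precomposition
  with the component of \<tau>. As \<open>L'\<close> is an equivalence on these homs by
  \<open>unit_equivalence\<close>, it can be cancelled.\<close>

lemma weak_equivalence_transpose_L':
  assumes X: "X \<in> Obj C" and Y: "Y \<in> Obj A"
  shows "weak_equivalence (hom_cat B (PObj L' X) (PObj R Y)) (hom_cat A (PObj E (PObj L' X)) Y) (counit_transpose Y)"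
proof -
  let ?K = "hom_cat A (PObj E (PObj L' X)) Y"
  let ?J = "hom_cat C X (PObj U Y)"
  have UY: "PObj U Y \<in> Obj C" and L'X: "PObj L' X \<in> Obj B" using X Y by auto
  have wL': "weak_equivalence ?J (hom_cat B (PObj L' X) (PObj R Y)) (hom_functor L')"
    using Ad'.weak_equivalence_hom_functor[OF X UY unit_equivalence[OF Y]] by simp
  have wL: "weak_equivalence ?J ?K
      (fnc_comp (precomp A (TArr \<tau> X)) (Ad.left_transpose Y))"
    using X Y by (intro weak_equivalence_comp[OF Ad.weak_equivalence_left_transpose]
        Ad.L.D.weak_equivalence_precomp \<tau>_equivalence) auto
  have "natural_isomorphism ?J ?K
      (fnc_comp (precomp A (TArr \<tau> X)) (Ad.left_transpose Y)) (fnc_comp (counit_transpose Y) (hom_functor L'))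
      (\<lambda>f. TArr \<epsilon> Y \<rhd>\<^bsub>A\<^esub> TCell \<tau> f)"
  proof (rule natural_isomorphism_hom_catI)
    fix a assume a: "a \<in> Cell C" "src C (dom2 C a) = X" "tgt C (dom2 C a) = PObj U Y"
    show "FAr (fnc_comp (counit_transpose Y) (hom_functor L')) a \<cdot>\<^bsub>A\<^esub> (TArr \<epsilon> Y \<rhd>\<^bsub>A\<^esub> TCell \<tau> (dom2 C a))
      = (TArr \<epsilon> Y \<rhd>\<^bsub>A\<^esub> TCell \<tau> (cod2 C a)) \<cdot>\<^bsub>A\<^esub> FAr (fnc_comp (precomp A (TArr \<tau> X)) (Ad.left_transpose Y)) a"
      using arg_cong[OF \<tau>.TCell_natural_simp[OF a(1) refl refl a(2,3)], of "\<lambda>x. TArr \<epsilon> Y \<rhd>\<^bsub>A\<^esub> x"] a X Y UY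
      by (simp add: counit_arr)
  next
    show "functor_between ?J ?K (fnc_comp (counit_transpose Y) (hom_functor L'))"
      by (rule functor_between_comp[OF weak_equivalenceD(1)[OF wL'] functor_transpose[OF L'X Y]])
  qed (use X Y UY weak_equivalenceD(1)[OF wL] Ad.L.D.two_category_axioms in \<open>auto simp: counit_arr\<close>)
  then have "weak_equivalence ?J ?K (fnc_comp (counit_transpose Y) (hom_functor L'))"
    using wL by (rule weak_equivalence_natural_isomorphism)
  then show ?thesis
    by (rule weak_equivalence_left_factor[OF _ wL' functor_transpose[OF L'X Y]])
qed

text \<open>Precomposition with \<epsilon>' at \<open>X\<close> reduces the general case to objects
  in the image of \<open>L'\<close>: the square relating it to precomposition with the image of this
  1-cell under \<open>E\<close> commutes up to \<open>PCmp E\<close>.\<close>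

lemma weak_equivalence_transpose:
  assumes X: "X \<in> Obj B" and Y: "Y \<in> Obj A"
  shows "weak_equivalence (hom_cat B X (PObj R Y)) (hom_cat A (PObj E X) Y) (counit_transpose Y)"
proof -
  let ?J = "hom_cat B X (PObj R Y)"
  let ?X = "PObj L' (PObj U' X)" and ?e = "TArr \<epsilon>' X"
  have obs: "PObj U' X \<in> Obj C" "?X \<in> Obj B" "PObj R Y \<in> Obj B" using X Y by auto
  have e: "internal_equivalence B ?e"
    using X by (rule Ad'.counit_internal_equivalence[OF local_U'])
  have wB: "weak_equivalence ?J (hom_cat B ?X (PObj R Y)) (precomp B ?e)"
    using X Y by (intro Ad'.L.D.weak_equivalence_precomp e) auto
  have wA: "weak_equivalence (hom_cat A (PObj E X) Y) (hom_cat A (PObj E ?X) Y) (precomp A (PArr E ?e))"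
    using X Y by (intro Ad.L.D.weak_equivalence_precomp E.PArr_internal_equivalence e) auto
  have w: "weak_equivalence ?J (hom_cat A (PObj E ?X) Y) (fnc_comp (counit_transpose Y) (precomp B ?e))"
    by (rule weak_equivalence_comp[OF wB weak_equivalence_transpose_L'[OF obs(1) Y]])
  have "natural_isomorphism ?J (hom_cat A (PObj E ?X) Y)
      (fnc_comp (precomp A (PArr E ?e)) (counit_transpose Y)) (fnc_comp (counit_transpose Y) (precomp B ?e))
      (\<lambda>g. TArr counit Y \<rhd>\<^bsub>A\<^esub> PCmp E g ?e)"
  proof (rule natural_isomorphism_hom_catI)
    fix a assume a: "a \<in> Cell B" "src B (dom2 B a) = X" "tgt B (dom2 B a) = PObj R Y"
    have "PCmp E (cod2 B a) ?e \<cdot>\<^bsub>A\<^esub> (PCell E a \<lhd>\<^bsub>A\<^esub> PArr E ?e) = PCell E (a \<lhd>\<^bsub>B\<^esub> ?e) \<cdot>\<^bsub>A\<^esub> PCmp E (dom2 B a) ?e"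
      using a X by (intro E.PCmp_rwhisk) auto
    from arg_cong[OF this, of "\<lambda>x. TArr counit Y \<rhd>\<^bsub>A\<^esub> x"]
    show "FAr (fnc_comp (counit_transpose Y) (precomp B ?e)) a \<cdot>\<^bsub>A\<^esub> (TArr counit Y \<rhd>\<^bsub>A\<^esub> PCmp E (dom2 B a) ?e)
      = (TArr counit Y \<rhd>\<^bsub>A\<^esub> PCmp E (cod2 B a) ?e) \<cdot>\<^bsub>A\<^esub> FAr (fnc_comp (precomp A (PArr E ?e)) (counit_transpose Y)) a"
      using a X Y by simp
  next
    show "functor_between ?J (hom_cat A (PObj E ?X) Y) (fnc_comp (precomp A (PArr E ?e)) (counit_transpose Y))"
      by (rule functor_between_comp[OF functor_transpose[OF X Y] weak_equivalenceD(1)[OF wA]])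
  qed (use X Y weak_equivalenceD(1)[OF w] Ad.L.D.two_category_axioms in auto)
  then have "weak_equivalence ?J (hom_cat A (PObj E ?X) Y) (fnc_comp (precomp A (PArr E ?e)) (counit_transpose Y))"
    using natural_isomorphism_sym weak_equivalence_natural_isomorphism[OF _ w] by blast
  then show ?thesis
    by (rule weak_equivalence_right_factor[OF _ wA functor_transpose[OF X Y]])
qed

text \<open>The cells of the counit identify \<open>R\<close> followed by transposition with
  precomposition with the counit at \<open>Y\<close>. Both the latter and transposition are
  equivalences, so \<open>R\<close> is one on homs.\<close>

lemma local_equivalence_R: "local_equivalence A B R"
  unfolding local_equivalence_def
proof (intro ballI weak_equivalence_imp_equivalence)
  fix Y Z assume Y: "Y \<in> Obj A" and Z: "Z \<in> Obj A"
  interpret R: pseudofunctor A B R by (rule pseudofunctor_R)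
  have RY: "PObj R Y \<in> Obj B" using Y by simp
  have w: "weak_equivalence (hom_cat A Y Z) (hom_cat A (PObj E (PObj R Y)) Z) (precomp A (TArr counit Y))"
    using Y Z by (intro Ad.L.D.weak_equivalence_precomp counit_equivalence) auto
  have R: "functor_between (hom_cat A Y Z) (hom_cat B (PObj R Y) (PObj R Z)) (hom_functor R)"
    using Y Z by (rule R.hom_functor)
  have "natural_isomorphism (hom_cat A Y Z) (hom_cat A (PObj E (PObj R Y)) Z)
      (precomp A (TArr counit Y)) (fnc_comp (counit_transpose Z) (hom_functor R)) (TCell counit)"
  proof (rule natural_isomorphism_hom_catI)
    fix a assume a: "a \<in> Cell A" "src A (dom2 A a) = Y" "tgt A (dom2 A a) = Z"
    show "FAr (fnc_comp (counit_transpose Z) (hom_functor R)) a \<cdot>\<^bsub>A\<^esub> TCell counit (dom2 A a)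
      = TCell counit (cod2 A a) \<cdot>\<^bsub>A\<^esub> FAr (precomp A (TArr counit Y)) a"
      using counit.TCell_natural_simp[OF a(1) refl refl a(2,3)] by simp
  next
    show "functor_between (hom_cat A Y Z) (hom_cat A (PObj E (PObj R Y)) Z) (fnc_comp (counit_transpose Z) (hom_functor R))"
      by (rule functor_between_comp[OF R functor_transpose[OF RY Z]])
  next
    fix f assume "f \<in> Arr A" "src A f = Y" "tgt A f = Z"
    then show "isocell A (TCell counit f) \<and> dom2 A (TCell counit f) = FOb (precomp A (TArr counit Y)) f \<and>
        cod2 A (TCell counit f) = FOb (fnc_comp (counit_transpose Z) (hom_functor R)) f"
      using counit.TCell_simps[of f] by simp
  qed (use weak_equivalenceD(1)[OF w] Ad.L.D.two_category_axioms in auto)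
  then have "weak_equivalence (hom_cat A Y Z) (hom_cat A (PObj E (PObj R Y)) Z) (fnc_comp (counit_transpose Z) (hom_functor R))"
    using w by (rule weak_equivalence_natural_isomorphism)
  then show "weak_equivalence (hom_cat A Y Z) (hom_cat B (PObj R Y) (PObj R Z)) (hom_functor R)"
    by (rule weak_equivalence_right_factor[OF _ weak_equivalence_transpose[OF RY Z] R])
qed

text \<open>Full faithfulness of the transposition is the axiom \<open>universal\<close>, and its
  essential surjectivity at the identity of \<open>E X\<close> provides the unit 1-cell together
  with the first triangle isomorphism.\<close>

lemma left_biadjoint_R: "left_biadjoint B A E R"
proof -
  interpret R: pseudofunctor A B R by (rule pseudofunctor_R)
  have "\<exists>g i. g \<in> Arr B \<and> src B g = X \<and> tgt B g = PObj R (PObj E X) \<and> isocell A i \<and>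
      dom2 A i = id1 A (PObj E X) \<and> cod2 A i = TArr counit (PObj E X) \<odot>\<^bsub>A\<^esub> PArr E g" if X: "X \<in> Obj B" for X
  proof -
    have EX: "PObj E X \<in> Obj A" using X by simp
    obtain g where g: "g \<in> Arr B" "src B g = X" "tgt B g = PObj R (PObj E X)"
      "isom A (TArr counit (PObj E X) \<odot>\<^bsub>A\<^esub> PArr E g) (id1 A (PObj E X))"
      using weak_equivalence_essentially_surjective[OF weak_equivalence_transpose[OF X EX] Ad.L.D.two_category_axioms,
          of "id1 A (PObj E X)"] EX by auto
    obtain i where "isocell A i" "dom2 A i = id1 A (PObj E X)" "cod2 A i = TArr counit (PObj E X) \<odot>\<^bsub>A\<^esub> PArr E g"
      using Ad.L.D.isom_sym[OF g(4)] by (auto simp: isom_def)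
    with g show ?thesis by blast
  qed
  then obtain u i where ui: "\<And>X. X \<in> Obj B \<Longrightarrow> u X \<in> Arr B \<and> src B (u X) = X \<and> tgt B (u X) = PObj R (PObj E X) \<and>
      isocell A (i X) \<and> dom2 A (i X) = id1 A (PObj E X) \<and> cod2 A (i X) = TArr counit (PObj E X) \<odot>\<^bsub>A\<^esub> PArr E (u X)"
    by metis
  interpret universal_counit B A E R counit u i
  proof (intro universal_counit.intro universal_counit_axioms.intro E.pseudofunctor_axioms R.pseudofunctor_axioms
      pseudonatural_counit)
    fix Y g g'
    assume g: "Y \<in> Obj A" "g \<in> Arr B" "g' \<in> Arr B" "src B g' = src B g" "tgt B g = PObj R Y" "tgt B g' = PObj R Y"
    have "src B g \<in> Obj B" using g by simp
    from weak_equivalence_transpose[OF this g(1)]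
    have "bij_betw (FAr (counit_transpose Y)) (Hom (hom_cat B (src B g) (PObj R Y)) g g')
      (Hom (hom_cat A (PObj E (src B g)) Y) (FOb (counit_transpose Y) g) (FOb (counit_transpose Y) g'))"
      unfolding weak_equivalence_def using g by auto
    moreover have "Hom (hom_cat B (src B g) (PObj R Y)) g g' = hom2 B g g'"
      "Hom (hom_cat A (PObj E (src B g)) Y) (FOb (counit_transpose Y) g) (FOb (counit_transpose Y) g')
        = hom2 A (TArr counit Y \<odot>\<^bsub>A\<^esub> PArr E g) (TArr counit Y \<odot>\<^bsub>A\<^esub> PArr E g')"
      using g by auto
    ultimately show "bij_betw (\<lambda>\<alpha>. TArr counit Y \<rhd>\<^bsub>A\<^esub> PCell E \<alpha>) (hom2 B g g')
        (hom2 A (TArr counit Y \<odot>\<^bsub>A\<^esub> PArr E g) (TArr counit Y \<odot>\<^bsub>A\<^esub> PArr E g'))"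
      by (simp add: counit_transpose_def fnc_comp_def postcomp_def hom_functor_def)
  qed (use ui in simp_all)
  show ?thesis
    unfolding left_biadjoint_def using biadjunction by blast
qed

end

theorem theorem2p21:
  fixes A :: "('oa, 'ma, 'ca) two_cat"
    and B :: "('ob, 'mb, 'cb) two_cat"
    and C :: "('oc, 'mc, 'cc) two_cat"
    and L :: "('oc, 'mc, 'cc, 'oa, 'ma, 'ca) psfun"
    and U :: "('oa, 'ma, 'ca, 'oc, 'mc, 'cc) psfun"
    and L' :: "('oc, 'mc, 'cc, 'ob, 'mb, 'cb) psfun"
    and U' :: "('ob, 'mb, 'cb, 'oc, 'mc, 'cc) psfun"
    and E :: "('ob, 'mb, 'cb, 'oa, 'ma, 'ca) psfun"
  assumes "two_category A" and "two_category B" and "two_category C"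
    and "pseudofunctor C A L" and "pseudofunctor A C U" and "left_biadjoint C A L U"
    and "pseudofunctor C B L'" and "pseudofunctor B C U'" and "left_biadjoint C B L' U'"
    and "local_equivalence A C U" and "local_equivalence B C U'"
    and "pseudofunctor B A E"
    and "\<exists>\<tau>. pseudonatural_equivalence C A (ps_comp A E L') L \<tau>"
  shows "\<exists>R. pseudofunctor A B R \<and> left_biadjoint B A E R \<and> local_equivalence A B R"
proof -
  obtain \<eta> \<epsilon> s t where Ad: "biadjunction C A L U \<eta> \<epsilon> s t"
    using \<open>left_biadjoint C A L U\<close> unfolding left_biadjoint_def by blast
  obtain \<eta>' \<epsilon>' s' t' where Ad': "biadjunction C B L' U' \<eta>' \<epsilon>' s' t'"
    using \<open>left_biadjoint C B L' U'\<close> unfolding left_biadjoint_def by blast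
  obtain \<tau> where \<tau>: "pseudonatural_equivalence C A (ps_comp A E L') L \<tau>"
    using assms by blast
  then have "pseudonatural C A (ps_comp A E L') L \<tau>"
    by (simp add: pseudonatural_equivalence_def)
  then interpret comparison A B C L U \<eta> \<epsilon> s t L' U' \<eta>' \<epsilon>' s' t' E \<tau>
    using Ad Ad' \<tau> \<open>pseudofunctor B A E\<close> \<open>local_equivalence A C U\<close> \<open>local_equivalence B C U'\<close>
    by (intro comparison.intro comparison_axioms.intro pseudonatural_equivalence_component)
  show ?thesis
    using pseudofunctor_R left_biadjoint_R local_equivalence_R by blast
qed

end
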